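(* Let $1<p<\infty$, $p\neq2$. Then $\ell_p$ admits a continuum of renormings (i.e. a family, of cardinality $\mathfrak{c}$, of equivalent norms) whose isometry groups are maximal and are pairwise non-conjugate in the isomorphism group of $\ell_p$.
   Context: $\ell_p$ is real or complex. For an equivalent norm $\|\cdot\|$ on $X$, $\operatorname{Isom}(X,\|\cdot\|)$ is the group of surjective linear isometries. It is maximal if whenever $|||\cdot|||$ is an equivalent norm on $X$ with $\operatorname{Isom}(X,\|\cdot\|)\subseteq\operatorname{Isom}(X,|||\cdot|||)$, then the two groups are equal (equivalently, $\operatorname{Isom}(X,\|\cdot\|)$ is a maximal bounded subgroup of the group $\mathrm{GL}(X)$ of isomorphisms of $X$ onto $X$). Subgroups $G_1,G_2$ of $\mathrm{GL}(X)$ are conjugate if $G_1=T^{-1}G_2T$ for some $T\in\mathrm{GL}(X)$. *)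

theory Defs
  imports Complex_Main "HOL-Library.Equipollence" "HOL-Algebra.Bij" "HOL-Algebra.Coset"
begin

text \<open>
  The exponent is a term variable, so \<open>\<ell>\<^sub>p\<close> is a carrier set of scalar sequences rather than a
  type. The scalar field \<open>'k\<close> is instantiated to \<^typ>\<open>real\<close> or \<^typ>\<open>complex\<close>.
\<close>

definition lp :: "real \<Rightarrow> (nat \<Rightarrow> 'k::real_normed_field) set" where
  "lp p = {x. summable (\<lambda>n. norm (x n) powr p)}"

definition lp_norm :: "real \<Rightarrow> (nat \<Rightarrow> 'k::real_normed_field) \<Rightarrow> real" where
  "lp_norm p x = (\<Sum>n. norm (x n) powr p) powr (1 / p)"

definition linear_on_lp ::
    "real \<Rightarrow> ((nat \<Rightarrow> 'k::real_normed_field) \<Rightarrow> (nat \<Rightarrow> 'k)) \<Rightarrow> bool" where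
  "linear_on_lp p T \<longleftrightarrow>
     (\<forall>x\<in>lp p. \<forall>y\<in>lp p. T (\<lambda>n. x n + y n) = (\<lambda>n. T x n + T y n)) \<and>
     (\<forall>c. \<forall>x\<in>lp p. T (\<lambda>n. c * x n) = (\<lambda>n. c * T x n))"

text \<open>
  Norms are total functions whose values outside \<^term>\<open>lp p\<close> are irrelevant.
\<close>

definition norm_on_lp :: "real \<Rightarrow> ((nat \<Rightarrow> 'k::real_normed_field) \<Rightarrow> real) \<Rightarrow> bool" where
  "norm_on_lp p N \<longleftrightarrow>
     (\<forall>x\<in>lp p. 0 \<le> N x) \<and>
     (\<forall>x\<in>lp p. N x = 0 \<longleftrightarrow> x = (\<lambda>n. 0)) \<and>
     (\<forall>c. \<forall>x\<in>lp p. N (\<lambda>n. c * x n) = norm c * N x) \<and>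
     (\<forall>x\<in>lp p. \<forall>y\<in>lp p. N (\<lambda>n. x n + y n) \<le> N x + N y)"

definition equivalent_norm :: "real \<Rightarrow> ((nat \<Rightarrow> 'k::real_normed_field) \<Rightarrow> real) \<Rightarrow> bool" where
  "equivalent_norm p N \<longleftrightarrow> norm_on_lp p N \<and>
     (\<exists>a>0. \<exists>b>0. \<forall>x\<in>lp p. a * lp_norm p x \<le> N x \<and> N x \<le> b * lp_norm p x)"

text \<open>
  Operators are extensional functions, so that two of them are equal as soon as they agree on
  \<^term>\<open>lp p\<close>; multiplication is the composition inherited from \<^const>\<open>BijGroup\<close>.
  The last condition says that the inverse operator is bounded.
\<close>

definition GL_lp :: "real \<Rightarrow> ((nat \<Rightarrow> 'k::real_normed_field) \<Rightarrow> (nat \<Rightarrow> 'k)) monoid" where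
  "GL_lp p = (BijGroup (lp p))
     \<lparr>carrier := {T \<in> Bij (lp p). linear_on_lp p T \<and>
        (\<exists>C. \<forall>x\<in>lp p. lp_norm p (T x) \<le> C * lp_norm p x) \<and>
        (\<exists>C. \<forall>x\<in>lp p. lp_norm p x \<le> C * lp_norm p (T x))}\<rparr>"

definition Isom ::
    "real \<Rightarrow> ((nat \<Rightarrow> 'k::real_normed_field) \<Rightarrow> real) \<Rightarrow> ((nat \<Rightarrow> 'k) \<Rightarrow> (nat \<Rightarrow> 'k)) set" where
  "Isom p N = {T \<in> extensional (lp p). T ` lp p = lp p \<and> linear_on_lp p T \<and>
     (\<forall>x\<in>lp p. N (T x) = N x)}"

definition maximal_Isom :: "real \<Rightarrow> ((nat \<Rightarrow> 'k::real_normed_field) \<Rightarrow> real) \<Rightarrow> bool" where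
  "maximal_Isom p N \<longleftrightarrow>
     (\<forall>M. equivalent_norm p M \<longrightarrow> Isom p N \<subseteq> Isom p M \<longrightarrow> Isom p N = Isom p M)"

definition conjugate_in :: "('a, 'b) monoid_scheme \<Rightarrow> 'a set \<Rightarrow> 'a set \<Rightarrow> bool" where
  "conjugate_in G H K \<longleftrightarrow> (\<exists>t\<in>carrier G. H = inv\<^bsub>G\<^esub> t <#\<^bsub>G\<^esub> (K #>\<^bsub>G\<^esub> t))"

end

theory Submission
  imports Defs "HOL-Analysis.Analysis" "HOL-Library.Function_Algebras"
begin

text \<open>
  The renormings come from isomorphisms of \<open>\<ell>\<^sub>p\<close> with \<open>\<ell>\<^sub>p\<close>-sums of Euclidean spaces (blocks) in which the set
  of dimensions is an arbitrary subset of the integers \<open>\<ge> 3\<close> containing 3, and every dimension that occurs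
  occurs infinitely often. By Khintchine's inequality the Rademacher functions span uniformly complemented,
  uniformly Euclidean subspaces of \<open>\<ell>\<^sub>p\<close> over the cubes, and an Eilenberg swindle splits them off.

  Let M be an equivalent norm that is invariant under all isometries of the sum, and call an operator A
  skew if \<open>M (x + t A x) \<le> (1 + O(t\<^sup>2)) M x\<close>. Skew operators form a real vector space that is stable under
  conjugation by isometries. If a skew operator had a nonzero matrix entry between two blocks, then
  compressing with sign changes would leave an operator on the plane of two unit vectors \<open>e, f\<close> from
  different blocks, and boundedness forces this operator to generate a rotation. Adding up its copies over
  m blocks of equal dimension gives a rotation that carries e to a multiple of \<open>(f\<^sub>1 + \<dots> + f\<^sub>m) / \<surd>m\<close>, whose
  norm is of the order \<open>m powr (1/p - 1/2)\<close>: impossible for \<open>p \<noteq> 2\<close>. Hence skew operators are block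
  diagonal. An isometry T between two such invariant norms conjugates the plane rotations inside a block to
  block diagonal operators, and since the blocks have dimension at least 3, T must map blocks onto blocks.
  So T preserves the Euclidean norms of the blocks (maximality) and the set of dimensions (non-conjugacy).
\<close>

text \<open>Nothing is known about M beyond equivalence and invariance, so its isometries are
  studied infinitesimally, through an inequality of first order that replaces one-parameter groups
  and avoids exponentials. Keeping M arbitrary serves both goals: for maximality M is a competing
  norm, for conjugacy it is a renorming carried back by the conjugating operator.

  Dimension 3 is where the argument starts because the rotations of a real plane commute with one
  another, so an operator commuting with them need not be scalar. Infinite multiplicity supplies
  arbitrarily large m in the growth comparison. The dimension 3 always occurs because the swindle
  leaves over a copy of \<open>lp p\<close>, whose coordinates are then grouped in triples; a set A
  of natural numbers contributes the dimensions a + 4, which are distinct from 3, and there are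
  continuum many such A.

  Khintchine's inequality is used from above only, for p and for the conjugate exponent: the second
  use bounds the projection by duality, and the projection being a left inverse gives the lower
  bound for the embedding.\<close>

text \<open>The assumption is the only place where the real and the complex field differ.\<close>

class scalar_field = real_normed_field + euclidean_space +
  assumes square_root_dichotomy:
    "(\<exists>r. z = (- (r\<^sup>2)) *\<^sub>R 1) \<or> (\<exists>w. w * w = z \<and> inner 1 w \<noteq> 0)"

instance real :: scalar_field
proof
  fix z :: real
  show "(\<exists>r. z = (- (r\<^sup>2)) *\<^sub>R 1) \<or> (\<exists>w. w * w = z \<and> inner 1 w \<noteq> 0)"
  proof (cases "z > 0")
    case True
    then show ?thesis by (intro disjI2 exI[of _ "sqrt z"]) auto
  next
    case False
    then show ?thesis by (intro disjI1 exI[of _ "sqrt (- z)"]) auto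
  qed
qed

instance complex :: scalar_field
proof
  fix z :: complex
  show "(\<exists>r. z = (- (r\<^sup>2)) *\<^sub>R 1) \<or> (\<exists>w. w * w = z \<and> inner 1 w \<noteq> 0)"
  proof (cases "Re (csqrt z) = 0")
    case True
    have "z = (csqrt z)\<^sup>2" by simp
    also have "\<dots> = (- ((Im (csqrt z))\<^sup>2)) *\<^sub>R 1"
      using True by (simp add: complex_eq_iff power2_eq_square)
    finally show ?thesis by blast
  next
    case False
    then show ?thesis
      by (intro disjI2 exI[of _ "csqrt z"]) (auto simp: inner_complex_def simp flip: power2_eq_square)
  qed
qed

section \<open>Scalar functions on an index set as a vector space\<close>

definition smul :: "'k::field \<Rightarrow> ('i \<Rightarrow> 'k) \<Rightarrow> ('i \<Rightarrow> 'k)" where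
  "smul c x = (\<lambda>i. c * x i)"

lemma smul_apply [simp]: "smul c x i = c * x i"
  by (simp add: smul_def)

interpretation fs: vector_space smul
  by standard (auto simp: smul_def fun_eq_iff algebra_simps)

definition lin_on :: "('i \<Rightarrow> 'k::field) set \<Rightarrow> (('i \<Rightarrow> 'k) \<Rightarrow> ('j \<Rightarrow> 'k)) \<Rightarrow> bool" where
  "lin_on V T \<longleftrightarrow> (\<forall>x\<in>V. \<forall>y\<in>V. T (x + y) = T x + T y) \<and> (\<forall>c. \<forall>x\<in>V. T (smul c x) = smul c (T x))"

definition nrm_on :: "('i \<Rightarrow> 'k::real_normed_field) set \<Rightarrow> (('i \<Rightarrow> 'k) \<Rightarrow> real) \<Rightarrow> bool" where
  "nrm_on V M \<longleftrightarrow> (\<forall>x\<in>V. 0 \<le> M x) \<and> (\<forall>x\<in>V. M x = 0 \<longleftrightarrow> x = 0) \<and>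
     (\<forall>c. \<forall>x\<in>V. M (smul c x) = norm c * M x) \<and> (\<forall>x\<in>V. \<forall>y\<in>V. M (x + y) \<le> M x + M y)"

section \<open>Sums of Euclidean blocks\<close>

text \<open>Convexity at positive arguments, extended to zero arguments by
  \<open>s powr p \<le> s\<close> on the unit interval, because block norms may vanish.\<close>

lemma powr_convex_nonneg:
  fixes p u v s t :: real
  assumes "1 \<le> p" "0 \<le> u" "0 \<le> v" "0 \<le> s" "0 \<le> t" "s + t = 1"
  shows "(s * u + t * v) powr p \<le> s * u powr p + t * v powr p"
proof -
  have *: "(s * u) powr p \<le> s * u powr p" if "0 \<le> s" "s \<le> 1" "0 \<le> u" for s u :: real
  proof -
    have "s powr p \<le> s"
    proof (cases "s = 0")
      case False
      then show ?thesis using powr_mono'[of 1 p s] that assms by simp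
    qed simp
    then show ?thesis using that by (simp add: powr_mult mult_right_mono)
  qed
  show ?thesis
  proof (cases "u = 0 \<or> v = 0")
    case True
    then show ?thesis using *[of s u] *[of t v] assms by auto
  next
    case False
    then have "u > 0" "v > 0" using assms by auto
    then show ?thesis
      using convex_onD[OF powr_convex[OF \<open>1 \<le> p\<close>], of t u v] assms(4-6)
      by (simp add: eq_diff_eq[symmetric])
  qed
qed

lemma infsum_nonneg_eq_0:
  fixes f :: "'b \<Rightarrow> real"
  assumes "f summable_on UNIV" "\<And>b. 0 \<le> f b" "infsum f UNIV = 0"
  shows "f b = 0"
  using nonneg_infsum_le_0D[of f UNIV b] assms by auto

text \<open>With A and B the two p-norms, f + g is A + B times the convex combination of f / A and g
  / B with weights A / (A + B) and B / (A + B). Pointwise convexity gives a summable majorant, hence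
  both claims. If A or B is zero, one of the functions vanishes.\<close>

lemma minkowski_infsum:
  fixes f g :: "'b \<Rightarrow> real"
  assumes p: "1 \<le> p" and f: "\<And>b. 0 \<le> f b" and g: "\<And>b. 0 \<le> g b"
    and sf: "(\<lambda>b. f b powr p) summable_on UNIV" and sg: "(\<lambda>b. g b powr p) summable_on UNIV"
  shows "(\<lambda>b. (f b + g b) powr p) summable_on UNIV" (is ?A)
    and "infsum (\<lambda>b. (f b + g b) powr p) UNIV powr (1/p)
      \<le> infsum (\<lambda>b. f b powr p) UNIV powr (1/p) + infsum (\<lambda>b. g b powr p) UNIV powr (1/p)" (is ?B)
proof -
  define A where "A = infsum (\<lambda>b. f b powr p) UNIV powr (1/p)"
  define B where "B = infsum (\<lambda>b. g b powr p) UNIV powr (1/p)"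
  have Ap: "A powr p = infsum (\<lambda>b. f b powr p) UNIV" and Bp: "B powr p = infsum (\<lambda>b. g b powr p) UNIV"
    using p by (auto simp: A_def B_def powr_powr infsum_nonneg)
  have "?A \<and> ?B"
  proof (cases "A = 0 \<or> B = 0")
    case True
    then show ?thesis
    proof
      assume "A = 0"
      then have "f b powr p = 0" for b
        using infsum_nonneg_eq_0[OF sf] Ap p by auto
      then have "f b = 0" for b by auto
      then show ?thesis using sg by simp
    next
      assume "B = 0"
      then have "g b powr p = 0" for b
        using infsum_nonneg_eq_0[OF sg] Bp p by auto
      then have "g b = 0" for b by auto
      then show ?thesis using sf by simp
    qed
  next
    case False
    then have AB: "A > 0" "B > 0" by (auto simp: A_def B_def less_le)
    define h where "h b = (A+B) powr p * (A / (A+B) * (f b powr p / A powr p) + B / (A+B) * (g b powr p / B powr p))" for b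
    have AB1: "A/(A+B) + B/(A+B) = 1" using AB by (simp flip: add_divide_distrib)
    have le: "(f b + g b) powr p \<le> h b" for b
    proof -
      have "(f b + g b) = (A+B) * (A/(A+B) * (f b / A) + B/(A+B) * (g b/B))"
      proof -
        have "(A+B) * (A/(A+B) * (f b / A)) = f b" "(A+B) * (B/(A+B) * (g b / B)) = g b"
          using AB by (simp_all add: divide_simps)
        then show ?thesis by (simp only: distrib_left)
      qed
      then have "(f b + g b) powr p = (A+B) powr p * (A/(A+B) * (f b / A) + B/(A+B) * (g b/B)) powr p"
        using AB f g by (simp add: powr_mult)
      also have "\<dots> \<le> (A+B) powr p * (A/(A+B) * (f b / A) powr p + B/(A+B) * (g b/B) powr p)"
        using AB f g p by (intro mult_left_mono powr_convex_nonneg AB1) auto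
      also have "\<dots> = h b" using AB f g by (simp add: h_def powr_divide)
      finally show ?thesis .
    qed
    have hs1: "(\<lambda>b. A / (A+B) * (f b powr p / A powr p)) summable_on UNIV"
      using summable_on_cmult_right[OF sf, of "A/(A+B)/A powr p"] by (simp add: field_simps)
    have hs2: "(\<lambda>b. B / (A+B) * (g b powr p / B powr p)) summable_on UNIV"
      using summable_on_cmult_right[OF sg, of "B/(A+B)/B powr p"] by (simp add: field_simps)
    have hs: "h summable_on UNIV"
      unfolding h_def by (intro summable_on_cmult_right summable_on_add hs1 hs2)
    have s: ?A
      by (rule summable_on_comparison_test[OF hs]) (use le in auto)
    have i1: "infsum (\<lambda>b. A / (A+B) * (f b powr p / A powr p)) UNIV = A/(A+B)"
      using infsum_cmult_right'[of "A/(A+B)/A powr p" "\<lambda>b. f b powr p" UNIV] AB by (simp flip: Ap)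
    have i2: "infsum (\<lambda>b. B / (A+B) * (g b powr p / B powr p)) UNIV = B/(A+B)"
      using infsum_cmult_right'[of "B/(A+B)/B powr p" "\<lambda>b. g b powr p" UNIV] AB by (simp flip: Bp)
    have "infsum (\<lambda>b. (f b + g b) powr p) UNIV \<le> infsum h UNIV"
      by (rule infsum_mono[OF s hs le])
    also have "\<dots> = (A+B) powr p * (A/(A+B) + B/(A+B))"
      unfolding h_def by (subst infsum_cmult_right') (simp only: infsum_add[OF hs1 hs2] i1 i2)
    also have "\<dots> = (A+B) powr p" using AB by (simp flip: add_divide_distrib)
    finally have "infsum (\<lambda>b. (f b + g b) powr p) UNIV powr (1/p) \<le> ((A+B) powr p) powr (1/p)"
      using p by (intro powr_mono2) (auto intro: infsum_nonneg)
    also have "\<dots> = A + B" using AB p by (simp add: powr_powr)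
    finally show ?thesis using s by (simp add: A_def B_def)
  qed
  then show ?A ?B by auto
qed

text \<open>A vector is a function on pairs of a block and a coordinate, and block b has dimension
  \<open>n b\<close>. Dimension 0 is allowed; it later marks indices that are absent.\<close>

definition blk :: "('b \<Rightarrow> nat) \<Rightarrow> ('b \<times> nat \<Rightarrow> 'k::real_normed_field) \<Rightarrow> 'b \<Rightarrow> real" where
  "blk n x b = L2_set (\<lambda>i. norm (x (b, i))) {..<n b}"

text \<open>Coordinates beyond the dimension are forced to be zero, so that equality of vectors is
  equality of functions.\<close>

definition bsp :: "real \<Rightarrow> ('b \<Rightarrow> nat) \<Rightarrow> ('b \<times> nat \<Rightarrow> 'k::real_normed_field) set" where
  "bsp p n = {x. (\<forall>b i. n b \<le> i \<longrightarrow> x (b, i) = 0) \<and> (\<lambda>b. blk n x b powr p) summable_on UNIV}"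

text \<open>The p-th power of the norm. It is additive over blocks, so the isomorphism estimates are
  made for it.\<close>

definition bsum :: "real \<Rightarrow> ('b \<Rightarrow> nat) \<Rightarrow> ('b \<times> nat \<Rightarrow> 'k::real_normed_field) \<Rightarrow> real" where
  "bsum p n x = infsum (\<lambda>b. blk n x b powr p) UNIV"

definition bnorm :: "real \<Rightarrow> ('b \<Rightarrow> nat) \<Rightarrow> ('b \<times> nat \<Rightarrow> 'k::real_normed_field) \<Rightarrow> real" where
  "bnorm p n x = bsum p n x powr (1 / p)"

definition ev :: "'i \<Rightarrow> ('i \<Rightarrow> 'k::real_normed_field)" where
  "ev \<beta> = (\<lambda>\<gamma>. if \<gamma> = \<beta> then 1 else 0)"

definition trunc :: "'b set \<Rightarrow> ('b \<times> nat \<Rightarrow> 'k::real_normed_field) \<Rightarrow> ('b \<times> nat \<Rightarrow> 'k)" where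
  "trunc F x = (\<lambda>\<gamma>. if fst \<gamma> \<in> F then x \<gamma> else 0)"

lemma blk_nonneg [simp]: "0 \<le> blk n x b"
  by (simp add: blk_def)

lemma blk_add: "blk n (x + y) b \<le> blk n x b + blk n y b"
proof -
  have "blk n (x + y) b \<le> L2_set (\<lambda>i. norm (x (b, i)) + norm (y (b, i))) {..<n b}"
    unfolding blk_def by (rule L2_set_mono) (auto simp: norm_triangle_ineq)
  also have "\<dots> \<le> blk n x b + blk n y b"
    unfolding blk_def by (rule L2_set_triangle_ineq)
  finally show ?thesis .
qed

lemma blk_smul: "blk n (smul c x) b = norm c * blk n x b"
  by (simp add: blk_def norm_mult L2_set_right_distrib)

lemma blk_eq_0_iff: "blk n x b = 0 \<longleftrightarrow> (\<forall>i<n b. x (b, i) = 0)"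
  by (auto simp: blk_def L2_set_eq_0_iff)

lemma norm_le_blk: "i < n b \<Longrightarrow> norm (x (b, i)) \<le> blk n x b"
  unfolding blk_def by (rule member_le_L2_set) auto

lemma blk_cong: "(\<And>i. i < n b \<Longrightarrow> norm (x (b,i)) = norm (y (c,i))) \<Longrightarrow> n b = n c \<Longrightarrow> blk n x b = blk n y c"
  by (simp add: blk_def L2_set_def)

lemma bspI: "(\<And>b i. n b \<le> i \<Longrightarrow> x (b, i) = 0) \<Longrightarrow> (\<lambda>b. blk n x b powr p) summable_on UNIV \<Longrightarrow> x \<in> bsp p n"
  by (auto simp: bsp_def)

lemma bsp_summable: "x \<in> bsp p n \<Longrightarrow> (\<lambda>b. blk n x b powr p) summable_on UNIV"
  by (auto simp: bsp_def)

lemma bsp_outside: "x \<in> bsp p n \<Longrightarrow> n b \<le> i \<Longrightarrow> x (b, i) = 0"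
  by (auto simp: bsp_def)

lemma bsum_nonneg [simp]: "0 \<le> bsum p n x"
  by (simp add: bsum_def infsum_nonneg)

lemma bnorm_nonneg [simp]: "0 \<le> bnorm p n x"
  by (simp add: bnorm_def)

lemma bsp_0: "0 \<in> bsp p n"
  by (auto simp: bsp_def blk_def L2_set_def)

lemma bsp_smul:
  assumes "x \<in> bsp p n"
  shows "smul c x \<in> bsp p n"
  using assms summable_on_cmult_right[OF bsp_summable[OF assms], of "norm c powr p"]
  by (auto simp: bsp_def blk_smul powr_mult)

lemma bnorm_smul:
  assumes "1 \<le> p"
  shows "bnorm p n (smul c x) = norm c * bnorm p n x"
  using assms
  by (simp add: bnorm_def bsum_def blk_smul powr_mult infsum_cmult_right' powr_powr infsum_nonneg)

lemma bsp_add_aux: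
  assumes p: "1 \<le> p" and x: "x \<in> bsp p n" and y: "y \<in> bsp p n"
  shows "x + y \<in> bsp p n \<and> bnorm p n (x + y) \<le> bnorm p n x + bnorm p n y"
proof -
  note m = minkowski_infsum[OF p blk_nonneg blk_nonneg bsp_summable[OF x] bsp_summable[OF y]]
  have le: "blk n (x + y) b powr p \<le> (blk n x b + blk n y b) powr p" for b
    using p blk_add by (intro powr_mono2) auto
  have s: "(\<lambda>b. blk n (x + y) b powr p) summable_on UNIV"
    by (rule summable_on_comparison_test[OF m(1)]) (use le in auto)
  have "bsum p n (x + y) \<le> infsum (\<lambda>b. (blk n x b + blk n y b) powr p) UNIV"
    unfolding bsum_def by (rule infsum_mono[OF s m(1) le])
  then have "bnorm p n (x + y) \<le> infsum (\<lambda>b. (blk n x b + blk n y b) powr p) UNIV powr (1/p)"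
    unfolding bnorm_def using p by (intro powr_mono2) auto
  then show ?thesis using m(2) s x y by (auto simp: bnorm_def bsum_def bsp_def)
qed

lemmas bsp_add = bsp_add_aux[THEN conjunct1]
lemmas bnorm_triangle = bsp_add_aux[THEN conjunct2]

lemma bsp_subspace: "1 \<le> p \<Longrightarrow> fs.subspace (bsp p n)"
  by (auto simp: fs.subspace_def bsp_0 bsp_add bsp_smul)

lemma blk_le_bnorm:
  assumes "1 \<le> p" "x \<in> bsp p n"
  shows "blk n x b \<le> bnorm p n x"
proof -
  have "blk n x b powr p \<le> bsum p n x"
    using infsum_mono2[of "\<lambda>b. blk n x b powr p" "{b}" UNIV] bsp_summable[OF assms(2)] by (simp add: bsum_def)
  then have "(blk n x b powr p) powr (1/p) \<le> bnorm p n x"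
    unfolding bnorm_def using assms by (intro powr_mono2) auto
  then show ?thesis using assms by (simp add: powr_powr)
qed

lemma norm_le_bnorm:
  assumes "1 \<le> p" "x \<in> bsp p n"
  shows "norm (x \<gamma>) \<le> bnorm p n x"
proof (cases "snd \<gamma> < n (fst \<gamma>)")
  case True
  then show ?thesis using norm_le_blk[of "snd \<gamma>" n "fst \<gamma>" x] blk_le_bnorm[OF assms, of "fst \<gamma>"] by simp
next
  case False
  then have "x \<gamma> = 0" using bsp_outside[OF assms(2), of "fst \<gamma>" "snd \<gamma>"] by simp
  then show ?thesis by simp
qed

lemma bnorm_eq_0_iff:
  assumes "1 \<le> p" "x \<in> bsp p n"
  shows "bnorm p n x = 0 \<longleftrightarrow> x = 0"
proof
  assume "bnorm p n x = 0"
  then show "x = 0" using norm_le_bnorm[OF assms] by (auto simp: fun_eq_iff)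
next
  assume "x = 0"
  then show "bnorm p n x = 0" using bnorm_smul[OF assms(1), of n 0 x] by simp
qed

lemma nrm_on_bnorm: "1 \<le> p \<Longrightarrow> nrm_on (bsp p n) (bnorm p n)"
  by (auto simp: nrm_on_def bnorm_eq_0_iff bnorm_smul bnorm_triangle)

lemma blk_ev: "snd \<beta> < n (fst \<beta>) \<Longrightarrow> blk n (ev \<beta> :: _ \<Rightarrow> 'k::real_normed_field) b = (if b = fst \<beta> then 1 else 0)"
proof -
  assume *: "snd \<beta> < n (fst \<beta>)"
  have "(\<Sum>i<n b. (norm (ev \<beta> (b, i) :: 'k))\<^sup>2) = (\<Sum>i<n b. if i = snd \<beta> \<and> b = fst \<beta> then 1 else 0)"
    by (rule sum.cong) (auto simp: ev_def)
  also have "\<dots> = (if b = fst \<beta> then 1 else 0)"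
    using * by (cases "b = fst \<beta>") auto
  finally show ?thesis by (simp add: blk_def L2_set_def)
qed

lemma bsp_finite_support:
  assumes "1 \<le> p" "\<And>b i. n b \<le> i \<Longrightarrow> x (b, i) = 0" "finite F" "\<And>b i. b \<notin> F \<Longrightarrow> x (b, i) = 0"
  shows "x \<in> bsp p n" "bsum p n x = (\<Sum>b\<in>F. blk n x b powr p)"
proof -
  have 0: "blk n x b powr p = 0" if "b \<in> UNIV - F" for b
    using assms(4) that by (auto simp: blk_eq_0_iff)
  show "x \<in> bsp p n"
    unfolding bsp_def by (simp add: assms(2), subst summable_on_cong_neutral[where S = UNIV and T = F and g = "\<lambda>b. blk n x b powr p"])
      (use 0 assms(3) in auto)
  show "bsum p n x = (\<Sum>b\<in>F. blk n x b powr p)"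
    unfolding bsum_def
    by (subst infsum_cong_neutral[where S = UNIV and T = F and g = "\<lambda>b. blk n x b powr p"])
      (use 0 assms(3) in auto)
qed

lemma ev_bsp: "1 \<le> p \<Longrightarrow> snd \<beta> < n (fst \<beta>) \<Longrightarrow> ev \<beta> \<in> bsp p n"
  by (rule bsp_finite_support(1)[where F = "{fst \<beta>}"]) (auto simp: ev_def)

lemma sum_fun_apply: "(\<Sum>j\<in>J. f j) i = (\<Sum>j\<in>J. f j i :: 'a::comm_monoid_add)"
  by (induction J rule: infinite_finite_induct) auto

lemma bnorm_sum_ev:
  assumes "1 \<le> p" "finite J" "\<And>c. c \<in> J \<Longrightarrow> j < n c"
  shows "(\<Sum>c\<in>J. ev (c, j) :: _ \<Rightarrow> 'k::real_normed_field) \<in> bsp p n"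
    "bnorm p n (\<Sum>c\<in>J. ev (c, j) :: _ \<Rightarrow> 'k) = real (card J) powr (1/p)"
proof -
  let ?W = "\<Sum>c\<in>J. ev (c, j) :: _ \<Rightarrow> 'k"
  have W: "?W (b, i) = (if b \<in> J \<and> i = j then 1 else 0)" for b i
  proof -
    have "?W (b, i) = (\<Sum>c\<in>J. if c = b \<and> i = j then 1 else 0)"
      by (simp add: sum_fun_apply ev_def eq_commute)
    also have "\<dots> = (if b \<in> J \<and> i = j then 1 else 0)"
      using assms(2) by (cases "i = j") (auto simp: eq_commute)
    finally show ?thesis .
  qed
  have 1: "?W (b, i) = 0" if "n b \<le> i" for b i
    using that assms(3)[of b] by (auto simp: W)
  have 2: "?W (b, i) = 0" if "b \<notin> J" for b i
    using that by (auto simp: W)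
  show "?W \<in> bsp p n" by (rule bsp_finite_support(1)[where F = J]) (use assms 1 2 in auto)
  have "blk n ?W b = 1" if "b \<in> J" for b
  proof -
    have "blk n ?W b = blk n (ev (b, j) :: _ \<Rightarrow> 'k) b"
      using that by (intro blk_cong) (auto simp: W, auto simp: ev_def)
    then show ?thesis using assms(3)[OF that] by (simp add: blk_ev)
  qed
  then show "bnorm p n ?W = real (card J) powr (1/p)"
    unfolding bnorm_def by (subst bsp_finite_support(2)[where F = J]) (use assms 1 2 in auto)
qed

lemma trunc_bsp:
  assumes "x \<in> bsp p n"
  shows "trunc F x \<in> bsp p n"
proof (rule bspI)
  have "blk n (trunc F x) b powr p \<le> blk n x b powr p" for b
    by (cases "b \<in> F") (auto simp: trunc_def blk_def L2_set_def)
  then show "(\<lambda>b. blk n (trunc F x) b powr p) summable_on UNIV"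
    by (intro summable_on_comparison_test[OF bsp_summable[OF assms]]) auto
qed (use assms in \<open>auto simp: trunc_def bsp_outside\<close>)

lemma trunc_finite_eq_sum:
  assumes "x \<in> bsp p n" "finite F"
  shows "trunc F x = (\<Sum>\<beta>\<in>(SIGMA b:F. {..<n b}). smul (x \<beta>) (ev \<beta>))"
proof
  fix \<gamma>
  have "(\<Sum>\<beta>\<in>(SIGMA b:F. {..<n b}). smul (x \<beta>) (ev \<beta>)) \<gamma> = (\<Sum>\<beta>\<in>(SIGMA b:F. {..<n b}). if \<beta> = \<gamma> then x \<gamma> else 0)"
    unfolding sum_fun_apply by (rule sum.cong) (auto simp: ev_def)
  also have "\<dots> = (if \<gamma> \<in> (SIGMA b:F. {..<n b}) then x \<gamma> else 0)"
    using assms(2) by (subst sum.delta) auto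
  also have "\<dots> = trunc F x \<gamma>"
    using bsp_outside[OF assms(1), of "fst \<gamma>" "snd \<gamma>"] by (cases \<gamma>) (auto simp: trunc_def not_less)
  finally show "trunc F x \<gamma> = (\<Sum>\<beta>\<in>(SIGMA b:F. {..<n b}). smul (x \<beta>) (ev \<beta>)) \<gamma>" by simp
qed

lemma trunc_approx:
  assumes "1 \<le> p" "x \<in> bsp p n" "0 < \<epsilon>"
  shows "\<exists>F. finite F \<and> bnorm p n (x - trunc F x) < \<epsilon>"
proof -
  let ?f = "\<lambda>b. blk n x b powr p"
  have s: "?f summable_on UNIV" by (rule bsp_summable[OF assms(2)])
  have "0 < (\<epsilon>/2) powr p" using assms by simp
  from infsum_finite_approximation[OF s this]
  obtain F where F: "finite F" "dist (sum ?f F) (infsum ?f UNIV) \<le> (\<epsilon>/2) powr p" by auto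
  have "x - trunc F x = trunc (- F) x" by (auto simp: trunc_def fun_eq_iff)
  moreover have "bsum p n (trunc (-F) x) = infsum ?f (-F)"
    unfolding bsum_def by (rule infsum_cong_neutral) (auto simp: trunc_def blk_def L2_set_def)
  moreover have "infsum ?f UNIV = infsum ?f F + infsum ?f (-F)"
  proof -
    have "?f summable_on (-F)" using s summable_on_subset_banach by blast
    then show ?thesis
      using infsum_Un_disjoint[of ?f F "-F"] F(1) by (simp add: Compl_partition)
  qed
  ultimately have "bsum p n (x - trunc F x) \<le> (\<epsilon>/2) powr p"
    using F by (simp add: dist_real_def)
  then have "bnorm p n (x - trunc F x) \<le> ((\<epsilon>/2) powr p) powr (1/p)"
    unfolding bnorm_def using assms by (intro powr_mono2) auto
  also have "\<dots> < \<epsilon>" using assms by (simp add: powr_powr)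
  finally show ?thesis using F by blast
qed

section \<open>Skew operators\<close>

text \<open>An isometry travels with its inverse because the functions are total and controlled only
  on V and W. Linearity and norm preservation of S follow, see \<open>isom_pair_sym\<close>.\<close>

definition isom_pair ::
    "('i \<Rightarrow> 'k::field) set \<Rightarrow> (('i \<Rightarrow> 'k) \<Rightarrow> real) \<Rightarrow> ('j \<Rightarrow> 'k) set \<Rightarrow> (('j \<Rightarrow> 'k) \<Rightarrow> real) \<Rightarrow>
     (('i \<Rightarrow> 'k) \<Rightarrow> ('j \<Rightarrow> 'k)) \<Rightarrow> (('j \<Rightarrow> 'k) \<Rightarrow> ('i \<Rightarrow> 'k)) \<Rightarrow> bool" where
  "isom_pair V M W N T S \<longleftrightarrow> lin_on V T \<and> (\<forall>x\<in>V. T x \<in> W) \<and> (\<forall>y\<in>W. S y \<in> V) \<and>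
     (\<forall>x\<in>V. S (T x) = x) \<and> (\<forall>y\<in>W. T (S y) = y) \<and> (\<forall>x\<in>V. N (T x) = M x)"

text \<open>First-order substitute for "exp(tA) is isometric for all real t". K must not depend on
  x, and boundedness of A is demanded, so that sums of skew operators are again skew.\<close>

definition skew :: "('i \<Rightarrow> 'k::real_normed_field) set \<Rightarrow> (('i \<Rightarrow> 'k) \<Rightarrow> real) \<Rightarrow> (('i \<Rightarrow> 'k) \<Rightarrow> ('i \<Rightarrow> 'k)) \<Rightarrow> bool" where
  "skew V M A \<longleftrightarrow> lin_on V A \<and> (\<forall>x\<in>V. A x \<in> V) \<and> (\<exists>C\<ge>0. \<forall>x\<in>V. M (A x) \<le> C * M x) \<and>
     (\<exists>K\<ge>0. \<forall>x\<in>V. \<forall>t. \<bar>t\<bar> \<le> 1 \<longrightarrow> M (x + smul (of_real t) (A x)) \<le> (1 + K * t\<^sup>2) * M x)"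

lemma lin_on_add: "lin_on V T \<Longrightarrow> x \<in> V \<Longrightarrow> y \<in> V \<Longrightarrow> T (x + y) = T x + T y"
  by (simp add: lin_on_def)

lemma lin_on_smul: "lin_on V T \<Longrightarrow> x \<in> V \<Longrightarrow> T (smul c x) = smul c (T x)"
  by (simp add: lin_on_def)

lemma smul_minus1: "smul (- 1) x = - x"
  by (auto simp: fun_eq_iff)

lemma lin_on_minus: "lin_on V T \<Longrightarrow> x \<in> V \<Longrightarrow> T (- x) = - T x"
  using lin_on_smul[of V T x "- 1"] by (simp add: smul_minus1)

lemma lin_on_diff:
  assumes "fs.subspace V" "lin_on V T" "x \<in> V" "y \<in> V"
  shows "T (x - y) = T x - T y"
  using lin_on_add[OF assms(2,3), of "- y"] lin_on_minus[OF assms(2,4)] fs.subspace_neg[OF assms(1,4)] by simp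

lemma lin_on_0: "lin_on V T \<Longrightarrow> fs.subspace V \<Longrightarrow> T 0 = 0"
  using lin_on_diff[of V T 0 0] fs.subspace_0 by fastforce

lemma lin_on_sum:
  assumes "fs.subspace V" "lin_on V T" "finite J" "\<And>j. j \<in> J \<Longrightarrow> f j \<in> V"
  shows "T (\<Sum>j\<in>J. f j) = (\<Sum>j\<in>J. T (f j))"
  using assms(3,4)
  by (induction J) (auto simp: lin_on_0[OF assms(2,1)] lin_on_add[OF assms(2)] fs.subspace_sum[OF assms(1)])

lemma lin_on_comp:
  assumes "lin_on V T" "\<And>x. x \<in> V \<Longrightarrow> T x \<in> W" "lin_on W S"
  shows "lin_on V (\<lambda>x. S (T x))"
  using assms by (simp add: lin_on_def)

lemma isom_pair_sym:
  assumes "isom_pair V M W N T S" and V: "fs.subspace V"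
  shows "isom_pair W N V M S T"
proof -
  from assms have T: "lin_on V T" "\<And>x. x \<in> V \<Longrightarrow> T x \<in> W" "\<And>y. y \<in> W \<Longrightarrow> S y \<in> V"
    "\<And>x. x \<in> V \<Longrightarrow> S (T x) = x" "\<And>y. y \<in> W \<Longrightarrow> T (S y) = y" "\<And>x. x \<in> V \<Longrightarrow> N (T x) = M x"
    by (auto simp: isom_pair_def)
  have "S (x + y) = S x + S y" if "x \<in> W" "y \<in> W" for x y
    using T(4)[of "S x + S y"] fs.subspace_add[OF V] lin_on_add[OF T(1), of "S x" "S y"] T(3,5) that by simp
  moreover have "S (smul c x) = smul c (S x)" if "x \<in> W" for c x
    using T(4)[of "smul c (S x)"] fs.subspace_scale[OF V] lin_on_smul[OF T(1), of "S x"] T(3,5) that by simp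
  ultimately have "lin_on W S" by (auto simp: lin_on_def)
  moreover have "M (S y) = N y" if "y \<in> W" for y
    using T(6)[of "S y"] T(3,5) that by simp
  ultimately show ?thesis using T by (auto simp: isom_pair_def)
qed

lemma isom_pair_comp:
  assumes "isom_pair V M W N T S" "isom_pair W N X L T' S'"
  shows "isom_pair V M X L (\<lambda>x. T' (T x)) (\<lambda>y. S (S' y))"
  using assms unfolding isom_pair_def lin_on_def by auto

text \<open>On W one has I + tTAS = T(I + tA)S, so the constants C and K of A carry over
  unchanged.\<close>

lemma skew_conj:
  assumes iso: "isom_pair V M W N T S" and V: "fs.subspace V" and A: "skew V M A"
  shows "skew W N (\<lambda>y. T (A (S y)))"
proof -
  note iso' = isom_pair_sym[OF iso V]
  have T: "lin_on V T" "\<And>x. x \<in> V \<Longrightarrow> T x \<in> W" "\<And>x. x \<in> V \<Longrightarrow> N (T x) = M x"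
    and S: "lin_on W S" "\<And>x. x \<in> W \<Longrightarrow> S x \<in> V" "\<And>x. x \<in> W \<Longrightarrow> M (S x) = N x"
    and TS: "\<And>y. y \<in> W \<Longrightarrow> T (S y) = y"
    using iso iso' by (auto simp: isom_pair_def)
  from A obtain C K where A: "lin_on V A" "\<And>x. x \<in> V \<Longrightarrow> A x \<in> V" "C \<ge> 0" "\<And>x. x \<in> V \<Longrightarrow> M (A x) \<le> C * M x"
    "K \<ge> 0" "\<And>x t. x \<in> V \<Longrightarrow> \<bar>t\<bar> \<le> 1 \<Longrightarrow> M (x + smul (of_real t) (A x)) \<le> (1 + K * t\<^sup>2) * M x"
    by (auto simp: skew_def)
  have "N (y + smul (of_real t) (T (A (S y)))) \<le> (1 + K * t\<^sup>2) * N y" if "y \<in> W" "\<bar>t\<bar> \<le> 1" for y t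
  proof -
    have "y + smul (of_real t) (T (A (S y))) = T (S y + smul (of_real t) (A (S y)))"
      using that T S TS A by (subst lin_on_add[OF T(1)]) (simp_all add: lin_on_smul[OF T(1)] fs.subspace_scale[OF V])
    then show ?thesis
      using that T S TS A(2) A(6)[of "S y" t] by (simp add: fs.subspace_add[OF V] fs.subspace_scale[OF V])
  qed
  moreover have "lin_on W (\<lambda>y. T (A (S y)))"
    using lin_on_comp[OF lin_on_comp[OF S(1,2) A(1)] _ T(1)] S A by auto
  moreover have "N (T (A (S y))) \<le> C * N y" if "y \<in> W" for y
    using that A(4)[of "S y"] T S A by simp
  ultimately show ?thesis using T S A by (auto simp: skew_def)
qed

locale normed_subspace =
  fixes V :: "('i \<Rightarrow> 'k::real_normed_field) set" and M :: "('i \<Rightarrow> 'k) \<Rightarrow> real"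
  assumes subsp: "fs.subspace V" and nrm: "nrm_on V M"
begin

lemma nonneg: "x \<in> V \<Longrightarrow> 0 \<le> M x"
  and eq_0_iff: "x \<in> V \<Longrightarrow> M x = 0 \<longleftrightarrow> x = 0"
  and scale: "x \<in> V \<Longrightarrow> M (smul c x) = norm c * M x"
  and triangle: "x \<in> V \<Longrightarrow> y \<in> V \<Longrightarrow> M (x + y) \<le> M x + M y"
  using nrm by (auto simp: nrm_on_def)

lemmas V_add = fs.subspace_add[OF subsp] and V_scale = fs.subspace_scale[OF subsp]
  and V_diff = fs.subspace_diff[OF subsp] and V_neg = fs.subspace_neg[OF subsp]
  and V_0 = fs.subspace_0[OF subsp] and V_sum = fs.subspace_sum[OF subsp]

lemma M_minus: "x \<in> V \<Longrightarrow> M (- x) = M x"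
  using scale[of x "- 1"] by (simp add: smul_minus1)

lemma triangle_diff: "x \<in> V \<Longrightarrow> y \<in> V \<Longrightarrow> M (x - y) \<le> M x + M y"
  using triangle[of x "- y"] by (simp add: V_neg M_minus)

text \<open>I + t(A + B) equals (I + tA)(I + tB) minus the term of second order AB scaled by t^2.
  The product costs the factors of A and B, and boundedness controls the correction.\<close>

lemma skew_add:
  assumes A: "skew V M A" and B: "skew V M B"
  shows "skew V M (\<lambda>x. A x + B x)"
proof -
  from A obtain C K where A: "lin_on V A" "\<And>x. x \<in> V \<Longrightarrow> A x \<in> V" "C \<ge> 0" "\<And>x. x \<in> V \<Longrightarrow> M (A x) \<le> C * M x"
    "K \<ge> 0" "\<And>x t. x \<in> V \<Longrightarrow> \<bar>t\<bar> \<le> 1 \<Longrightarrow> M (x + smul (of_real t) (A x)) \<le> (1 + K * t\<^sup>2) * M x"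
    by (auto simp: skew_def)
  from B obtain C' K' where B: "lin_on V B" "\<And>x. x \<in> V \<Longrightarrow> B x \<in> V" "C' \<ge> 0" "\<And>x. x \<in> V \<Longrightarrow> M (B x) \<le> C' * M x"
    "K' \<ge> 0" "\<And>x t. x \<in> V \<Longrightarrow> \<bar>t\<bar> \<le> 1 \<Longrightarrow> M (x + smul (of_real t) (B x)) \<le> (1 + K' * t\<^sup>2) * M x"
    by (auto simp: skew_def)
  have "lin_on V (\<lambda>x. A x + B x)"
    using A(1) B(1) by (auto simp: lin_on_def fs.scale_right_distrib)
  moreover have "M (A x + B x) \<le> (C + C') * M x" if "x \<in> V" for x
    using triangle[of "A x" "B x"] A(2,4) B(2,4) that by (simp add: distrib_right) (smt (verit))
  moreover have "M (x + smul (of_real t) (A x + B x)) \<le> (1 + (K + K' + K * K' + C * C') * t\<^sup>2) * M x"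
    if x: "x \<in> V" and t: "\<bar>t\<bar> \<le> 1" for x t
  proof -
    define y where "y = x + smul (of_real t) (B x)"
    have y: "y \<in> V" using x B by (simp add: y_def V_add V_scale)
    have "x + smul (of_real t) (A x + B x) = (y + smul (of_real t) (A y)) - smul (of_real (t\<^sup>2)) (A (B x))"
      using x A B by (simp add: y_def lin_on_add lin_on_smul V_scale fun_eq_iff algebra_simps power2_eq_square)
    then have "M (x + smul (of_real t) (A x + B x)) \<le> M (y + smul (of_real t) (A y)) + M (smul (of_real (t\<^sup>2)) (A (B x)))"
      using triangle_diff x y A B by (simp add: V_add V_scale)
    also have "\<dots> \<le> (1 + K * t\<^sup>2) * M y + t\<^sup>2 * (C * (C' * M x))"
    proof (rule add_mono)
      have "M (A (B x)) \<le> C * (C' * M x)"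
        using A(4)[of "B x"] B x A(3) by (meson mult_left_mono order_trans)
      then show "M (smul (of_real (t\<^sup>2)) (A (B x))) \<le> t\<^sup>2 * (C * (C' * M x))"
        using A B x by (subst scale) (auto simp: norm_power intro!: mult_left_mono)
    qed (use A(6) y t in auto)
    also have "\<dots> \<le> (1 + K * t\<^sup>2) * ((1 + K' * t\<^sup>2) * M x) + t\<^sup>2 * (C * (C' * M x))"
      using B(6)[OF x t] A(5) by (auto simp: y_def intro!: mult_left_mono)
    also have "\<dots> = (1 + (K + K' + K * K' * t\<^sup>2 + C * C') * t\<^sup>2) * M x"
      by (simp add: algebra_simps)
    also have "\<dots> \<le> (1 + (K + K' + K * K' * 1 + C * C') * t\<^sup>2) * M x"
      using t A(5) B(5) nonneg[OF x]
      by (intro mult_right_mono add_left_mono add_right_mono mult_left_mono) (auto simp: abs_square_le_1)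
    finally show ?thesis by simp
  qed
  ultimately show ?thesis
    using A B unfolding skew_def
    by (intro conjI ballI exI[of _ "C + C'"] exI[of _ "K + K' + K * K' + C * C'"]) (auto simp: V_add)
qed

lemma skew_minus:
  assumes "skew V M A"
  shows "skew V M (\<lambda>x. - A x)"
proof -
  from assms obtain C K where A: "lin_on V A" "\<And>x. x \<in> V \<Longrightarrow> A x \<in> V" "C \<ge> 0" "\<And>x. x \<in> V \<Longrightarrow> M (A x) \<le> C * M x"
    "K \<ge> 0" "\<And>x t. x \<in> V \<Longrightarrow> \<bar>t\<bar> \<le> 1 \<Longrightarrow> M (x + smul (of_real t) (A x)) \<le> (1 + K * t\<^sup>2) * M x"
    by (auto simp: skew_def)
  have "M (x + smul (of_real t) (- A x)) \<le> (1 + K * t\<^sup>2) * M x" if "x \<in> V" "\<bar>t\<bar> \<le> 1" for x t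
    using A(6)[of x "- t"] that by simp
  moreover have "lin_on V (\<lambda>x. - A x)"
    using A(1) by (auto simp: lin_on_def)
  ultimately show ?thesis using A unfolding skew_def
    by (intro conjI ballI exI[of _ C] exI[of _ K]) (auto simp: V_neg M_minus)
qed

lemma skew_diff: "skew V M A \<Longrightarrow> skew V M B \<Longrightarrow> skew V M (\<lambda>x. A x - B x)"
  using skew_add[OF _ skew_minus[of B], of A] by simp

lemma skew_zero: "skew V M (\<lambda>x. 0)"
  using eq_0_iff[OF V_0] unfolding skew_def
  by (intro conjI exI[of _ 0]) (auto simp: lin_on_def V_0 nonneg)

lemma skew_sum:
  assumes "finite J" "\<And>j. j \<in> J \<Longrightarrow> skew V M (A j)"
  shows "skew V M (\<lambda>x. \<Sum>j\<in>J. A j x)"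
  using assms by (induction J) (auto intro: skew_add skew_zero)

text \<open>Along a curve that solves x' = Ax up to a quadratic error, skewness bounds the increment
  of the norm above by O(h^2) for both signs of h; hence the norm has derivative zero. The curves
  used below are given in closed form, so no exponential series occurs.\<close>

lemma skew_curve_constant:
  fixes x :: "real \<Rightarrow> ('i \<Rightarrow> 'k)"
  assumes A: "skew V M A" and x: "\<And>t. x t \<in> V"
    and L: "\<And>t h. \<bar>h\<bar> \<le> 1 \<Longrightarrow> M (x (t + h) - (x t + smul (of_real h) (A (x t)))) \<le> L * h\<^sup>2"
  shows "M (x t) = M (x 0)"
proof -
  from A obtain K where A: "\<And>x. x \<in> V \<Longrightarrow> A x \<in> V"
    and K: "K \<ge> 0" "\<And>x t. x \<in> V \<Longrightarrow> \<bar>t\<bar> \<le> 1 \<Longrightarrow> M (x + smul (of_real t) (A x)) \<le> (1 + K * t\<^sup>2) * M x"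
    by (auto simp: skew_def)
  define g where "g t = M (x t)" for t
  have step: "g (t + h) - g t \<le> (K * g t + L) * h\<^sup>2" if "\<bar>h\<bar> \<le> 1" for t h
  proof -
    let ?y = "x t + smul (of_real h) (A (x t))"
    have "M (x (t + h)) \<le> M ?y + M (x (t + h) - ?y)"
      using triangle[of ?y "x (t + h) - ?y"] x A by (simp add: V_add V_diff V_scale)
    also have "\<dots> \<le> (1 + K * h\<^sup>2) * M (x t) + L * h\<^sup>2"
      using K(2)[OF x that] L[OF that] by (intro add_mono)
    finally show ?thesis by (simp add: g_def algebra_simps)
  qed
  have L0: "L \<ge> 0"
    using L[of 1 0] nonneg[of "x 1 - (x 0 + A (x 0))"] x A by (simp add: V_diff V_add)
  have g0: "g t \<ge> 0" for t by (simp add: g_def nonneg x)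
  have "(g has_real_derivative 0) (at t)" for t
  proof -
    define B where "B = K * ((1 + K) * g t + L) + L"
    have bound: "\<bar>g (t + h) - g t\<bar> \<le> B * h\<^sup>2" if h: "\<bar>h\<bar> \<le> 1" for h
    proof -
      have h2: "h\<^sup>2 \<le> 1" using h by (simp add: abs_square_le_1)
      have *: "(K * g t + L) * h\<^sup>2 \<le> K * g t + L"
        using h2 K L0 g0 by (simp add: mult_left_le)
      \<comment> \<open>The lower bound is the same estimate started at t + h with step - h. Its
        constant involves \<open>g (t + h)\<close>, which must first be bounded through
        \<open>g t\<close>.\<close>
      have gh: "g (t + h) \<le> (1 + K) * g t + L"
        using step[OF h, of t] * by (simp add: algebra_simps)
      have gt: "g t \<le> (1 + K) * g t + L" using K L0 g0 by (simp add: algebra_simps)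
      have "g (t + h) - g t \<le> B * h\<^sup>2"
        using step[OF h, of t] mult_right_mono[of "K * g t + L" B "h\<^sup>2"] mult_left_mono[OF gt K(1)] by (simp add: B_def)
      moreover have "g t - g (t + h) \<le> B * h\<^sup>2"
        using step[of "- h" "t + h"] h mult_right_mono[of "K * g (t + h) + L" B "h\<^sup>2"] mult_left_mono[OF gh K(1)] by (simp add: B_def)
      ultimately show ?thesis by linarith
    qed
    have "((\<lambda>h. (g (t + h) - g t) / h) \<longlongrightarrow> 0) (at 0)"
    proof (rule tendsto_0_le[where f = "\<lambda>h. h" and K = B])
      have "\<forall>\<^sub>F h in at 0. \<bar>h\<bar> < (1::real)"
        using eventually_at_ball[of 1 "0::real" UNIV] by (simp add: dist_real_def)
      then show "\<forall>\<^sub>F h in at 0. norm ((g (t + h) - g t) / h) \<le> norm h * B"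
      proof eventually_elim
        case (elim h)
        then show ?case using bound[of h]
          by (cases "h = 0") (auto simp: field_simps power2_eq_square abs_mult[symmetric])
      qed
    qed (rule tendsto_ident_at)
    then show ?thesis by (simp add: DERIV_def)
  qed
  then have "g t = g 0" by (intro DERIV_isconst_all) auto
  then show ?thesis by (simp add: g_def)
qed

end

section \<open>Skew operators are block diagonal\<close>

definition phase :: "('i \<Rightarrow> 'k::field) \<Rightarrow> ('i \<Rightarrow> 'k) \<Rightarrow> ('i \<Rightarrow> 'k)" where
  "phase u x = (\<lambda>\<gamma>. u \<gamma> * x \<gamma>)"

definition swap_blocks :: "'b \<Rightarrow> 'b \<Rightarrow> ('b \<times> nat \<Rightarrow> 'k) \<Rightarrow> ('b \<times> nat \<Rightarrow> 'k)" where
  "swap_blocks b c x = (\<lambda>\<gamma>. x (Transposition.transpose b c (fst \<gamma>), snd \<gamma>))"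

text \<open>The real matrix with rows (c, s) and (s, -c). A reflection is its own inverse, which a
  rotation is not; rotations are obtained by a further sign change.\<close>

definition plane_reflection ::
    "'b \<Rightarrow> nat \<Rightarrow> nat \<Rightarrow> real \<Rightarrow> real \<Rightarrow> ('b \<times> nat \<Rightarrow> 'k::real_normed_field) \<Rightarrow> ('b \<times> nat \<Rightarrow> 'k)" where
  "plane_reflection b i j c s x = (\<lambda>\<gamma>.
     if \<gamma> = (b, i) then c *\<^sub>R x (b, i) + s *\<^sub>R x (b, j)
     else if \<gamma> = (b, j) then s *\<^sub>R x (b, i) - c *\<^sub>R x (b, j) else x \<gamma>)"

text \<open>If T only permutes the block norms, membership in the space and preservation of the norm
  both follow by reindexing one sum.\<close>

lemma isom_pair_blkI:
  fixes T S :: "('b \<times> nat \<Rightarrow> 'k::real_normed_field) \<Rightarrow> ('b \<times> nat \<Rightarrow> 'k)"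
  assumes lin: "lin_on (bsp p n) T" and \<pi>: "bij \<pi>"
    and T: "\<And>x b. x \<in> bsp p n \<Longrightarrow> blk n (T x) b = blk n x (\<pi> b)"
    and S: "\<And>x b. x \<in> bsp p n \<Longrightarrow> blk n (S x) b = blk n x (inv_into UNIV \<pi> b)"
    and T0: "\<And>x b i. x \<in> bsp p n \<Longrightarrow> n b \<le> i \<Longrightarrow> T x (b, i) = 0"
    and S0: "\<And>x b i. x \<in> bsp p n \<Longrightarrow> n b \<le> i \<Longrightarrow> S x (b, i) = 0"
    and ST: "\<And>x. x \<in> bsp p n \<Longrightarrow> S (T x) = x" "\<And>x. x \<in> bsp p n \<Longrightarrow> T (S x) = x"
  shows "isom_pair (bsp p n) (bnorm p n) (bsp p n) (bnorm p n) T S"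
proof -
  have "(\<lambda>b. blk n x (\<pi> b) powr p) summable_on UNIV" if "x \<in> bsp p n" for x :: "_ \<Rightarrow> 'k"
    using summable_on_reindex_bij_betw[OF \<pi>, of "\<lambda>b. blk n x b powr p"] bsp_summable[OF that] by simp
  then have "T x \<in> bsp p n" if "x \<in> bsp p n" for x
    using that by (auto simp: bsp_def[of p n] T T0)
  moreover have "(\<lambda>b. blk n x (inv_into UNIV \<pi> b) powr p) summable_on UNIV" if "x \<in> bsp p n" for x :: "_ \<Rightarrow> 'k"
    using summable_on_reindex_bij_betw[OF bij_imp_bij_inv[OF \<pi>], of "\<lambda>b. blk n x b powr p"] bsp_summable[OF that] by simp
  then have "S x \<in> bsp p n" if "x \<in> bsp p n" for x
    using that by (auto simp: bsp_def[of p n] S S0)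
  moreover have "bnorm p n (T x) = bnorm p n x" if "x \<in> bsp p n" for x
    using infsum_reindex_bij_betw[OF \<pi>, of "\<lambda>b. blk n x b powr p"] that by (simp add: bnorm_def bsum_def T)
  ultimately show ?thesis using lin ST by (auto simp: isom_pair_def)
qed

lemma phase_isom:
  assumes "\<And>\<gamma>. norm (u \<gamma> :: 'k::real_normed_field) = 1"
  shows "isom_pair (bsp p n) (bnorm p n) (bsp p n) (bnorm p n) (phase u) (phase (\<lambda>\<gamma>. inverse (u \<gamma>)))"
proof (rule isom_pair_blkI[where \<pi> = id])
  have nz: "u \<gamma> \<noteq> 0" for \<gamma> using assms[of \<gamma>] by auto
  show "phase (\<lambda>\<gamma>. inverse (u \<gamma>)) (phase u x) = x" "phase u (phase (\<lambda>\<gamma>. inverse (u \<gamma>)) x) = x" for x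
    by (auto simp: phase_def nz)
qed (auto simp: lin_on_def phase_def blk_def L2_set_def norm_mult norm_inverse assms bsp_outside fun_eq_iff algebra_simps)

lemma swap_blocks_isom:
  assumes "n b = n c"
  shows "isom_pair (bsp p n) (bnorm p n) (bsp p n) (bnorm p n)
    (swap_blocks b c :: _ \<Rightarrow> _ \<Rightarrow> 'k::real_normed_field) (swap_blocks b c)"
proof (rule isom_pair_blkI[where \<pi> = "Transposition.transpose b c"])
  have *: "n (Transposition.transpose b c d) = n d" for d
    using assms by (auto simp: Transposition.transpose_def)
  show 1: "blk n (swap_blocks b c x) d = blk n x (Transposition.transpose b c d)" for x :: "_ \<Rightarrow> 'k" and d
    by (simp add: blk_def L2_set_def swap_blocks_def *)
  then show "blk n (swap_blocks b c x) d = blk n x (inv_into UNIV (Transposition.transpose b c) d)" for x :: "_ \<Rightarrow> 'k" and d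
    by simp
  show "swap_blocks b c x (d, i) = 0" if "x \<in> bsp p n" "n d \<le> i" for x :: "_ \<Rightarrow> 'k" and d i
    using that by (auto simp: swap_blocks_def * intro!: bsp_outside)
  then show "swap_blocks b c x (d, i) = 0" if "x \<in> bsp p n" "n d \<le> i" for x :: "_ \<Rightarrow> 'k" and d i
    using that by blast
qed (auto simp: swap_blocks_def lin_on_def)

lemma blk_plane_reflection:
  fixes x :: "'b \<times> nat \<Rightarrow> 'k::scalar_field"
  assumes "i < n b" "j < n b" "i \<noteq> j" and cs: "c\<^sup>2 + s\<^sup>2 = 1"
  shows "blk n (plane_reflection b i j c s x) d = blk n x d"
proof (cases "d = b")
  case True
  let ?y = "plane_reflection b i j c s x"
  have split: "(\<Sum>k<n b. f k) = f i + f j + (\<Sum>k\<in>{..<n b} - {i} - {j}. f k)" for f :: "nat \<Rightarrow> real"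
    using assms by (simp add: sum.remove[of "{..<n b}" i] sum.remove[of "{..<n b} - {i}" j])
  have "(norm (c *\<^sub>R u + s *\<^sub>R v))\<^sup>2 + (norm (s *\<^sub>R u - c *\<^sub>R v))\<^sup>2 = (c\<^sup>2 + s\<^sup>2) * ((norm u)\<^sup>2 + (norm v)\<^sup>2)" for u v :: 'k
    unfolding power2_norm_eq_inner by (simp add: inner_simps inner_commute power2_eq_square algebra_simps)
  then have "(\<Sum>k<n b. (norm (?y (b, k)))\<^sup>2) = (\<Sum>k<n b. (norm (x (b, k)))\<^sup>2)"
    unfolding split using assms by (simp add: plane_reflection_def)
  then show ?thesis by (simp add: True blk_def L2_set_def)
qed (auto simp: blk_def L2_set_def plane_reflection_def)

lemma plane_reflection_isom:
  assumes ij: "i < n b" "j < n b" "i \<noteq> j" and cs: "c\<^sup>2 + s\<^sup>2 = 1"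
  shows "isom_pair (bsp p n) (bnorm p n) (bsp p n) (bnorm p n)
    (plane_reflection b i j c s :: _ \<Rightarrow> _ \<Rightarrow> 'k::scalar_field) (plane_reflection b i j c s)"
proof (rule isom_pair_blkI[where \<pi> = id])
  show "lin_on (bsp p n) (plane_reflection b i j c s :: _ \<Rightarrow> _ \<Rightarrow> 'k)"
    by (auto simp: lin_on_def plane_reflection_def fun_eq_iff algebra_simps)
  have "c *\<^sub>R (c *\<^sub>R u + s *\<^sub>R v) + s *\<^sub>R (s *\<^sub>R u - c *\<^sub>R v) = (c\<^sup>2 + s\<^sup>2) *\<^sub>R u"
    "s *\<^sub>R (c *\<^sub>R u + s *\<^sub>R v) - c *\<^sub>R (s *\<^sub>R u - c *\<^sub>R v) = (c\<^sup>2 + s\<^sup>2) *\<^sub>R v" for u v :: 'k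
    by (simp_all add: algebra_simps power2_eq_square)
  then have "plane_reflection b i j c s (plane_reflection b i j c s x) \<gamma> = x \<gamma>" for x :: "_ \<Rightarrow> 'k" and \<gamma>
    using ij cs by (simp add: plane_reflection_def[of b i j c s "plane_reflection b i j c s x"])
      (simp add: plane_reflection_def)
  then show "plane_reflection b i j c s (plane_reflection b i j c s x) = x" for x :: "_ \<Rightarrow> 'k" by auto
  then show "plane_reflection b i j c s (plane_reflection b i j c s x) = x" for x :: "_ \<Rightarrow> 'k" by auto
  show "plane_reflection b i j c s x (d, k) = 0" if "x \<in> bsp p n" "n d \<le> k" for x :: "_ \<Rightarrow> 'k" and d k
    using that ij by (auto simp: plane_reflection_def bsp_outside)
  then show "plane_reflection b i j c s x (d, k) = 0" if "x \<in> bsp p n" "n d \<le> k" for x :: "_ \<Rightarrow> 'k" and d k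
    using that by blast
qed (use assms in \<open>auto simp: blk_plane_reflection\<close>)

lemma cos_sin_taylor:
  fixes u d :: real
  shows "\<bar>cos (u + d) - cos u + d * sin u\<bar> \<le> d\<^sup>2" "\<bar>sin (u + d) - sin u - d * cos u\<bar> \<le> d\<^sup>2"
proof -
  have s: "\<bar>sin d - d\<bar> \<le> d\<^sup>2 / 2"
    using Maclaurin_sin_bound[of d 2] by (simp add: numeral_2_eq_2 sin_coeff_def)
  have "cos d = 1 - 2 * (sin (d/2))\<^sup>2" using cos_double_sin[of "d/2"] by simp
  moreover have "(sin (d/2))\<^sup>2 \<le> (d/2)\<^sup>2"
    using abs_sin_x_le_abs_x[of "d/2"] by (simp only: abs_le_square_iff)
  ultimately have c: "\<bar>cos d - 1\<bar> \<le> d\<^sup>2 / 2" by (simp add: power2_eq_square)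
  have bound: "\<bar>a * (cos d - 1) + b * (sin d - d)\<bar> \<le> d\<^sup>2" if "\<bar>a\<bar> \<le> 1" "\<bar>b\<bar> \<le> 1" for a b
  proof -
    have "\<bar>a * (cos d - 1)\<bar> \<le> 1 * (d\<^sup>2/2)" "\<bar>b * (sin d - d)\<bar> \<le> 1 * (d\<^sup>2/2)"
      unfolding abs_mult using that c s by (intro mult_mono; simp)+
    then show ?thesis by linarith
  qed
  show "\<bar>cos (u + d) - cos u + d * sin u\<bar> \<le> d\<^sup>2"
    using bound[of "cos u" "- sin u"] by (simp add: cos_add algebra_simps)
  show "\<bar>sin (u + d) - sin u - d * cos u\<bar> \<le> d\<^sup>2"
    using bound[of "sin u" "cos u"] by (simp add: sin_add algebra_simps)
qed

text \<open>The reference norm \<open>bnorm\<close> enters only through its isometries and through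
  equivalence with M. Infinite multiplicity feeds the growth comparison, and the lower bound on the
  dimensions supplies a third coordinate in every block.\<close>

locale block_invariant =
  fixes p :: real and n :: "'b \<Rightarrow> nat" and M :: "('b \<times> nat \<Rightarrow> 'k::scalar_field) \<Rightarrow> real"
  assumes p: "1 < p" "p \<noteq> 2"
    and dims: "\<And>b. 3 \<le> n b" and mult: "\<And>b. infinite {c. n c = n b}"
    and nrm_M: "nrm_on (bsp p n) M"
    and equiv: "\<exists>a>0. \<exists>b>0. \<forall>x\<in>bsp p n. a * bnorm p n x \<le> M x \<and> M x \<le> b * bnorm p n x"
    and invariant: "\<And>T S x. isom_pair (bsp p n) (bnorm p n) (bsp p n) (bnorm p n) T S \<Longrightarrow> x \<in> bsp p n \<Longrightarrow> M (T x) = M x"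
begin

lemma p1: "1 \<le> p" using p by simp

sublocale normed_subspace "bsp p n" M
  using bsp_subspace[OF p1] nrm_M by unfold_locales

lemma isom_pair_M:
  assumes "isom_pair (bsp p n) (bnorm p n) (bsp p n) (bnorm p n) T S"
  shows "isom_pair (bsp p n) M (bsp p n) M T S"
  using assms invariant[OF assms] by (simp add: isom_pair_def)

section \<open>Compressing a skew operator to two coordinates\<close>

definition sgn_flip :: "('b \<times> nat) set \<Rightarrow> ('b \<times> nat \<Rightarrow> 'k) \<Rightarrow> ('b \<times> nat \<Rightarrow> 'k)" where
  "sgn_flip U = phase (\<lambda>\<gamma>. if \<gamma> \<in> U then - 1 else 1)"

lemma sgn_flip_apply: "sgn_flip U x \<gamma> = (if \<gamma> \<in> U then - x \<gamma> else x \<gamma>)"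
  by (simp add: sgn_flip_def phase_def)

lemma sgn_flip_isom: "isom_pair (bsp p n) M (bsp p n) M (sgn_flip U) (sgn_flip U)"
proof -
  have "inverse (if \<gamma> \<in> U then - 1 else 1) = (if \<gamma> \<in> U then - 1 else (1::'k))" for \<gamma> by simp
  then show ?thesis
    using isom_pair_M[OF phase_isom[of "\<lambda>\<gamma>. if \<gamma> \<in> U then - 1 else (1::'k)"]]
    by (simp add: sgn_flip_def)
qed

lemma ev_V: "snd \<beta> < n (fst \<beta>) \<Longrightarrow> ev \<beta> \<in> bsp p n"
  by (rule ev_bsp[OF p1])

lemma ev_nz: "ev \<beta> \<noteq> (0 :: 'i \<Rightarrow> 'a::real_normed_field)"
  by (auto simp: ev_def fun_eq_iff)

text \<open>Subtracting from D its conjugate by the sign change at \<alpha> doubles the entries with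
  exactly one index \<alpha> and kills all others. Doing the same at \<beta> leaves the two entries
  between \<alpha> and \<beta>, multiplied by 4.\<close>

lemma skew_compress:
  assumes D: "skew (bsp p n) M D" and \<alpha>: "snd \<alpha> < n (fst \<alpha>)" and \<beta>: "snd \<beta> < n (fst \<beta>)" and ne: "\<alpha> \<noteq> \<beta>"
  shows "skew (bsp p n) M (\<lambda>x. smul (4 * D (ev \<beta>) \<alpha> * x \<beta>) (ev \<alpha>) + smul (4 * D (ev \<alpha>) \<beta> * x \<alpha>) (ev \<beta>))"
    (is "skew _ _ ?R")
proof -
  define D1 where "D1 x = D x - sgn_flip {\<alpha>} (D (sgn_flip {\<alpha>} x))" for x
  define D2 where "D2 x = D1 x - sgn_flip {\<beta>} (D1 (sgn_flip {\<beta>} x))" for x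
  note flip = skew_conj[OF sgn_flip_isom subsp]
  have "skew (bsp p n) M D1" unfolding D1_def by (intro skew_diff D flip)
  then have D2: "skew (bsp p n) M D2" unfolding D2_def by (intro skew_diff flip)
  have lin: "lin_on (bsp p n) D" using D by (simp add: skew_def)
  \<comment> \<open>A sign change at one coordinate is a rank-one correction of the identity, so D
    of the flipped vector is found by linearity alone, without expanding x in infinitely many
    coordinates.\<close>
  have fl: "sgn_flip {\<gamma>} x = x - smul (2 * x \<gamma>) (ev \<gamma>)" for x \<gamma>
    by (auto simp: sgn_flip_apply ev_def fun_eq_iff)
  have Dfl: "D (sgn_flip {\<gamma>} x) = D x - smul (2 * x \<gamma>) (D (ev \<gamma>))" if "x \<in> bsp p n" "snd \<gamma> < n (fst \<gamma>)" for x \<gamma>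
    using that lin_on_diff[OF subsp lin] by (simp add: fl V_scale ev_V lin_on_smul[OF lin])
  have V: "sgn_flip U x \<in> bsp p n" if "x \<in> bsp p n" for x U
    using sgn_flip_isom[of U] that by (auto simp: isom_pair_def)
  have "D2 x = ?R x" if x: "x \<in> bsp p n" for x
  proof -
    have D1: "D1 y = (smul (2 * y \<alpha>) (D (ev \<alpha>)) + smul (2 * D y \<alpha>) (ev \<alpha>)) - smul (4 * y \<alpha> * D (ev \<alpha>) \<alpha>) (ev \<alpha>)" if "y \<in> bsp p n" for y
      using that by (simp add: D1_def Dfl \<alpha>) (auto simp: fl fun_eq_iff algebra_simps)
    show ?thesis
      using ne x V[OF x] unfolding D2_def by (simp add: D1 Dfl \<beta>)
        (auto simp: sgn_flip_apply ev_def fun_eq_iff algebra_simps)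
  qed
  moreover have "?R x \<in> bsp p n" if "x \<in> bsp p n" for x
    by (intro V_add V_scale ev_V \<alpha> \<beta>)
  ultimately show ?thesis
    using D2 V_add V_scale unfolding skew_def lin_on_def by simp
qed

text \<open>On the eigenvector, skewness reads |1 + t\<mu>| \<le> 1 + K t^2. The left side grows to
  first order like t times the real part of \<mu>, which is \<open>inner 1 \<mu>\<close>, and t may
  have either sign.\<close>

lemma skew_eigenvalue:
  assumes A: "skew (bsp p n) M A" and v: "v \<in> bsp p n" "v \<noteq> 0" and Av: "A v = smul \<mu> v"
  shows "inner 1 \<mu> = 0"
proof (rule ccontr)
  assume ne: "inner 1 \<mu> \<noteq> 0"
  from A obtain K where K: "K \<ge> 0"
    "\<And>t. \<bar>t\<bar> \<le> 1 \<Longrightarrow> M (v + smul (of_real t) (A v)) \<le> (1 + K * t\<^sup>2) * M v"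
    using v unfolding skew_def by auto
  have Mv: "M v > 0" using nonneg[OF v(1)] eq_0_iff[OF v(1)] v(2) by (simp add: less_le)
  have "2 * t * inner 1 \<mu> \<le> (2 * K + K\<^sup>2) * t\<^sup>2" if t: "\<bar>t\<bar> \<le> 1" for t
  proof -
    have "v + smul (of_real t) (A v) = smul (1 + of_real t * \<mu>) v"
      by (simp add: Av fun_eq_iff algebra_simps)
    then have "norm (1 + of_real t * \<mu>) * M v \<le> (1 + K * t\<^sup>2) * M v"
      using K(2)[OF t] scale[OF v(1)] by simp
    then have "norm (1 + t *\<^sub>R \<mu>) \<le> 1 + K * t\<^sup>2"
      using Mv by (simp add: scaleR_conv_of_real)
    then have "(norm (1 + t *\<^sub>R \<mu>))\<^sup>2 \<le> (1 + K * t\<^sup>2)\<^sup>2"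
      by (rule power_mono) simp
    moreover have "(norm (1 + t *\<^sub>R \<mu>))\<^sup>2 = 1 + 2 * t * inner 1 \<mu> + t\<^sup>2 * (norm \<mu>)\<^sup>2"
    proof -
      have "inner 1 (1 :: 'k) = 1" using power2_norm_eq_inner[of "1 :: 'k"] by simp
      then show ?thesis
        unfolding power2_norm_eq_inner by (simp add: inner_simps inner_commute power2_eq_square)
    qed
    moreover have "t\<^sup>2 * (norm \<mu>)\<^sup>2 \<ge> 0" by simp
    ultimately have "2 * t * inner 1 \<mu> \<le> 2 * K * t\<^sup>2 + K\<^sup>2 * (t\<^sup>2 * t\<^sup>2)"
      by (simp add: power2_eq_square algebra_simps)
    also have "\<dots> \<le> 2 * K * t\<^sup>2 + K\<^sup>2 * (t\<^sup>2 * 1)"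
      using t by (intro add_left_mono mult_left_mono) (auto simp: abs_square_le_1)
    finally show ?thesis by (simp add: algebra_simps)
  qed
  note * = this
  \<comment> \<open>The estimate is used at t = \<open>inner 1 \<mu> / B\<close>. B is large enough
    for |t| \<le> 1 and dominates the quadratic coefficient, which leaves twice a square bounded by
    that square.\<close>
  define B where "B = 2 * K + K\<^sup>2 + \<bar>inner 1 \<mu>\<bar> + 1"
  have B: "B > 0" "\<bar>inner 1 \<mu>\<bar> \<le> B" "2 * K + K\<^sup>2 \<le> B" using K(1) zero_le_power2[of K] unfolding B_def by linarith+
  have "2 * (inner 1 \<mu> / B) * inner 1 \<mu> \<le> (2 * K + K\<^sup>2) * (inner 1 \<mu> / B)\<^sup>2"
    using B by (intro *) (auto simp: field_simps)
  also have "\<dots> \<le> B * (inner 1 \<mu> / B)\<^sup>2" using B by (intro mult_right_mono) auto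
  finally have "2 * (inner 1 \<mu>)\<^sup>2 \<le> (inner 1 \<mu>)\<^sup>2"
    using B(1) by (simp add: power2_eq_square field_simps)
  then show False using ne by simp
qed

text \<open>Swapping block c with c' is an isometry fixing the block of \<alpha>, so each summand is
  a conjugate of the given operator. The sum couples one vector with many blocks at once.\<close>

lemma skew_spread:
  assumes A: "skew (bsp p n) M (\<lambda>x. smul (a * x (c, j)) (ev \<alpha>) + smul (d * x \<alpha>) (ev (c, j)))"
    and ne: "fst \<alpha> \<noteq> c" and J: "finite J" "J \<subseteq> {c'. n c' = n c}" "fst \<alpha> \<notin> J"
  shows "skew (bsp p n) M (\<lambda>x. \<Sum>c'\<in>J. smul (a * x (c', j)) (ev \<alpha>) + smul (d * x \<alpha>) (ev (c', j)))"
proof (rule skew_sum[OF J(1)])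
  fix c' assume c': "c' \<in> J"
  let ?S = "swap_blocks c c' :: _ \<Rightarrow> _ \<Rightarrow> 'k"
  have "fst \<alpha> \<noteq> c'" "n c = n c'" using c' J by auto
  have x: "?S x (c, j) = x (c', j)" "?S x \<alpha> = x \<alpha>" for x
    using ne \<open>fst \<alpha> \<noteq> c'\<close> by (auto simp: swap_blocks_def Transposition.transpose_def)
  have e: "?S (ev \<alpha>) = ev \<alpha>" "?S (ev (c, j)) = ev (c', j)"
    using ne \<open>fst \<alpha> \<noteq> c'\<close>
    by (auto simp: swap_blocks_def ev_def fun_eq_iff prod_eq_iff Transposition.transpose_def)
  have l: "?S (x + y) = ?S x + ?S y" "?S (smul r x) = smul r (?S x)" for x y r
    by (auto simp: swap_blocks_def)
  show "skew (bsp p n) M (\<lambda>x. smul (a * x (c', j)) (ev \<alpha>) + smul (d * x \<alpha>) (ev (c', j)))"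
    using skew_conj[OF isom_pair_M[OF swap_blocks_isom[of n c c', OF \<open>n c = n c'\<close>]] subsp A]
    by (simp only: x e l)
qed

lemma powr_unbounded:
  fixes e :: real
  assumes "e > 0"
  shows "\<exists>m::nat. 1 \<le> m \<and> X < real m powr e"
proof -
  define Y where "Y = \<bar>X\<bar> + 1"
  obtain m :: nat where m: "Y powr (1/e) < real m" using reals_Archimedean2 by blast
  have "X < Y" by (simp add: Y_def)
  also have "Y = (Y powr (1/e)) powr e" using assms by (simp add: powr_powr Y_def)
  also have "\<dots> < real m powr e" using m assms by (intro powr_less_mono2) auto
  finally have "X < real m powr e" .
  moreover have "m \<noteq> 0" using m by (metis not_less of_nat_0 powr_ge_zero)
  ultimately show ?thesis by (intro exI[of _ m]) auto
qed

text \<open>A sum of m unit vectors from different blocks has \<open>bnorm\<close> m powr (1/p), so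
  M of it lies between multiples of that. Growth like the square root of m violates the lower
  estimate when p < 2 and the upper one when p > 2. The omitted block b will be the one in which the
  rotation starts.\<close>

lemma sqrt_growth_contradiction:
  assumes c: "snd (c, j) < n c" and \<kappa>: "\<kappa> > 0"
    and W: "\<And>J. finite J \<Longrightarrow> J \<noteq> {} \<Longrightarrow> J \<subseteq> {c'. n c' = n c} - {b} \<Longrightarrow>
      M (\<Sum>c'\<in>J. ev (c', j)) = \<kappa> * sqrt (card J)"
  shows False
proof -
  obtain lo hi where eq: "lo > 0" "hi > 0"
    "\<And>x. x \<in> bsp p n \<Longrightarrow> lo * bnorm p n x \<le> M x" "\<And>x. x \<in> bsp p n \<Longrightarrow> M x \<le> hi * bnorm p n x"
    using equiv by blast
  have bd: "lo * real m powr (1/p) \<le> \<kappa> * real m powr (1/2)" "\<kappa> * real m powr (1/2) \<le> hi * real m powr (1/p)" if "1 \<le> m" for m :: nat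
  proof -
    obtain J where J: "J \<subseteq> {c'. n c' = n c} - {b}" "finite J" "card J = m"
      using infinite_arbitrarily_large[of "{c'. n c' = n c} - {b}" m] mult[of c] by auto
    have "J \<noteq> {}" using J that by auto
    have jn: "\<And>c'. c' \<in> J \<Longrightarrow> j < n c'" using J c by auto
    note b = bnorm_sum_ev[where 'k = 'k, OF p1 J(2) jn]
    show "lo * real m powr (1/p) \<le> \<kappa> * real m powr (1/2)" "\<kappa> * real m powr (1/2) \<le> hi * real m powr (1/p)"
      using eq(3,4)[OF b(1)] W[OF J(2) \<open>J \<noteq> {}\<close> J(1)] b(2) J(3) by (simp_all add: powr_half_sqrt)
  qed
  show False
  proof (cases "1/p - 1/2 > 0")
    case True
    from powr_unbounded[OF this, of "\<kappa> / lo"] obtain m :: nat where m: "1 \<le> m" "\<kappa> / lo < real m powr (1/p - 1/2)" by blast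
    have "lo * real m powr (1/p - 1/2) \<le> \<kappa>"
      unfolding powr_diff using bd(1)[OF m(1)] m(1) by (simp add: field_simps)
    then show False using m(2) eq(1) by (simp add: field_simps)
  next
    case False
    then have "1/2 - 1/p > 0" using p by (auto simp: field_simps)
    from powr_unbounded[OF this, of "hi / \<kappa>"] obtain m :: nat where m: "1 \<le> m" "hi / \<kappa> < real m powr (1/2 - 1/p)" by blast
    have "\<kappa> * real m powr (1/2 - 1/p) \<le> hi"
      unfolding powr_diff using bd(2)[OF m(1)] m(1) by (simp add: field_simps)
    then show False using m(2) \<kappa> by (simp add: field_simps)
  qed
qed

text \<open>Let W be the sum of the vectors \<open>ev (c', j)\<close>. The spread operator B maps
  \<open>ev \<alpha>\<close> to dW and W to card J times a \<open>ev \<alpha>\<close>, so on their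
  span its square is - w^2 with w = r sqrt (card J). Its orbit through \<open>ev \<alpha>\<close>
  has constant norm and reaches dW / w after a quarter period.\<close>

lemma skew_rotation_norm:
  fixes r :: real
  assumes A: "skew (bsp p n) M (\<lambda>x. smul (a * x (c, j)) (ev \<alpha>) + smul (d * x \<alpha>) (ev (c, j)))"
    and ne: "fst \<alpha> \<noteq> c" and \<alpha>: "snd \<alpha> < n (fst \<alpha>)" and j: "j < n c"
    and J: "finite J" "J \<noteq> {}" "J \<subseteq> {c'. n c' = n c}" "fst \<alpha> \<notin> J"
    and ad: "a * d = - of_real (r\<^sup>2)" and r: "r > 0"
  shows "norm d * M (\<Sum>c'\<in>J. ev (c', j)) = r * M (ev \<alpha>) * sqrt (card J)"
proof -
  define B where "B x = (\<Sum>c'\<in>J. smul (a * x (c', j)) (ev \<alpha>) + smul (d * x \<alpha>) (ev (c', j)))" for x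
  define W where "W = (\<Sum>c'\<in>J. ev (c', j) :: _ \<Rightarrow> 'k)"
  define w where "w = sqrt (card J) * r"
  define x where "x t = smul (of_real (cos (w * t))) (ev \<alpha>) + smul (of_real (sin (w * t) / w) * d) W" for t
  have skB: "skew (bsp p n) M B" unfolding B_def by (rule skew_spread[OF A ne J(1,3,4)])
  have cJ: "card J > 0" using J by (simp add: card_gt_0_iff)
  then have w: "w > 0" "w * w = card J * r\<^sup>2" using r by (auto simp: w_def power2_eq_square)
  have eV: "ev \<alpha> \<in> bsp p n" by (rule ev_V[OF \<alpha>])
  have WV: "W \<in> bsp p n"
    unfolding W_def using J j by (intro bnorm_sum_ev(1)[OF p1]) auto
  have Wa: "W \<alpha> = 0" using J(4) by (auto simp: W_def sum_fun_apply ev_def intro!: sum.neutral)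
  have Wc: "W (c', j) = 1" if "c' \<in> J" for c'
    using that J(1) by (simp add: W_def sum_fun_apply ev_def)
  have xV: "x t \<in> bsp p n" for t unfolding x_def by (intro V_add V_scale eV WV)
  have Bx: "B (x t) = smul (of_real (- w * sin (w * t))) (ev \<alpha>) + smul (of_real (cos (w * t)) * d) W" for t
  proof -
    have xa: "x t \<alpha> = of_real (cos (w * t))" using Wa by (simp add: x_def ev_def)
    have xc: "x t (c', j) = of_real (sin (w * t) / w) * d" if "c' \<in> J" for c'
      using Wc[OF that] J(4) that by (auto simp: x_def ev_def)
    have "B (x t) = (\<Sum>c'\<in>J. smul (a * d * of_real (sin (w * t) / w)) (ev \<alpha>) + smul (of_real (cos (w * t)) * d) (ev (c', j)))"
      unfolding B_def by (rule sum.cong) (auto simp: xa xc mult_ac)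
    also have "\<dots> = smul (of_nat (card J) * (a * d * of_real (sin (w * t) / w))) (ev \<alpha>) + smul (of_real (cos (w * t)) * d) W"
      by (auto simp: sum.distrib sum_fun_apply W_def fun_eq_iff sum_distrib_left mult_ac)
    also have "of_nat (card J) * (a * d * of_real (sin (w * t) / w)) = of_real (- (card J * r\<^sup>2) * (sin (w * t) / w))"
      by (simp add: ad)
    also have "- (card J * r\<^sup>2) * (sin (w * t) / w) = - w * sin (w * t)"
      unfolding w(2)[symmetric] using w(1) by (simp add: field_simps)
    finally show ?thesis .
  qed
  \<comment> \<open>The Taylor remainders of cosine and sine are at most (wh)^2; the second is
    multiplied by |d| M W / w, which accounts for the single factor w there.\<close>
  define L where "L = w\<^sup>2 * M (ev \<alpha>) + w * norm d * M W"
  have "M (x (t + h) - (x t + smul (of_real h) (B (x t)))) \<le> L * h\<^sup>2" for t h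
  proof -
    let ?c = "cos (w * t + w * h) - cos (w * t) + (w * h) * sin (w * t)"
    let ?s = "sin (w * t + w * h) - sin (w * t) - (w * h) * cos (w * t)"
    have "x (t + h) - (x t + smul (of_real h) (B (x t))) = smul (of_real ?c) (ev \<alpha>) + smul (of_real (?s / w) * d) W"
      unfolding Bx unfolding x_def using w(1) by (auto simp: fun_eq_iff field_simps)
    then have "M (x (t + h) - (x t + smul (of_real h) (B (x t)))) \<le> M (smul (of_real ?c) (ev \<alpha>)) + M (smul (of_real (?s / w) * d) W)"
      using triangle[OF V_scale[OF eV] V_scale[OF WV]] by simp
    also have "\<dots> = \<bar>?c\<bar> * M (ev \<alpha>) + \<bar>?s\<bar> * (norm d * M W / w)"
      using w(1) by (simp add: scale[OF eV] scale[OF WV] norm_mult norm_divide flip: of_real_diff of_real_add of_real_mult)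
    also have "\<dots> \<le> (w * h)\<^sup>2 * M (ev \<alpha>) + (w * h)\<^sup>2 * (norm d * M W / w)"
      using cos_sin_taylor[of "w * t" "w * h"] nonneg[OF eV] nonneg[OF WV] w(1)
      by (intro add_mono mult_right_mono) auto
    also have "\<dots> = L * h\<^sup>2" using w(1) by (simp add: L_def power2_eq_square algebra_simps)
    finally show ?thesis .
  qed
  from skew_curve_constant[OF skB xV this, of "pi / (2 * w)"]
  have "M (x (pi / (2 * w))) = M (x 0)" by simp
  moreover have "x (pi / (2 * w)) = smul (of_real (1 / w) * d) W" "x 0 = ev \<alpha>"
    using w(1) by (auto simp: x_def)
  ultimately have "norm d / w * M W = M (ev \<alpha>)"
    using scale[OF WV] w(1) by (simp add: norm_mult norm_divide)
  then have "norm d * M W = M (ev \<alpha>) * w" using w(1) by (simp add: field_simps)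
  then show ?thesis by (simp add: W_def w_def mult_ac)
qed

lemma skew_off_block:
  assumes D: "skew (bsp p n) M D" and \<alpha>: "snd \<alpha> < n (fst \<alpha>)" and \<beta>: "snd \<beta> < n (fst \<beta>)"
    and ne: "fst \<alpha> \<noteq> fst \<beta>"
  shows "D (ev \<beta>) \<alpha> = 0"
proof (rule ccontr)
  assume nz: "D (ev \<beta>) \<alpha> \<noteq> 0"
  obtain c j where cj: "\<beta> = (c, j)" by (cases \<beta>)
  define a where "a = 4 * D (ev \<beta>) \<alpha>"
  define d where "d = 4 * D (ev \<alpha>) \<beta>"
  have a: "a \<noteq> 0" using nz by (simp add: a_def)
  have "\<alpha> \<noteq> \<beta>" using ne by auto
  from skew_compress[OF D \<alpha> \<beta> this]
  have A: "skew (bsp p n) M (\<lambda>x. smul (a * x (c, j)) (ev \<alpha>) + smul (d * x \<alpha>) (ev (c, j)))" (is "skew _ _ ?A")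
    by (simp add: a_def d_def cj)
  have eV: "ev \<alpha> \<in> bsp p n" "ev \<beta> \<in> bsp p n" using ev_V[OF \<alpha>] ev_V[OF \<beta>] by auto
  have ev01: "ev \<alpha> \<beta> = (0::'k)" "ev \<beta> \<alpha> = (0::'k)" "ev \<beta> \<beta> = (1::'k)" "ev \<alpha> \<alpha> = (1::'k)"
    using \<open>\<alpha> \<noteq> \<beta>\<close> by (auto simp: ev_def)
  have M\<alpha>: "M (ev \<alpha>) > 0" using nonneg[OF eV(1)] eq_0_iff[OF eV(1)] ev_nz[of \<alpha>] by (metis less_le)
  \<comment> \<open>On the plane of the two unit vectors the compressed operator squares to a d. The
    dichotomy for square roots makes it a rotation, nilpotent, or an operator with an eigenvalue w
    whose real part \<open>inner 1 w\<close> is nonzero.\<close>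
  consider r where "r \<noteq> 0" "a * d = - of_real (r\<^sup>2)" | "a * d = 0" | w where "w * w = a * d" "inner 1 w \<noteq> 0"
    using square_root_dichotomy[of "a * d"] by (fastforce simp: scaleR_conv_of_real)
  then show False
  proof cases
    case 1
    then have d: "d \<noteq> 0" by auto
    show False
    proof (rule sqrt_growth_contradiction[of c j "\<bar>r\<bar> * M (ev \<alpha>) / norm d" "fst \<alpha>"])
      show "snd (c, j) < n c" using \<beta> cj by simp
      show "0 < \<bar>r\<bar> * M (ev \<alpha>) / norm d" using 1 d M\<alpha> by simp
      fix J assume J: "finite J" "J \<noteq> {}" "J \<subseteq> {c'. n c' = n c} - {fst \<alpha>}"
      have "norm d * M (\<Sum>c'\<in>J. ev (c', j)) = \<bar>r\<bar> * M (ev \<alpha>) * sqrt (card J)"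
        using J 1 ne \<beta> cj by (intro skew_rotation_norm[OF A _ \<alpha>]) auto
      then show "M (\<Sum>c'\<in>J. ev (c', j)) = \<bar>r\<bar> * M (ev \<alpha>) / norm d * sqrt (card J)"
        using d by (simp add: field_simps)
    qed
  next
    case 2
    then have d: "d = 0" using a by simp
    \<comment> \<open>Nilpotent case: this line solves x' = Ax exactly, so its norm would be
      constant although the line is unbounded.\<close>
    define x where "x t = ev \<beta> + smul (of_real t * a) (ev \<alpha>)" for t
    have xV: "x t \<in> bsp p n" for t unfolding x_def by (intro V_add V_scale eV)
    have x': "x (t + h) - (x t + smul (of_real h) (?A (x t))) = 0" for t h
      by (simp add: d x_def flip: cj) (auto simp: ev01 fun_eq_iff algebra_simps)
    have "M (x (t + h) - (x t + smul (of_real h) (?A (x t)))) \<le> 0 * h\<^sup>2" for t h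
      unfolding x' using eq_0_iff[OF V_0] by simp
    from skew_curve_constant[OF A xV this] have const: "M (x t) = M (x 0)" for t .
    have bd: "\<bar>t\<bar> * norm a * M (ev \<alpha>) \<le> 2 * M (ev \<beta>)" for t
    proof -
      have "smul (of_real t * a) (ev \<alpha>) = x t - ev \<beta>" by (simp add: x_def)
      then have "\<bar>t\<bar> * norm a * M (ev \<alpha>) \<le> M (x t) + M (ev \<beta>)"
        using triangle_diff[OF xV eV(2), of t] scale[OF eV(1), of "of_real t * a"] by (simp add: norm_mult)
      also have "M (x t) = M (ev \<beta>)" using const[of t] by (simp add: x_def)
      finally show ?thesis by simp
    qed
    have pos: "norm a * M (ev \<alpha>) > 0" using a M\<alpha> by simp
    show False
      using bd[of "(2 * M (ev \<beta>) + 1) / (norm a * M (ev \<alpha>))"] pos nonneg[OF eV(2)]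
      using a M\<alpha> by (simp add: mult.assoc)
  next
    case 3
    \<comment> \<open>Since w w = a d, this is an eigenvector for the eigenvalue w.\<close>
    define v where "v = smul a (ev \<alpha>) + smul w (ev \<beta>)"
    have v: "v \<in> bsp p n" unfolding v_def by (intro V_add V_scale eV)
    have v2: "v \<alpha> = a" "v \<beta> = w" by (auto simp: v_def ev01)
    then have "v \<noteq> 0" using a by auto
    have "?A v = smul w v"
      by (simp flip: cj add: v2) (auto simp: v_def fun_eq_iff 3(1) algebra_simps)
    from skew_eigenvalue[OF A v \<open>v \<noteq> 0\<close> this] 3(2) show False by simp
  qed
qed

end

section \<open>Isometries map blocks to blocks\<close>

context block_invariant
begin

lemma coordinate_bound: "\<exists>C>0. \<forall>x\<in>bsp p n. \<forall>\<gamma>. norm (x \<gamma>) \<le> C * M x"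
proof -
  obtain lo where lo: "lo > 0" "\<And>x. x \<in> bsp p n \<Longrightarrow> lo * bnorm p n x \<le> M x"
    using equiv by blast
  have "norm (x \<gamma>) \<le> 1 / lo * M x" if "x \<in> bsp p n" for x \<gamma>
  proof -
    have "lo * norm (x \<gamma>) \<le> lo * bnorm p n x"
      using lo(1) norm_le_bnorm[OF p1 that] by simp
    also have "\<dots> \<le> M x" by (rule lo(2)[OF that])
    finally show ?thesis using lo(1) by (simp add: field_simps)
  qed
  then show ?thesis using lo(1) by (intro exI[of _ "1 / lo"]) auto
qed

text \<open>Finitely supported vectors are dense and D is bounded. The target space is left free
  because the lemma is also applied to operators into another block sum.\<close>

lemma vanishing_on_ev:
  assumes W: "normed_subspace W N" and lin: "lin_on (bsp p n) D"
    and DW: "\<And>x. x \<in> bsp p n \<Longrightarrow> D x \<in> W" and C: "\<And>x. x \<in> bsp p n \<Longrightarrow> N (D x) \<le> C * M x"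
    and ev: "\<And>\<beta>. snd \<beta> < n (fst \<beta>) \<Longrightarrow> D (ev \<beta>) = 0" and x: "x \<in> bsp p n"
  shows "D x = 0"
proof -
  interpret W: normed_subspace W N by fact
  obtain hi where hi: "hi > 0" "\<And>x. x \<in> bsp p n \<Longrightarrow> M x \<le> hi * bnorm p n x"
    using equiv by blast
  have "N (D x) \<le> \<bar>C\<bar> * hi * \<epsilon>" if \<epsilon>: "\<epsilon> > 0" for \<epsilon>
  proof -
    obtain F where F: "finite F" "bnorm p n (x - trunc F x) < \<epsilon>"
      using trunc_approx[OF p1 x \<epsilon>] by blast
    let ?I = "SIGMA b:F. {..<n b}"
    have V: "x - trunc F x \<in> bsp p n" by (intro V_diff x trunc_bsp)
    have "D (trunc F x) = (\<Sum>\<beta>\<in>?I. D (smul (x \<beta>) (ev \<beta>)))"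
      unfolding trunc_finite_eq_sum[OF x F(1)]
      using F(1) by (intro lin_on_sum[OF subsp lin]) (auto intro!: V_scale ev_V)
    also have "\<dots> = 0"
      by (intro sum.neutral) (auto simp: lin_on_smul[OF lin ev_V] ev)
    finally have "D x = D (x - trunc F x)"
      using lin_on_diff[OF subsp lin x trunc_bsp[OF x]] by simp
    then have "N (D x) \<le> C * M (x - trunc F x)" using C[OF V] by simp
    also have "\<dots> \<le> \<bar>C\<bar> * (hi * \<epsilon>)"
      using order_trans[OF hi(2)[OF V] mult_left_mono[OF less_imp_le[OF F(2)]]] hi(1) nonneg[OF V]
      by (intro mult_mono) auto
    finally show ?thesis by simp
  qed
  note * = this
  have "N (D x) \<le> 0"
  proof (rule field_le_epsilon)
    fix e :: real assume "e > 0"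
    have "K * (e / (K + 1)) \<le> e" if "K \<ge> 0" for K :: real
      using that \<open>e > 0\<close> by (simp add: pos_divide_le_eq add_nonneg_pos algebra_simps)
    from this[of "\<bar>C\<bar> * hi"] have "\<bar>C\<bar> * hi * (e / (\<bar>C\<bar> * hi + 1)) \<le> e"
      using hi(1) by simp
    then show "N (D x) \<le> 0 + e"
      using *[of "e / (\<bar>C\<bar> * hi + 1)"] \<open>e > 0\<close> hi(1) by (smt (verit) divide_pos_pos mult_nonneg_nonneg)
  qed
  then show ?thesis using W.nonneg[OF DW[OF x]] W.eq_0_iff[OF DW[OF x]] by simp
qed

definition block_flip :: "'b \<Rightarrow> ('b \<times> nat \<Rightarrow> 'k) \<Rightarrow> ('b \<times> nat \<Rightarrow> 'k)" where
  "block_flip k = sgn_flip ({k} \<times> UNIV)"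

lemma block_flip_apply: "block_flip k x \<gamma> = (if fst \<gamma> = k then - x \<gamma> else x \<gamma>)"
  by (cases \<gamma>) (simp add: block_flip_def sgn_flip_apply)

lemma block_flip_isom: "isom_pair (bsp p n) M (bsp p n) M (block_flip k) (block_flip k)"
  unfolding block_flip_def by (rule sgn_flip_isom)

lemma block_flip_simps [simp]:
  "block_flip k (block_flip k x) = x" "block_flip k (smul c x) = smul c (block_flip k x)"
  "block_flip k (x + y) = block_flip k x + block_flip k y"
  by (auto simp: block_flip_apply fun_eq_iff)

lemma block_flip_V: "x \<in> bsp p n \<Longrightarrow> block_flip k x \<in> bsp p n"
  and block_flip_M: "x \<in> bsp p n \<Longrightarrow> M (block_flip k x) = M x"
  using block_flip_isom[of k] by (auto simp: isom_pair_def)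

lemma block_flip_ev: "block_flip k (ev \<beta>) = (if fst \<beta> = k then - ev \<beta> else ev \<beta>)"
  by (auto simp: block_flip_apply ev_def fun_eq_iff)

text \<open>Block diagonality in a form suited to conjugation: commutation with the reflection of
  every block. In the difference E the entries inside a block cancel, those between blocks vanish by
  \<open>skew_off_block\<close>, and density does the rest.\<close>

lemma skew_commutes_block_flip:
  assumes D: "skew (bsp p n) M D" and x: "x \<in> bsp p n"
  shows "D (block_flip k x) = block_flip k (D x)"
proof -
  define E where "E x = D x - block_flip k (D (block_flip k x))" for x
  have E: "skew (bsp p n) M E"
    unfolding E_def by (intro skew_diff D skew_conj[OF block_flip_isom subsp])
  then obtain C where E': "lin_on (bsp p n) E" "\<And>x. x \<in> bsp p n \<Longrightarrow> E x \<in> bsp p n"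
    "\<And>x. x \<in> bsp p n \<Longrightarrow> M (E x) \<le> C * M x" by (auto simp: skew_def)
  have lin: "lin_on (bsp p n) D" using D by (simp add: skew_def)
  have "E (ev \<beta>) = 0" if \<beta>: "snd \<beta> < n (fst \<beta>)" for \<beta>
  proof
    fix \<gamma>
    show "E (ev \<beta>) \<gamma> = 0 \<gamma>"
    proof (cases "snd \<gamma> < n (fst \<gamma>)")
      case True
      have "D (ev \<beta>) \<gamma> = 0" if "fst \<gamma> \<noteq> fst \<beta>"
        by (rule skew_off_block[OF D True \<beta> that])
      then show ?thesis
        by (auto simp: E_def block_flip_ev block_flip_apply lin_on_minus[OF lin ev_V[OF \<beta>]])
    next
      case False
      then show ?thesis
        using bsp_outside[OF E'(2)[OF ev_V[OF \<beta>]], of "fst \<gamma>" "snd \<gamma>"] by simp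
    qed
  qed
  from vanishing_on_ev[OF normed_subspace_axioms E' this]
  have "E y = 0" if "y \<in> bsp p n" for y using that by blast
  from this[OF block_flip_V[OF x]] show ?thesis by (simp add: E_def)
qed

text \<open>The generator of rotations in a coordinate plane of block b.\<close>

definition rot_gen :: "'b \<Rightarrow> nat \<Rightarrow> nat \<Rightarrow> ('b \<times> nat \<Rightarrow> 'k) \<Rightarrow> ('b \<times> nat \<Rightarrow> 'k)" where
  "rot_gen b i j x = smul (x (b, j)) (ev (b, i)) - smul (x (b, i)) (ev (b, j))"

text \<open>With r = sqrt (1 + t^2), the operator I + tR is r times a rotation on the plane and the
  identity off it. The rotation preserves M, and the stretching on the plane costs r - 1 \<le>
  t^2.\<close>

lemma skew_rot_gen:
  assumes ij: "i < n b" "j < n b" "i \<noteq> j"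
  shows "skew (bsp p n) M (rot_gen b i j)"
proof -
  obtain C where C: "C > 0" "\<And>x \<gamma>. x \<in> bsp p n \<Longrightarrow> norm (x \<gamma>) \<le> C * M x"
    using coordinate_bound by blast
  have eV: "ev (b, i) \<in> bsp p n" "ev (b, j) \<in> bsp p n" using ij by (auto intro!: ev_V)
  define C' where "C' = C * (M (ev (b, i)) + M (ev (b, j)))"
  have C': "C' \<ge> 0" using C(1) nonneg[OF eV(1)] nonneg[OF eV(2)] by (simp add: C'_def)
  have two: "M (smul u (ev (b, i)) + smul v (ev (b, j))) \<le> C' * m"
    if "norm u \<le> C * m" "norm v \<le> C * m" for u v m
  proof -
    have "M (smul u (ev (b, i)) + smul v (ev (b, j))) \<le> norm u * M (ev (b, i)) + norm v * M (ev (b, j))"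
      using triangle[OF V_scale[OF eV(1)] V_scale[OF eV(2)]] by (simp add: scale eV)
    also have "\<dots> \<le> C * m * M (ev (b, i)) + C * m * M (ev (b, j))"
      using that nonneg eV by (intro add_mono mult_right_mono) auto
    finally show ?thesis by (simp add: C'_def algebra_simps)
  qed
  have rg: "rot_gen b i j x = smul (x (b, j)) (ev (b, i)) + smul (- x (b, i)) (ev (b, j))" for x
    by (auto simp: rot_gen_def)
  have "M (x + smul (of_real t) (rot_gen b i j x)) \<le> (1 + C' * t\<^sup>2) * M x"
    if x: "x \<in> bsp p n" for x t
  proof -
    define r where "r = sqrt (1 + t\<^sup>2)"
    have r: "r > 0" "r * r = 1 + t\<^sup>2" using zero_le_power2[of t] by (auto simp: r_def add_pos_nonneg)
    have r1: "r \<ge> 1" "r - 1 \<le> t\<^sup>2"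
    proof -
      show "r \<ge> 1" by (simp add: r_def)
      then have "r \<le> r * r" by simp
      then show "r - 1 \<le> t\<^sup>2" using r by simp
    qed
    \<comment> \<open>The rotation, written as a reflection followed by a sign change.\<close>
    define y where "y = sgn_flip {(b, j)} (plane_reflection b i j (1 / r) (t / r) x)"
    have "(1 / r)\<^sup>2 + (t / r)\<^sup>2 = 1"
      using r(1) by (simp add: power_divide flip: add_divide_distrib) (simp add: power2_eq_square r(2))
    note iso = isom_pair_comp[OF isom_pair_M[OF plane_reflection_isom[of i n b j, OF ij this]] sgn_flip_isom[of "{(b,j)}"]]
    have y: "y \<in> bsp p n" "M y = M x"
      using iso x by (auto simp: isom_pair_def y_def)
    have yij: "y (b, i) = (1 / r) *\<^sub>R x (b, i) + (t / r) *\<^sub>R x (b, j)"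
      "y (b, j) = (1 / r) *\<^sub>R x (b, j) - (t / r) *\<^sub>R x (b, i)"
      using ij by (auto simp: y_def sgn_flip_apply plane_reflection_def)
    have yo: "y \<gamma> = x \<gamma>" if "\<gamma> \<noteq> (b, i)" "\<gamma> \<noteq> (b, j)" for \<gamma>
      using that by (simp add: y_def sgn_flip_apply plane_reflection_def)
    define z where "z = smul (y (b, i)) (ev (b, i)) + smul (y (b, j)) (ev (b, j))"
    have z: "z \<in> bsp p n" "M z \<le> C' * M y"
      using two[OF C(2)[OF y(1)] C(2)[OF y(1)]] by (auto simp: z_def intro!: V_add V_scale eV)
    have ry: "y (b, i) + (of_real r - 1) * y (b, i) = x (b, i) + of_real t * x (b, j)"
      "y (b, j) + (of_real r - 1) * y (b, j) = x (b, j) - of_real t * x (b, i)"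
      unfolding yij using r(1) by (auto simp: scaleR_conv_of_real field_simps)
    have "x + smul (of_real t) (rot_gen b i j x) = y + smul (of_real (r - 1)) z"
    proof
      fix \<gamma>
      consider "\<gamma> = (b, i)" | "\<gamma> = (b, j)" | "\<gamma> \<noteq> (b, i)" "\<gamma> \<noteq> (b, j)" by blast
      then show "(x + smul (of_real t) (rot_gen b i j x)) \<gamma> = (y + smul (of_real (r - 1)) z) \<gamma>"
        by cases (use ij ry yo in \<open>auto simp: rot_gen_def z_def ev_def\<close>)
    qed
    then have "M (x + smul (of_real t) (rot_gen b i j x)) \<le> M y + (r - 1) * M z"
      using triangle[OF y(1) V_scale[OF z(1)], of "of_real (r - 1)"] scale[OF z(1), of "of_real (r - 1)"] r1(1)
      by (simp del: of_real_diff)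
    also have "\<dots> \<le> M x + t\<^sup>2 * (C' * M x)"
      using z r1 y nonneg[OF z(1)] by (auto intro!: mult_mono)
    finally show ?thesis by (simp add: algebra_simps)
  qed
  moreover have "M (rot_gen b i j x) \<le> C' * M x" if "x \<in> bsp p n" for x
    unfolding rg using C(2)[OF that] by (intro two) auto
  moreover have "lin_on (bsp p n) (rot_gen b i j)"
    by (auto simp: lin_on_def rot_gen_def fun_eq_iff algebra_simps)
  moreover have "rot_gen b i j x \<in> bsp p n" for x
    unfolding rg by (intro V_add V_scale eV)
  ultimately show ?thesis using C' unfolding skew_def by blast
qed

lemma rot_gen_ev: "i \<noteq> j \<Longrightarrow> rot_gen b i j (ev (b, j)) = ev (b, i)"
  by (auto simp: rot_gen_def ev_def fun_eq_iff)

section \<open>Invariant norms restricted to one block\<close>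

lemma phase_invariant:
  assumes "\<And>\<gamma>. norm (u \<gamma>) = 1" "x \<in> bsp p n"
  shows "phase u x \<in> bsp p n" "M (phase u x) = M x" "blk n (phase u x) b = blk n x b"
  using isom_pair_M[OF phase_isom[of u], OF assms(1)] assms
  by (auto simp: isom_pair_def phase_def norm_mult intro!: blk_cong)

text \<open>Phases and plane reflections move any vector of the block onto its first axis without
  changing M or the Euclidean norm. The induction counts the nonzero coordinates off that
  axis.\<close>

lemma M_on_block:
  assumes "x \<in> bsp p n" "\<And>\<gamma>. fst \<gamma> \<noteq> b \<Longrightarrow> x \<gamma> = 0"
  shows "M x = blk n x b * M (ev (b, 0))"
  using assms
proof (induction "card {i. 0 < i \<and> x (b, i) \<noteq> 0}" arbitrary: x)
  have 0: "0 < n b" using dims[of b] by simp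
  have fin: "finite {i. 0 < i \<and> x (b, i) \<noteq> 0}" if "x \<in> bsp p n" for x :: "_ \<Rightarrow> 'k"
    by (rule finite_subset[of _ "{..<n b}"]) (use bsp_outside[OF that] in \<open>auto simp: not_less[symmetric]\<close>)
  {
    case 0
    have e: "ev (b, 0) \<in> bsp p n" by (rule ev_V) (use dims[of b] in simp)
    have "{i. 0 < i \<and> x (b, i) \<noteq> 0} = {}" using 0(1) fin[OF 0(2)] by simp
    then have "x (b, i) = 0" if "0 < i" for i using that by blast
    then have z: "x (c, i) = 0" if "(c, i) \<noteq> (b, 0)" for c i
      using 0(3)[of "(c, i)"] that by (cases "c = b") auto
    have "\<exists>c. x = smul c (ev (b, 0))"
      by (rule exI[of _ "x (b, 0)"]) (use z in \<open>auto simp: fun_eq_iff ev_def\<close>)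
    then obtain c where "x = smul c (ev (b, 0))" ..
    moreover have "M (smul c (ev (b, 0))) = blk n (smul c (ev (b, 0))) b * M (ev (b, 0))" for c
      using dims[of b] scale[OF e] by (simp add: blk_smul blk_ev)
    ultimately show ?case by (simp only:)
  next
    case (Suc k)
    have "{i. 0 < i \<and> x (b, i) \<noteq> 0} \<noteq> {}" using Suc(2) by (metis Zero_not_Suc card.empty)
    then obtain i where i: "0 < i" "x (b, i) \<noteq> 0" by auto
    have ib: "i < n b" using bsp_outside[OF Suc(3), of b i] i(2) by (meson not_less)
    \<comment> \<open>The phases make all coordinates real and nonnegative; only then can a
      reflection with real coefficients annihilate one of them.\<close>
    define u where "u \<gamma> = (if x \<gamma> = 0 then 1 else of_real (norm (x \<gamma>)) / x \<gamma>)" for \<gamma>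
    have u: "norm (u \<gamma>) = 1" for \<gamma> by (simp add: u_def norm_divide)
    define y where "y = phase u x"
    have y: "y \<in> bsp p n" "M y = M x" "blk n y b = blk n x b"
      unfolding y_def by (rule phase_invariant[OF u Suc(3)])+
    have yx: "y \<gamma> = of_real (norm (x \<gamma>))" for \<gamma> by (simp add: y_def phase_def u_def)
    define r where "r = sqrt ((norm (x (b, 0)))\<^sup>2 + (norm (x (b, i)))\<^sup>2)"
    have r: "r > 0" using i(2) by (simp add: r_def add_nonneg_pos)
    \<comment> \<open>With c and s the direction of the pair of coordinates 0 and i, the reflection
      sends that pair to (r, 0).\<close>
    define c where "c = norm (x (b, 0)) / r"
    define s where "s = norm (x (b, i)) / r"
    have cs: "c\<^sup>2 + s\<^sup>2 = 1"
      using r i(2) by (simp add: c_def s_def power_divide flip: add_divide_distrib) (simp add: r_def add_nonneg_pos)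
    define z where "z = plane_reflection b 0 i c s y"
    have z: "z \<in> bsp p n" "M z = M y"
      using isom_pair_M[OF plane_reflection_isom[of 0 n b i, OF 0 ib _ cs]] i(1) y(1) by (auto simp: isom_pair_def z_def)
    have bz: "blk n z b = blk n y b"
      unfolding z_def using 0 ib i(1) cs by (intro blk_plane_reflection) auto
    have zi: "z (b, i) = 0"
      using i(1) by (simp add: z_def plane_reflection_def yx c_def s_def scaleR_conv_of_real)
    have zl: "z \<gamma> = y \<gamma>" if "\<gamma> \<noteq> (b, 0)" "\<gamma> \<noteq> (b, i)" for \<gamma>
      using that by (simp add: z_def plane_reflection_def)
    have "{l. 0 < l \<and> z (b, l) \<noteq> 0} = {l. 0 < l \<and> x (b, l) \<noteq> 0} - {i}"
    proof (rule Set.set_eqI)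
      fix l
      show "l \<in> {l. 0 < l \<and> z (b, l) \<noteq> 0} \<longleftrightarrow> l \<in> {l. 0 < l \<and> x (b, l) \<noteq> 0} - {i}"
        by (cases "l = i"; cases "l = 0") (auto simp: zi zl yx)
    qed
    then have "k = card {l. 0 < l \<and> z (b, l) \<noteq> 0}"
      using Suc(2) i fin[OF Suc(3)] by simp
    moreover have "z \<gamma> = 0" if "fst \<gamma> \<noteq> b" for \<gamma>
    proof -
      have "\<gamma> \<noteq> (b, 0)" "\<gamma> \<noteq> (b, i)" using that by auto
      from zl[OF this] show ?thesis by (simp add: yx Suc(4)[OF that])
    qed
    ultimately have "M z = blk n z b * M (ev (b, 0))"
      by (intro Suc(1) z(1)) auto
    then show ?case using z(2) y bz by simp
  }
qed

lemma M_ev_eq: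
  assumes "n b = n c"
  shows "M (ev (b, 0)) = M (ev (c, 0))"
proof -
  have "swap_blocks b c (ev (b, 0) :: _ \<Rightarrow> 'k) = ev (c, 0)"
    by (auto simp: swap_blocks_def ev_def fun_eq_iff Transposition.transpose_def)
  moreover have "ev (b, 0) \<in> bsp p n" using dims[of b] by (intro ev_V) simp
  ultimately show ?thesis
    using isom_pair_M[OF swap_blocks_isom[of n b c, OF assms]] unfolding isom_pair_def by force
qed

end

lemma eq_uminus_self_iff: "x = - x \<longleftrightarrow> x = (0 :: 'a::real_normed_field)"
  by (simp add: eq_neg_iff_add_eq_0 flip: mult_2)

text \<open>Two possibly different sums and norms: the same sum and norm twice gives maximality, two
  sums give non-conjugacy.\<close>

locale block_isometry =
  A: block_invariant p n M + B: block_invariant p m N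
  for p :: real and n :: "'b \<Rightarrow> nat" and M :: "('b \<times> nat \<Rightarrow> 'k::scalar_field) \<Rightarrow> real"
    and m :: "'c \<Rightarrow> nat" and N :: "('c \<times> nat \<Rightarrow> 'k) \<Rightarrow> real" +
  fixes T S
  assumes iso: "isom_pair (bsp p n) M (bsp p m) N T S"
begin

lemma T_lin: "lin_on (bsp p n) T" and T_V: "x \<in> bsp p n \<Longrightarrow> T x \<in> bsp p m"
  and ST: "x \<in> bsp p n \<Longrightarrow> S (T x) = x" and TS: "y \<in> bsp p m \<Longrightarrow> T (S y) = y"
  and S_V: "y \<in> bsp p m \<Longrightarrow> S y \<in> bsp p n" and T_N: "x \<in> bsp p n \<Longrightarrow> N (T x) = M x"
  using iso by (auto simp: isom_pair_def)

lemma S_lin: "lin_on (bsp p m) S"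
  using isom_pair_sym[OF iso A.subsp] by (simp add: isom_pair_def)

lemma T_nz: "x \<in> bsp p n \<Longrightarrow> x \<noteq> 0 \<Longrightarrow> T x \<noteq> 0"
  using ST[of x] lin_on_0[OF S_lin B.subsp] by auto

lemma inverse: "block_isometry p m N n M S T"
  by unfold_locales (rule isom_pair_sym[OF iso A.subsp])

text \<open>The involution S R T, with R the reflection in block k, commutes with all plane rotations of a
  block of dimension at least 3, so it is plus or minus the identity on that block.\<close>

lemma conjugated_flip_scalar:
  "\<exists>c. \<forall>i<n b. S (B.block_flip k (T (ev (b, i)))) = smul c (ev (b, i))"
proof -
  define P where "P x = S (B.block_flip k (T x))" for x
  have comm: "A.rot_gen b i j (P x) = P (A.rot_gen b i j x)"
    if ij: "i < n b" "j < n b" "i \<noteq> j" and x: "x \<in> bsp p n" for i j x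
  proof -
    let ?D = "A.rot_gen b i j"
    have D: "skew (bsp p n) M ?D" by (rule A.skew_rot_gen[OF ij])
    then have DV: "?D y \<in> bsp p n" if "y \<in> bsp p n" for y using that by (auto simp: skew_def)
    have PV: "P x \<in> bsp p n" unfolding P_def by (intro S_V B.block_flip_V T_V x)
    \<comment> \<open>The plane generator, conjugated by T, is skew for N and therefore commutes
      with the block reflection in the target. Pulling this back by S gives the commutation with
      P.\<close>
    from B.skew_commutes_block_flip[OF skew_conj[OF iso A.subsp D] T_V[OF x], of k]
    have "T (?D (P x)) = B.block_flip k (T (?D x))"
      by (simp add: P_def ST x)
    then show ?thesis using ST[OF DV[OF PV]] by (simp add: P_def)
  qed
  have e: "ev (b, i) \<in> bsp p n" if "i < n b" for i using that by (intro A.ev_V) simp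
  have P1: "P (ev (b, i)) = smul (P (ev (b, j)) (b, j)) (ev (b, i)) - smul (P (ev (b, j)) (b, i)) (ev (b, j))"
    if "i < n b" "j < n b" "i \<noteq> j" for i j
    using comm[OF that e[OF that(2)]] by (simp add: A.rot_gen_ev[OF that(3)]) (simp add: A.rot_gen_def)
  have coeff: "P (ev (b, i)) (b, i) = P (ev (b, j)) (b, j)" if "i < n b" "j < n b" for i j
    using P1[of i j] that by (cases "i = j") (auto simp: ev_def)
  have diag: "P (ev (b, i)) = smul (P (ev (b, i)) (b, i)) (ev (b, i))" if i: "i < n b" for i
  proof -
    \<comment> \<open>Two further coordinates of the block. The relation for i and l shows that P
      maps \<open>ev (b, i)\<close> to a vector without j-component, and the relation for i and j
      carries this over to the off-diagonal entry of P at (i, j).\<close>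
    define j :: nat where "j = (if i = 0 then 1 else 0)"
    define l :: nat where "l = (if i = 2 then 1 else 2)"
    have jl: "j \<noteq> l" "j < n b" "l < n b" "j \<noteq> i" "l \<noteq> i"
      using A.dims[of b] by (auto simp: j_def l_def)
    have "P (ev (b, i)) (b, j) = 0"
      using P1[of i l] i jl by (simp add: ev_def)
    moreover have "P (ev (b, i)) (b, j) = - P (ev (b, j)) (b, i)"
      using P1[of i j] i jl by (simp add: ev_def)
    ultimately have "P (ev (b, j)) (b, i) = 0" by simp
    then show ?thesis
      unfolding coeff[OF i jl(2)] using P1[OF i jl(2) jl(4)[symmetric]] by simp
  qed
  have "P (ev (b, i)) = smul (P (ev (b, 0)) (b, 0)) (ev (b, i))" if "i < n b" for i
    using diag[OF that] coeff[of i 0] that A.dims[of b] by simp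
  then show ?thesis unfolding P_def by blast
qed

text \<open>Reflect the target in a block where T \<open>ev (b, 0)\<close> is nonzero. The
  reflection acts on the whole image of block b by one scalar c, and evaluation at \<gamma>0 gives c
  = -1. A vector changed in sign by the reflection vanishes outside the reflected block.\<close>

lemma block_image: "\<exists>k. \<forall>i<n b. \<forall>\<gamma>. fst \<gamma> \<noteq> k \<longrightarrow> T (ev (b, i)) \<gamma> = 0"
proof -
  have 0: "0 < n b" using A.dims[of b] by simp
  have e: "ev (b, i) \<in> bsp p n" if "i < n b" for i using that by (intro A.ev_V) simp
  have "T (ev (b, 0)) \<noteq> 0" by (rule T_nz[OF e[OF 0] A.ev_nz])
  then obtain \<gamma>0 where \<gamma>0: "T (ev (b, 0)) \<gamma>0 \<noteq> 0" by (auto simp: fun_eq_iff)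
  obtain c where c: "\<And>i. i < n b \<Longrightarrow> S (B.block_flip (fst \<gamma>0) (T (ev (b, i)))) = smul c (ev (b, i))"
    using conjugated_flip_scalar by blast
  have flip: "B.block_flip (fst \<gamma>0) (T (ev (b, i))) = smul c (T (ev (b, i)))" if "i < n b" for i
    using arg_cong[OF c[OF that], of T] TS[OF B.block_flip_V[OF T_V[OF e[OF that]]]]
    by (simp add: lin_on_smul[OF T_lin e[OF that]])
  have "- T (ev (b, 0)) \<gamma>0 = c * T (ev (b, 0)) \<gamma>0"
    using fun_cong[OF flip[OF 0], of \<gamma>0] by (simp add: B.block_flip_apply)
  then have "(- 1) * T (ev (b, 0)) \<gamma>0 = c * T (ev (b, 0)) \<gamma>0" by simp
  then have "c = - 1" using \<gamma>0 by (simp only: mult_cancel_right) simp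
  have "T (ev (b, i)) \<gamma> = 0" if "i < n b" "fst \<gamma> \<noteq> fst \<gamma>0" for i \<gamma>
    using fun_cong[OF flip[OF that(1)], of \<gamma>] that(2)
    by (simp add: B.block_flip_apply \<open>c = - 1\<close> eq_uminus_self_iff)
  then show ?thesis by blast
qed

definition \<sigma> :: "'b \<Rightarrow> 'c" where
  "\<sigma> b = (SOME k. \<forall>i<n b. \<forall>\<gamma>. fst \<gamma> \<noteq> k \<longrightarrow> T (ev (b, i)) \<gamma> = 0)"

lemma \<sigma>: "i < n b \<Longrightarrow> fst \<gamma> \<noteq> \<sigma> b \<Longrightarrow> T (ev (b, i)) \<gamma> = 0"
  using someI_ex[OF block_image[of b]] unfolding \<sigma>_def by blast

lemma T_block:
  assumes x: "x \<in> bsp p n" "\<And>\<gamma>. fst \<gamma> \<noteq> b \<Longrightarrow> x \<gamma> = 0" and \<delta>: "fst \<delta> \<noteq> \<sigma> b"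
  shows "T x \<delta> = 0"
proof -
  have e: "ev (b, i) \<in> bsp p n" if "i < n b" for i using that by (intro A.ev_V) simp
  let ?I = "SIGMA b:{b}. {..<n b}"
  have "x = trunc {b} x" using x(2) by (auto simp: trunc_def fun_eq_iff)
  also have "\<dots> = (\<Sum>\<beta>\<in>?I. smul (x \<beta>) (ev \<beta>))" by (rule trunc_finite_eq_sum[OF x(1)]) simp
  finally have "T x = T (\<Sum>\<beta>\<in>?I. smul (x \<beta>) (ev \<beta>))" by simp
  also have "\<dots> = (\<Sum>\<beta>\<in>?I. T (smul (x \<beta>) (ev \<beta>)))"
    by (intro lin_on_sum[OF A.subsp T_lin]) (auto intro!: A.V_scale e)
  finally have "T x \<delta> = (\<Sum>\<beta>\<in>?I. T (smul (x \<beta>) (ev \<beta>)) \<delta>)" by (simp only: sum_fun_apply)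
  also have "\<dots> = 0"
    by (intro sum.neutral) (auto simp: lin_on_smul[OF T_lin e] \<sigma> \<delta>)
  finally show ?thesis .
qed

abbreviation (input) "\<tau> \<equiv> block_isometry.\<sigma> m S"

text \<open>Otherwise S would send block \<sigma> b elsewhere, and S (T (ev (b, 0))), which is
  \<open>ev (b, 0)\<close>, would vanish at (b, 0).\<close>

lemma \<tau>\<sigma>: "\<tau> (\<sigma> b) = b"
proof (rule ccontr)
  interpret I: block_isometry p m N n M S T by (rule inverse)
  have e: "ev (b, 0) \<in> bsp p n" using A.dims[of b] by (intro A.ev_V) simp
  assume "\<tau> (\<sigma> b) \<noteq> b"
  then have "S (T (ev (b, 0))) (b, 0) = 0"
    by (intro I.T_block[of _ "\<sigma> b"] T_V e) (use \<sigma>[of 0 b] A.dims[of b] in auto)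
  then show False by (simp add: ST[OF e]) (simp add: ev_def)
qed

lemma \<sigma>\<tau>: "\<sigma> (\<tau> c) = c"
proof -
  interpret I: block_isometry p m N n M S T by (rule inverse)
  show ?thesis by (rule I.\<tau>\<sigma>)
qed

lemma bij_\<sigma>: "bij \<sigma>"
  by (rule o_bij[of \<tau>]) (auto simp: \<tau>\<sigma> \<sigma>\<tau>)

text \<open>T is injective, so the images of the unit vectors of block b are linearly independent in
  the span of the \<open>m (\<sigma> b)\<close> unit vectors of one target block. Equality follows
  from the same bound for the inverse isometry.\<close>

lemma dim_le: "n b \<le> m (\<sigma> b)"
proof -
  have e: "ev (b, i) \<in> bsp p n" if "i < n b" for i using that by (intro A.ev_V) simp
  define f where "f i = T (ev (b, i))" for i
  \<comment> \<open>Independence concerns the set of images, so its cardinality must be known to be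
    the full \<open>n b\<close>.\<close>
  have inj: "inj_on f {..<n b}"
  proof (rule inj_onI)
    fix i j assume ij: "i \<in> {..<n b}" "j \<in> {..<n b}" "f i = f j"
    then have "S (f i) = S (f j)" by simp
    then have "ev (b, i) = (ev (b, j) :: _ \<Rightarrow> 'k)"
      using ij(1,2) unfolding f_def by (simp add: ST e)
    then show "i = j" by (auto simp: ev_def fun_eq_iff split: if_splits)
  qed
  have "fs.independent (f ` {..<n b})"
  proof (rule fs.independent_if_scalars_zero)
    fix g x assume g: "(\<Sum>x\<in>f ` {..<n b}. smul (g x) x) = 0" and "x \<in> f ` {..<n b}"
    then obtain i where i: "i < n b" "x = f i" by auto
    have "0 = (\<Sum>i<n b. smul (g (f i)) (f i))" using g inj by (simp add: sum.reindex)
    also have "\<dots> = (\<Sum>i<n b. T (smul (g (f i)) (ev (b, i))))"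
      by (intro sum.cong) (auto simp: f_def lin_on_smul[OF T_lin e])
    also have "\<dots> = T (\<Sum>i<n b. smul (g (f i)) (ev (b, i)))"
      by (intro lin_on_sum[OF A.subsp T_lin, symmetric]) (auto intro!: A.V_scale e)
    finally have "T (\<Sum>i<n b. smul (g (f i)) (ev (b, i))) = 0" by simp
    moreover have "(\<Sum>i<n b. smul (g (f i)) (ev (b, i))) \<in> bsp p n"
      by (intro A.V_sum A.V_scale e) simp
    ultimately have "(\<Sum>i<n b. smul (g (f i)) (ev (b, i))) = (0 :: _ \<Rightarrow> 'k)"
      using T_nz by blast
    then have "(\<Sum>l<n b. smul (g (f l)) (ev (b, l))) (b, i) = 0" by simp
    moreover have "(\<Sum>l<n b. smul (g (f l)) (ev (b, l))) (b, i) = (\<Sum>l<n b. if l = i then g (f l) else 0)"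
      unfolding sum_fun_apply by (rule sum.cong) (auto simp: ev_def)
    ultimately show "g x = 0" using i by simp
  qed simp
  moreover have "f ` {..<n b} \<subseteq> fs.span ((\<lambda>j. ev (\<sigma> b, j)) ` {..<m (\<sigma> b)})"
  proof clarify
    fix i assume i: "i < n b"
    have "f i = trunc {\<sigma> b} (f i)"
      using \<sigma>[OF i] by (auto simp: trunc_def f_def fun_eq_iff)
    also have "\<dots> = (\<Sum>\<beta>\<in>(SIGMA b:{\<sigma> b}. {..<m b}). smul (f i \<beta>) (ev \<beta>))"
      using trunc_finite_eq_sum[OF T_V[OF e[OF i]], of "{\<sigma> b}"] by (simp add: f_def)
    also have "\<dots> \<in> fs.span ((\<lambda>j. ev (\<sigma> b, j)) ` {..<m (\<sigma> b)})"
      by (intro fs.span_sum fs.span_scale fs.span_base) auto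
    finally show "f i \<in> fs.span ((\<lambda>j. ev (\<sigma> b, j)) ` {..<m (\<sigma> b)})" .
  qed
  ultimately have "card (f ` {..<n b}) \<le> card ((\<lambda>j. ev (\<sigma> b, j) :: _ \<Rightarrow> 'k) ` {..<m (\<sigma> b)})"
    using fs.independent_span_bound by blast
  also have "\<dots> \<le> card {..<m (\<sigma> b)}" by (rule card_image_le) simp
  finally show ?thesis using card_image[OF inj] by simp
qed

lemma dim_eq: "m (\<sigma> b) = n b"
proof -
  interpret I: block_isometry p m N n M S T by (rule inverse)
  show ?thesis using dim_le[of b] I.dim_le[of "\<sigma> b"] \<tau>\<sigma>[of b] by simp
qed

lemma range_dims_eq: "range n = range m"
proof -
  have "range n = range (\<lambda>b. m (\<sigma> b))" by (simp add: dim_eq)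
  also have "\<dots> = m ` range \<sigma>" by (simp add: image_image)
  finally show ?thesis using bij_\<sigma> by (simp add: bij_is_surj)
qed

text \<open>The block map, known on unit vectors only, is extended to all vectors by density. The
  constant 2 is the triangle inequality for two isometric terms.\<close>

lemma T_block_flip:
  assumes x: "x \<in> bsp p n"
  shows "T (A.block_flip b x) = B.block_flip (\<sigma> b) (T x)"
proof -
  define D where "D x = T (A.block_flip b x) - B.block_flip (\<sigma> b) (T x)" for x
  have DV: "D x \<in> bsp p m" if "x \<in> bsp p n" for x
    unfolding D_def by (intro B.V_diff T_V A.block_flip_V B.block_flip_V that)
  have "D x = 0"
  proof (rule A.vanishing_on_ev[OF B.normed_subspace_axioms _ DV _ _ x, where C = 2])
    show "lin_on (bsp p n) D"
      unfolding D_def lin_on_def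
      by (auto simp: lin_on_add[OF T_lin] lin_on_smul[OF T_lin] A.block_flip_V A.V_scale fs.scale_right_diff_distrib)
    show "N (D x) \<le> 2 * M x" if "x \<in> bsp p n" for x
      using B.triangle_diff[OF T_V[OF A.block_flip_V[OF that]] B.block_flip_V[OF T_V[OF that]], of b "\<sigma> b"]
      by (simp add: D_def T_N A.block_flip_V that A.block_flip_M B.block_flip_M T_V)
    fix \<beta> assume \<beta>: "snd \<beta> < n (fst \<beta>)"
    note e = A.ev_V[OF \<beta>]
    have inj: "\<sigma> (fst \<beta>) = \<sigma> b \<longleftrightarrow> fst \<beta> = b" by (metis \<tau>\<sigma>)
    show "D (ev \<beta>) = 0"
    proof
      fix \<gamma>
      have "T (ev \<beta>) \<gamma> = 0" if "fst \<gamma> \<noteq> \<sigma> (fst \<beta>)"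
        using \<sigma>[OF \<beta>, of \<gamma>] that by simp
      then show "D (ev \<beta>) \<gamma> = 0 \<gamma>"
        using inj by (auto simp: D_def A.block_flip_ev B.block_flip_apply lin_on_minus[OF T_lin e])
    qed
  qed (assumption)
  then show ?thesis by (simp add: D_def)
qed

end

text \<open>On a block, M is a multiple of the Euclidean norm whose factor depends only on the
  dimension. T maps blocks to blocks of equal dimension and preserves M, so the factors cancel and
  the Euclidean block norms are permuted.\<close>

lemma block_isometry_preserves_bnorm:
  fixes M :: "('b \<times> nat \<Rightarrow> 'k::scalar_field) \<Rightarrow> real"
  assumes "block_isometry p n M n M T S" and x: "x \<in> bsp p n"
  shows "bnorm p n (T x) = bnorm p n x"
proof -
  interpret block_isometry p n M n M T S by fact
  have blk2: "blk n (y - A.block_flip c y) c = 2 * blk n y c" for y c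
  proof -
    have "blk n (y - A.block_flip c y) c = blk n (smul 2 y) c"
      by (rule blk_cong) (simp_all only: minus_apply A.block_flip_apply fst_conv if_True refl smul_apply mult_2 diff_minus_eq_add)
    then show ?thesis by (simp add: blk_smul)
  qed
  have "blk n (T x) (\<sigma> b) = blk n x b" for b
  proof -
    \<comment> \<open>Twice the component of x in block b. T commutes with the corresponding
      reflections, so T y is twice the component of T x in block \<sigma> b.\<close>
    define y where "y = x - A.block_flip b x"
    have y: "y \<in> bsp p n" unfolding y_def by (intro A.V_diff A.block_flip_V x)
    have Ty: "T y = T x - A.block_flip (\<sigma> b) (T x)"
      unfolding y_def lin_on_diff[OF A.subsp T_lin x A.block_flip_V[OF x]] T_block_flip[OF x] ..
    have pos: "M (ev (b, 0)) \<noteq> 0"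
    proof -
      have "(ev (b, 0) :: _ \<Rightarrow> 'k) \<in> bsp p n" by (rule A.ev_V) (use A.dims[of b] in simp)
      then show ?thesis by (simp add: A.eq_0_iff A.ev_nz)
    qed
    have "blk n (T y) (\<sigma> b) * M (ev (\<sigma> b, 0)) = M (T y)"
      by (rule A.M_on_block[symmetric, OF T_V[OF y]]) (simp only: Ty minus_apply A.block_flip_apply if_False diff_self)
    also have "\<dots> = blk n y b * M (ev (b, 0))"
      unfolding T_N[OF y] by (rule A.M_on_block[OF y]) (simp only: y_def minus_apply A.block_flip_apply if_False diff_self)
    finally have "blk n (T y) (\<sigma> b) = blk n y b"
      using pos A.M_ev_eq[of "\<sigma> b" b, OF dim_eq] by simp
    moreover have "blk n (T y) (\<sigma> b) = 2 * blk n (T x) (\<sigma> b)" by (simp only: Ty blk2)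
    moreover have "blk n y b = 2 * blk n x b" by (simp only: y_def blk2)
    ultimately show ?thesis by simp
  qed
  then show ?thesis
    using infsum_reindex_bij_betw[OF bij_\<sigma>, of "\<lambda>c. blk n (T x) c powr p"] by (simp add: bnorm_def bsum_def)
qed

section \<open>Rademacher functions\<close>

text \<open>A sign vector is coded by the set of its positive places, so the cube of dimension m is
  \<open>Pow {..<m}\<close>.\<close>

definition rad :: "nat \<Rightarrow> nat set \<Rightarrow> real" where
  "rad i S = (if i \<in> S then 1 else - 1)"

text \<open>For different i and j, toggling membership of i is an involution of the cube that
  changes the sign of the product.\<close>

lemma sum_rad_orthogonal:
  assumes "i < m" "j < m"
  shows "(\<Sum>S\<in>Pow {..<m}. rad i S * rad j S) = (if i = j then 2 ^ m else 0)"
proof (cases "i = j")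
  case True
  then have "(\<Sum>S\<in>Pow {..<m}. rad i S * rad j S) = (\<Sum>S\<in>Pow {..<m}. 1)"
    by (intro sum.cong) (auto simp: rad_def)
  then show ?thesis using True by (simp add: card_Pow)
next
  case False
  define h where "h S = (if i \<in> S then S - {i} else insert i S)" for S
  have "(\<Sum>S\<in>Pow {..<m}. rad i S * rad j S) = (\<Sum>S\<in>Pow {..<m}. - (rad i S * rad j S))"
    by (rule sum.reindex_bij_witness[of _ h h]) (use assms False in \<open>auto simp: h_def rad_def\<close>)
  then show ?thesis using False by (simp add: sum_negf)
qed

text \<open>Expanding the product over subsets is independence of the signs: the moment generating
  function factorises.\<close>

lemma sum_exp_rad:
  "(\<Sum>S\<in>Pow {..<m}. exp (\<Sum>i<m. rad i S * b i)) = (\<Prod>i<m. exp (b i) + exp (- b i))"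
proof -
  have "exp (\<Sum>i<m. rad i S * b i) = (\<Prod>i\<in>S. exp (b i)) * (\<Prod>i\<in>{..<m} - S. exp (- b i))"
    if "S \<in> Pow {..<m}" for S
  proof -
    have "exp (\<Sum>i<m. rad i S * b i) = (\<Prod>i<m. exp (rad i S * b i))" by (simp add: exp_sum)
    also have "\<dots> = (\<Prod>i\<in>{..<m} - S. exp (rad i S * b i)) * (\<Prod>i\<in>S. exp (rad i S * b i))"
      using that by (intro prod.subset_diff) auto
    also have "\<dots> = (\<Prod>i\<in>{..<m} - S. exp (- b i)) * (\<Prod>i\<in>S. exp (b i))"
      by (intro arg_cong2[of _ _ _ _ "(*)"] prod.cong) (auto simp: rad_def)
    finally show ?thesis by (simp add: mult.commute)
  qed
  then show ?thesis by (simp add: prod_add)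
qed

text \<open>A cruder form of the bound for cosh, enough for Khintchine. For 0 \<le> y \<le> 1 the
  bound on exp (-y) comes from (1 + y)(1 - y + y^2) = 1 + y^3.\<close>

lemma exp_add_exp_minus_le:
  fixes x :: real
  assumes "\<bar>x\<bar> \<le> 1"
  shows "exp x + exp (- x) \<le> 2 * exp (x\<^sup>2)"
proof -
  have *: "exp y + exp (- y) \<le> 2 + 2 * y\<^sup>2" if "0 \<le> y" "y \<le> 1" for y :: real
  proof -
    have "exp y \<le> 1 + y + y\<^sup>2" using exp_bound that by blast
    moreover have "exp (- y) \<le> 1 - y + y\<^sup>2"
    proof -
      have "1 \<le> (1 + y) * (1 - y + y\<^sup>2)"
        using that by (simp add: algebra_simps power2_eq_square)
      also have "\<dots> \<le> exp y * (1 - y + y\<^sup>2)"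
        using that exp_ge_add_one_self[of y] by (intro mult_right_mono) auto
      finally show ?thesis by (simp add: exp_minus field_simps)
    qed
    ultimately show ?thesis by simp
  qed
  have "exp x + exp (- x) \<le> 2 + 2 * x\<^sup>2"
    using *[of x] *[of "- x"] assms by (cases "0 \<le> x") auto
  also have "\<dots> \<le> 2 * exp (x\<^sup>2)" using exp_ge_add_one_self[of "x\<^sup>2"] by linarith
  finally show ?thesis .
qed

lemma powr_le_exp:
  fixes s q :: real
  assumes "0 \<le> s" "0 < q"
  shows "s powr q \<le> q powr q * exp s"
proof -
  have "s / q \<le> exp (s / q)" using exp_ge_add_one_self[of "s / q"] by linarith
  then have "s \<le> q * exp (s / q)" using assms by (simp add: field_simps)
  then have "s powr q \<le> (q * exp (s / q)) powr q" using assms by (intro powr_mono2) auto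
  also have "\<dots> = q powr q * exp s" using assms by (simp add: powr_mult exp_powr_real)
  finally show ?thesis .
qed

text \<open>A power is dominated by an exponential: |s| powr q \<le> q powr q (exp s + exp (-s)).
  Each exponential has cube sum at most 2 ^ m exp 1, because the coefficients are normalised; this
  explains the constant.\<close>

lemma khintchine_real:
  fixes b :: "nat \<Rightarrow> real"
  assumes q: "0 < q" and b: "(\<Sum>i<m. (b i)\<^sup>2) \<le> 1"
  shows "(\<Sum>S\<in>Pow {..<m}. \<bar>\<Sum>i<m. rad i S * b i\<bar> powr q) \<le> 2 * exp 1 * q powr q * 2 ^ m"
proof -
  have b1: "\<bar>b i\<bar> \<le> 1" if "i < m" for i
  proof -
    have "(b i)\<^sup>2 \<le> (\<Sum>i<m. (b i)\<^sup>2)" using that by (intro member_le_sum) auto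
    then show ?thesis using b by (simp flip: abs_square_le_1)
  qed
  have mgf: "(\<Sum>S\<in>Pow {..<m}. exp (\<Sum>i<m. rad i S * c i)) \<le> 2 ^ m * exp 1"
    if c: "\<And>i. i < m \<Longrightarrow> \<bar>c i\<bar> = \<bar>b i\<bar>" for c
  proof -
    have c2: "(c i)\<^sup>2 = (b i)\<^sup>2" if "i < m" for i using c[OF that] by (metis power2_abs)
    have "(\<Prod>i<m. exp (c i) + exp (- c i)) \<le> (\<Prod>i<m. 2 * exp ((b i)\<^sup>2))"
    proof (intro prod_mono conjI)
      fix i assume "i \<in> {..<m}"
      then show "exp (c i) + exp (- c i) \<le> 2 * exp ((b i)\<^sup>2)"
        using exp_add_exp_minus_le[of "c i"] b1[of i] c[of i] c2[of i] by simp
    qed (simp add: add_nonneg_nonneg)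
    also have "\<dots> = 2 ^ m * exp (\<Sum>i<m. (b i)\<^sup>2)" by (simp add: prod.distrib exp_sum)
    also have "\<dots> \<le> 2 ^ m * exp 1" using b by simp
    finally show ?thesis by (simp add: sum_exp_rad)
  qed
  have "\<bar>\<Sum>i<m. rad i S * b i\<bar> powr q \<le> q powr q * (exp (\<Sum>i<m. rad i S * b i) + exp (\<Sum>i<m. rad i S * - b i))" for S
  proof -
    let ?s = "\<Sum>i<m. rad i S * b i"
    have "\<bar>?s\<bar> powr q \<le> q powr q * exp \<bar>?s\<bar>" using powr_le_exp q by simp
    also have "\<dots> \<le> q powr q * (exp ?s + exp (- ?s))"
      by (intro mult_left_mono) (auto simp: abs_if)
    finally show ?thesis by (simp add: sum_negf)
  qed
  then have "(\<Sum>S\<in>Pow {..<m}. \<bar>\<Sum>i<m. rad i S * b i\<bar> powr q) \<le>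
      (\<Sum>S\<in>Pow {..<m}. q powr q * (exp (\<Sum>i<m. rad i S * b i) + exp (\<Sum>i<m. rad i S * - b i)))"
    by (rule sum_mono)
  also have "\<dots> = q powr q * ((\<Sum>S\<in>Pow {..<m}. exp (\<Sum>i<m. rad i S * b i)) + (\<Sum>S\<in>Pow {..<m}. exp (\<Sum>i<m. rad i S * - b i)))"
    by (subst sum_distrib_left[symmetric]) (simp only: sum.distrib)
  also have "\<dots> \<le> q powr q * (2 ^ m * exp 1 + 2 ^ m * exp 1)"
    using mgf[of b] mgf[of "\<lambda>i. - b i"] by (intro mult_left_mono add_mono) auto
  finally show ?thesis by (simp add: mult_ac)
qed

lemma powr_sum_le:
  fixes x :: "'a \<Rightarrow> real"
  assumes "finite I" "0 < q" "\<And>i. i \<in> I \<Longrightarrow> 0 \<le> x i"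
  shows "(\<Sum>i\<in>I. x i) powr q \<le> real (card I) powr q * (\<Sum>i\<in>I. x i powr q)"
proof (cases "I = {}")
  case False
  have "Max (x ` I) \<in> x ` I" using assms(1) False by (intro Max_in) auto
  then obtain j where j: "j \<in> I" "Max (x ` I) = x j" by auto
  have jm: "x i \<le> x j" if "i \<in> I" for i using assms(1) that by (simp flip: j(2))
  have "(\<Sum>i\<in>I. x i) \<le> real (card I) * x j" using jm by (rule sum_bounded_above)
  then have "(\<Sum>i\<in>I. x i) powr q \<le> (real (card I) * x j) powr q"
    using assms by (intro powr_mono2 sum_nonneg) auto
  also have "\<dots> = real (card I) powr q * x j powr q" using assms(3) j by (simp add: powr_mult)
  also have "\<dots> \<le> real (card I) powr q * (\<Sum>i\<in>I. x i powr q)"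
    using assms(1) j by (intro mult_left_mono member_le_sum) auto
  finally show ?thesis .
qed simp

text \<open>Reduction to the real case by coordinates of the scalar field and division by the
  Euclidean norm \<alpha>. What matters is that K depends on q and the field but not on m.\<close>

lemma khintchine:
  assumes q: "0 < q"
  shows "\<exists>K>0. \<forall>m. \<forall>a :: nat \<Rightarrow> 'k::euclidean_space.
    (\<Sum>S\<in>Pow {..<m}. norm (\<Sum>i<m. rad i S *\<^sub>R a i) powr q) \<le> K * 2 ^ m * L2_set (\<lambda>i. norm (a i)) {..<m} powr q"
proof (intro exI conjI allI)
  let ?d = "real DIM('k)"
  let ?K = "?d powr q * (?d * (2 * exp 1 * q powr q))"
  show "?K > 0" using q by simp
  fix m and a :: "nat \<Rightarrow> 'k"
  define \<alpha> where "\<alpha> = L2_set (\<lambda>i. norm (a i)) {..<m}"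
  have \<alpha>2: "\<alpha>\<^sup>2 = (\<Sum>i<m. (norm (a i))\<^sup>2)" by (simp add: \<alpha>_def L2_set_def sum_nonneg)
  show "(\<Sum>S\<in>Pow {..<m}. norm (\<Sum>i<m. rad i S *\<^sub>R a i) powr q) \<le> ?K * 2 ^ m * \<alpha> powr q"
  proof (cases "\<alpha> = 0")
    case True
    then have "a i = 0" if "i < m" for i using that by (simp add: \<alpha>_def L2_set_eq_0_iff)
    then have "(\<Sum>i<m. rad i S *\<^sub>R a i) = 0" for S by simp
    then show ?thesis using True by simp
  next
    case False
    let ?s = "\<lambda>S u. \<Sum>i<m. rad i S * (inner (a i) u / \<alpha>)"
    from False have \<alpha>: "\<alpha> > 0" by (simp add: \<alpha>_def less_le L2_set_nonneg)
    have "norm (\<Sum>i<m. rad i S *\<^sub>R a i) powr q \<le> ?d powr q * (\<Sum>u\<in>Basis. \<alpha> powr q * \<bar>?s S u\<bar> powr q)" for S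
    proof -
      let ?z = "\<Sum>i<m. rad i S *\<^sub>R a i"
      have "norm ?z powr q \<le> (\<Sum>u\<in>Basis. \<bar>inner ?z u\<bar>) powr q"
        using q norm_le_l1 by (intro powr_mono2) auto
      also have "\<dots> \<le> ?d powr q * (\<Sum>u\<in>Basis. \<bar>inner ?z u\<bar> powr q)"
        using q by (intro powr_sum_le) auto
      also have "(\<Sum>u\<in>Basis. \<bar>inner ?z u\<bar> powr q) = (\<Sum>u\<in>Basis. \<alpha> powr q * \<bar>?s S u\<bar> powr q)"
      proof (rule sum.cong[OF refl])
        fix u :: 'k
        have "inner ?z u = \<alpha> * ?s S u"
          using \<alpha> by (simp add: inner_sum_left sum_distrib_left)
        then show "\<bar>inner ?z u\<bar> powr q = \<alpha> powr q * \<bar>?s S u\<bar> powr q"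
          using \<alpha> by (simp add: abs_mult powr_mult)
      qed
      finally show ?thesis .
    qed
    then have "(\<Sum>S\<in>Pow {..<m}. norm (\<Sum>i<m. rad i S *\<^sub>R a i) powr q) \<le>
        (\<Sum>S\<in>Pow {..<m}. ?d powr q * (\<Sum>u\<in>Basis. \<alpha> powr q * \<bar>?s S u\<bar> powr q))"
      by (rule sum_mono)
    also have "\<dots> = ?d powr q * (\<Sum>u\<in>Basis. \<alpha> powr q * (\<Sum>S\<in>Pow {..<m}. \<bar>?s S u\<bar> powr q))"
      unfolding sum_distrib_left[symmetric] by (subst sum.swap) (simp only: sum_distrib_left)
    also have "\<dots> \<le> ?d powr q * (\<Sum>u\<in>(Basis :: 'k set). \<alpha> powr q * (2 * exp 1 * q powr q * 2 ^ m))"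
    proof (intro mult_left_mono sum_mono khintchine_real q)
      fix u :: 'k assume u: "u \<in> Basis"
      have "(inner (a i) u)\<^sup>2 \<le> (norm (a i))\<^sup>2" for i
        using Basis_le_norm[OF u, of "a i"] by (simp flip: abs_le_square_iff)
      then have "(\<Sum>i<m. (inner (a i) u)\<^sup>2) \<le> \<alpha>\<^sup>2" unfolding \<alpha>2 by (intro sum_mono)
      then show "(\<Sum>i<m. (inner (a i) u / \<alpha>)\<^sup>2) \<le> 1"
        using \<alpha> by (simp add: power_divide flip: sum_divide_distrib)
    qed auto
    finally show ?thesis by (simp add: mult_ac)
  qed
qed

section \<open>Uniformly complemented Euclidean subspaces over the cubes\<close>

lemma hoelder_sum:
  fixes a b :: "'a \<Rightarrow> real"
  assumes pq: "1 < p" "1 < q" "1/p + 1/q = 1" and I: "finite I"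
    and a: "\<And>i. i \<in> I \<Longrightarrow> 0 \<le> a i" and b: "\<And>i. i \<in> I \<Longrightarrow> 0 \<le> b i"
  shows "(\<Sum>i\<in>I. a i * b i) \<le> (\<Sum>i\<in>I. a i powr p) powr (1/p) * (\<Sum>i\<in>I. b i powr q) powr (1/q)"
proof -
  define A where "A = (\<Sum>i\<in>I. a i powr p) powr (1/p)"
  define B where "B = (\<Sum>i\<in>I. b i powr q) powr (1/q)"
  have Ap: "A powr p = (\<Sum>i\<in>I. a i powr p)" and Bq: "B powr q = (\<Sum>i\<in>I. b i powr q)"
    using pq by (auto simp: A_def B_def powr_powr sum_nonneg)
  show ?thesis
  proof (cases "A = 0 \<or> B = 0")
    case True
    have "a i * b i = 0" if "i \<in> I" for i
    proof (cases "A = 0")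
      case True
      then have "a i powr p = 0" using Ap pq I that by (simp add: sum_nonneg_eq_0_iff)
      then show ?thesis by simp
    next
      case False
      then have "b i powr q = 0" using True Bq pq I that by (simp add: sum_nonneg_eq_0_iff)
      then show ?thesis by simp
    qed
    then have "(\<Sum>i\<in>I. a i * b i) = 0" by (rule sum.neutral[OF ballI])
    then show ?thesis by simp
  next
    case False
    then have AB: "A > 0" "B > 0" by (auto simp: A_def B_def less_le)
    have "(\<Sum>i\<in>I. a i * b i) = A * B * (\<Sum>i\<in>I. (a i / A) * (b i / B))"
      using AB by (simp add: sum_distrib_left)
    also have "\<dots> \<le> A * B * (\<Sum>i\<in>I. (a i / A) powr p / p + (b i / B) powr q / q)"
      using AB a b pq by (intro mult_left_mono sum_mono Youngs_inequality) auto
    also have "(\<Sum>i\<in>I. (a i / A) powr p / p + (b i / B) powr q / q) = (\<Sum>i\<in>I. a i powr p) / A powr p / p + (\<Sum>i\<in>I. b i powr q) / B powr q / q"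
      using AB a b by (simp add: sum.distrib powr_divide sum_divide_distrib)
    also have "\<dots> = 1" using AB pq by (simp flip: Ap Bq)
    finally show ?thesis by (simp add: A_def B_def)
  qed
qed

text \<open>The Rademacher embedding; the power of 2 converts the uniform probability on the cube
  into counting measure.\<close>

definition cube_emb :: "real \<Rightarrow> nat \<Rightarrow> (nat \<Rightarrow> 'k::real_vector) \<Rightarrow> nat set \<Rightarrow> 'k" where
  "cube_emb p m a S = (2 ^ m) powr (- 1 / p) *\<^sub>R (\<Sum>i<m. rad i S *\<^sub>R a i)"

text \<open>The adjoint of the Rademacher embedding for the conjugate exponent, which is a left
  inverse of \<open>cube_emb\<close> by orthogonality.\<close>

definition cube_proj :: "real \<Rightarrow> nat \<Rightarrow> (nat set \<Rightarrow> 'k::real_vector) \<Rightarrow> nat \<Rightarrow> 'k" where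
  "cube_proj p m f i = (2 ^ m) powr (1 / p - 1) *\<^sub>R (\<Sum>S\<in>Pow {..<m}. rad i S *\<^sub>R f S)"

lemma cube_proj_emb:
  assumes "i < m"
  shows "cube_proj p m (cube_emb p m a) i = a i"
proof -
  have "(\<Sum>S\<in>Pow {..<m}. rad i S *\<^sub>R (\<Sum>j<m. rad j S *\<^sub>R a j)) = (\<Sum>j<m. (\<Sum>S\<in>Pow {..<m}. rad i S * rad j S) *\<^sub>R a j)"
    by (simp add: scaleR_sum_right scaleR_sum_left) (rule sum.swap)
  also have "\<dots> = (\<Sum>j<m. if j = i then 2 ^ m *\<^sub>R a i else 0)"
    using assms by (intro sum.cong) (auto simp: sum_rad_orthogonal)
  also have "\<dots> = 2 ^ m *\<^sub>R a i" using assms by simp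
  finally have *: "(\<Sum>S\<in>Pow {..<m}. rad i S *\<^sub>R (\<Sum>j<m. rad j S *\<^sub>R a j)) = 2 ^ m *\<^sub>R a i" .
  have "cube_proj p m (cube_emb p m a) i =
      ((2 ^ m) powr (1 / p - 1) * (2 ^ m) powr (- 1 / p)) *\<^sub>R (\<Sum>S\<in>Pow {..<m}. rad i S *\<^sub>R (\<Sum>j<m. rad j S *\<^sub>R a j))"
    unfolding cube_proj_def cube_emb_def scaleR_sum_right scaleR_scaleR by (simp add: mult_ac)
  also have "(2 ^ m) powr (1 / p - 1) * (2 ^ m) powr (- 1 / p) = (2 ^ m :: real) powr (- 1)"
    by (simp flip: powr_add)
  finally show ?thesis unfolding * by (simp add: powr_minus)
qed

lemma cube_emb_bound:
  assumes "0 < p"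
  shows "\<exists>K>0. \<forall>m. \<forall>a :: nat \<Rightarrow> 'k::euclidean_space.
    (\<Sum>S\<in>Pow {..<m}. norm (cube_emb p m a S) powr p) \<le> K * L2_set (\<lambda>i. norm (a i)) {..<m} powr p"
proof -
  obtain K where K: "K > 0" "\<And>m (a :: nat \<Rightarrow> 'k). (\<Sum>S\<in>Pow {..<m}. norm (\<Sum>i<m. rad i S *\<^sub>R a i) powr p)
      \<le> K * 2 ^ m * L2_set (\<lambda>i. norm (a i)) {..<m} powr p"
    using khintchine[OF assms, where 'k = 'k] by blast
  have "(\<Sum>S\<in>Pow {..<m}. norm (cube_emb p m a S) powr p) \<le> K * L2_set (\<lambda>i. norm (a i)) {..<m} powr p" for m and a :: "nat \<Rightarrow> 'k"
  proof -
    have "norm (cube_emb p m a S) powr p = (1 / 2 ^ m) * norm (\<Sum>i<m. rad i S *\<^sub>R a i) powr p" for S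
      using assms by (simp add: cube_emb_def powr_mult powr_powr powr_minus_divide powr_divide)
    then have "(\<Sum>S\<in>Pow {..<m}. norm (cube_emb p m a S) powr p) = (1 / 2 ^ m) * (\<Sum>S\<in>Pow {..<m}. norm (\<Sum>i<m. rad i S *\<^sub>R a i) powr p)"
      by (simp only: sum_distrib_left)
    also have "\<dots> \<le> (1 / 2 ^ m) * (K * 2 ^ m * L2_set (\<lambda>i. norm (a i)) {..<m} powr p)"
      by (intro mult_left_mono K(2)) auto
    finally show ?thesis by simp
  qed
  then show ?thesis using K(1) by blast
qed

text \<open>Duality: the squared Euclidean norm of c = \<open>cube_proj p m f\<close> is c0 times
  the pairing of f with the Rademacher sum z of c. Hoelder and Khintchine at exponent q bound it by
  a constant times F L, the powers of 2 cancel, and one factor L is divided out.\<close>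

lemma cube_proj_bound:
  assumes p: "1 < p"
  shows "\<exists>K>0. \<forall>m. \<forall>f :: nat set \<Rightarrow> 'k::euclidean_space.
    L2_set (\<lambda>i. norm (cube_proj p m f i)) {..<m} powr p \<le> K * (\<Sum>S\<in>Pow {..<m}. norm (f S) powr p)"
proof -
  define q where "q = p / (p - 1)"
  have q: "1 < q" "1/p + 1/q = 1" using p by (auto simp: q_def field_simps)
  obtain K where K: "K > 0" "\<And>m (a :: nat \<Rightarrow> 'k). (\<Sum>S\<in>Pow {..<m}. norm (\<Sum>i<m. rad i S *\<^sub>R a i) powr q)
      \<le> K * 2 ^ m * L2_set (\<lambda>i. norm (a i)) {..<m} powr q"
    using khintchine[of q, where 'k = 'k] q by force
  have "L2_set (\<lambda>i. norm (cube_proj p m f i)) {..<m} powr p \<le> (K powr (1/q)) powr p * (\<Sum>S\<in>Pow {..<m}. norm (f S) powr p)" for m and f :: "nat set \<Rightarrow> 'k"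
  proof -
    define c where "c = cube_proj p m f"
    define L where "L = L2_set (\<lambda>i. norm (c i)) {..<m}"
    define F where "F = (\<Sum>S\<in>Pow {..<m}. norm (f S) powr p) powr (1/p)"
    define z where "z S = (\<Sum>i<m. rad i S *\<^sub>R c i)" for S
    define c0 where "c0 = (2 ^ m :: real) powr (1 / p - 1)"
    have L0: "L \<ge> 0" by (simp add: L_def L2_set_nonneg)
    have "L\<^sup>2 = (\<Sum>i<m. inner (c i) (c i))"
      by (simp add: L_def L2_set_def sum_nonneg power2_norm_eq_inner)
    also have "\<dots> = (\<Sum>i<m. \<Sum>S\<in>Pow {..<m}. c0 * inner (f S) (rad i S *\<^sub>R c i))"
    proof (rule sum.cong[OF refl])
      fix i
      have "inner (c i) (c i) = inner (c0 *\<^sub>R (\<Sum>S\<in>Pow {..<m}. rad i S *\<^sub>R f S)) (c i)"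
        by (simp add: c_def cube_proj_def c0_def)
      then show "inner (c i) (c i) = (\<Sum>S\<in>Pow {..<m}. c0 * inner (f S) (rad i S *\<^sub>R c i))"
        by (simp add: inner_sum_left sum_distrib_left)
    qed
    also have "\<dots> = c0 * (\<Sum>S\<in>Pow {..<m}. inner (f S) (z S))"
      by (subst sum.swap) (simp add: z_def inner_sum_right sum_distrib_left)
    also have "\<dots> \<le> c0 * (\<Sum>S\<in>Pow {..<m}. norm (f S) * norm (z S))"
      by (intro mult_left_mono sum_mono norm_cauchy_schwarz) (simp add: c0_def)
    also have "\<dots> \<le> c0 * (F * (\<Sum>S\<in>Pow {..<m}. norm (z S) powr q) powr (1/q))"
      unfolding F_def using p q by (intro mult_left_mono hoelder_sum) (auto simp: c0_def)
    also have "\<dots> \<le> c0 * (F * (K * 2 ^ m * L powr q) powr (1/q))"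
      unfolding z_def L_def using q
      by (intro mult_left_mono powr_mono2 K(2) sum_nonneg) (auto simp: c0_def F_def)
    also have "(K * 2 ^ m * L powr q) powr (1/q) = K powr (1/q) * (2 ^ m) powr (1/q) * L"
      using K(1) L0 q by (simp add: powr_mult powr_powr)
    also have "c0 * (F * (K powr (1/q) * (2 ^ m) powr (1/q) * L)) = (c0 * (2 ^ m) powr (1/q)) * (K powr (1/q) * F * L)"
      by (simp add: mult_ac)
    also have "c0 * (2 ^ m) powr (1/q) = 1"
    proof -
      have "1/p - 1 + 1/q = 0" using q(2) by linarith
      then show ?thesis by (simp add: c0_def flip: powr_add)
    qed
    finally have "L * L \<le> (K powr (1/q) * F) * L" by (simp add: power2_eq_square)
    then have "L \<le> K powr (1/q) * F"
      using L0 by (cases "L = 0") (auto simp: F_def)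
    then have "L powr p \<le> (K powr (1/q) * F) powr p" using L0 p by (intro powr_mono2) auto
    also have "\<dots> = (K powr (1/q)) powr p * (\<Sum>S\<in>Pow {..<m}. norm (f S) powr p)"
      using p by (simp add: powr_mult F_def powr_powr sum_nonneg)
    finally show ?thesis by (simp add: L_def c_def)
  qed
  then show ?thesis using K(1) by (intro exI[of _ "(K powr (1/q)) powr p"]) auto
qed

section \<open>Splitting off Euclidean blocks\<close>

text \<open>Bounds on finite partial sums serve both \<open>infsum\<close> over blocks and
  \<open>suminf\<close> over natural numbers. Summability comes with the bound, and reindexing asks
  for injectivity only.\<close>

definition sum_bdd :: "('a \<Rightarrow> real) \<Rightarrow> real \<Rightarrow> bool" where
  "sum_bdd f c \<longleftrightarrow> (\<forall>i. 0 \<le> f i) \<and> (\<forall>F. finite F \<longrightarrow> sum f F \<le> c)"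

lemma sum_bdd_summable_on:
  assumes "sum_bdd f c"
  shows "f summable_on UNIV" "infsum f UNIV \<le> c"
proof -
  show s: "f summable_on UNIV"
    using assms by (intro nonneg_bdd_above_summable_on) (auto simp: sum_bdd_def bdd_above_def)
  show "infsum f UNIV \<le> c"
    using assms infsum_le_finite_sums[OF s] by (auto simp: sum_bdd_def)
qed

lemma sum_bdd_infsum:
  assumes "\<And>i. 0 \<le> f i" "f summable_on UNIV"
  shows "sum_bdd f (infsum f UNIV)"
  using assms by (auto simp: sum_bdd_def intro!: finite_sum_le_infsum)

lemma sum_bdd_mono: "sum_bdd g c \<Longrightarrow> (\<And>i. 0 \<le> f i) \<Longrightarrow> (\<And>i. f i \<le> g i) \<Longrightarrow> sum_bdd f c"
  unfolding sum_bdd_def by (meson order_trans sum_mono)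

lemma sum_bdd_add: "sum_bdd f c \<Longrightarrow> sum_bdd g d \<Longrightarrow> sum_bdd (\<lambda>i. f i + g i) (c + d)"
  unfolding sum_bdd_def by (auto simp: sum.distrib intro!: add_mono)

lemma sum_bdd_cmult: "sum_bdd f c \<Longrightarrow> 0 \<le> a \<Longrightarrow> sum_bdd (\<lambda>i. a * f i) (a * c)"
  unfolding sum_bdd_def by (auto simp flip: sum_distrib_left intro!: mult_left_mono)

lemma sum_bdd_inj:
  fixes \<phi> :: "'b \<Rightarrow> 'a"
  assumes f: "sum_bdd f c" and "inj \<phi>"
  shows "sum_bdd (\<lambda>i. f (\<phi> i)) c"
  unfolding sum_bdd_def
proof (intro conjI allI impI)
  fix F :: "'b set" assume "finite F"
  have "(\<Sum>i\<in>F. f (\<phi> i)) = sum f (\<phi> ` F)"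
    by (subst sum.reindex) (auto intro: inj_on_subset[OF \<open>inj \<phi>\<close>])
  then show "(\<Sum>i\<in>F. f (\<phi> i)) \<le> c" using f \<open>finite F\<close> by (simp add: sum_bdd_def)
qed (use f in \<open>simp add: sum_bdd_def\<close>)

lemma sum_bdd_extend:
  assumes "sum_bdd g c" "inj \<phi>" "\<And>a. G (\<phi> a) = g a" "\<And>b. b \<notin> range \<phi> \<Longrightarrow> G b = 0"
  shows "sum_bdd G c"
  unfolding sum_bdd_def
proof (intro conjI allI impI)
  show "0 \<le> G b" for b using assms by (cases "b \<in> range \<phi>") (auto simp: sum_bdd_def)
  fix F :: "'b set" assume F: "finite F"
  have "sum G F = sum G (\<phi> ` (\<phi> -` F))"
    by (rule sum.mono_neutral_right) (use F assms(4) in auto)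
  also have "\<dots> = sum g (\<phi> -` F)"
    by (subst sum.reindex) (auto intro: inj_on_subset[OF assms(2)] simp: assms(3))
  also have "\<dots> \<le> c"
    using assms(1) finite_vimageI[OF F assms(2)] by (simp add: sum_bdd_def)
  finally show "sum G F \<le> c" .
qed

lemma sum_bdd_case_sum:
  assumes "sum_bdd (\<lambda>a. f (Inl a)) c" "sum_bdd (\<lambda>b. f (Inr b)) d"
  shows "sum_bdd f (c + d)"
proof -
  have nn: "0 \<le> f i" for i using assms by (cases i) (auto simp: sum_bdd_def)
  have "sum_bdd (\<lambda>i. case i of Inl a \<Rightarrow> f (Inl a) | Inr b \<Rightarrow> 0) c"
    by (rule sum_bdd_extend[OF assms(1), of Inl]) (auto split: sum.splits)
  moreover have "sum_bdd (\<lambda>i. case i of Inl a \<Rightarrow> 0 | Inr b \<Rightarrow> f (Inr b)) d"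
    by (rule sum_bdd_extend[OF assms(2), of Inr]) (auto split: sum.splits)
  ultimately have "sum_bdd (\<lambda>i. (case i of Inl a \<Rightarrow> f (Inl a) | Inr b \<Rightarrow> 0) + (case i of Inl a \<Rightarrow> 0 | Inr b \<Rightarrow> f (Inr b))) (c + d)"
    by (rule sum_bdd_add)
  then show ?thesis by (rule sum_bdd_mono) (use nn in \<open>auto split: sum.splits\<close>)
qed

lemma sum_bdd_fibers:
  assumes "sum_bdd f c" "\<And>a. finite (B a)"
  shows "sum_bdd (\<lambda>a. \<Sum>b\<in>B a. f (a, b)) c"
  using assms unfolding sum_bdd_def by (auto simp: sum.Sigma intro!: sum_nonneg)

lemma sum_bdd_Sigma:
  assumes "sum_bdd (\<lambda>a. \<Sum>b\<in>B a. f (a, b)) c" "\<And>a. finite (B a)"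
    "\<And>x. 0 \<le> f x" "\<And>a b. b \<notin> B a \<Longrightarrow> f (a, b) = 0"
  shows "sum_bdd f c"
  unfolding sum_bdd_def
proof (intro conjI allI impI)
  fix F :: "('a \<times> 'b) set" assume F: "finite F"
  have "sum f F = sum f (F \<inter> Sigma (fst ` F) B)"
    by (rule sum.mono_neutral_right) (use F assms(4) in force)+
  also have "\<dots> \<le> sum f (Sigma (fst ` F) B)"
    using F assms by (intro sum_mono2) auto
  also have "\<dots> = (\<Sum>a\<in>fst ` F. \<Sum>b\<in>B a. f (a, b))" using F assms(2) by (simp add: sum.Sigma)
  also have "\<dots> \<le> c" using assms(1) F by (simp add: sum_bdd_def)
  finally show "sum f F \<le> c" .
qed (rule assms(3))

lemma bsp_sum_bdd: "x \<in> bsp p n \<Longrightarrow> sum_bdd (\<lambda>b. blk n x b powr p) (bsum p n x)"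
  unfolding bsum_def by (intro sum_bdd_infsum bsp_summable) auto

lemma sum_bdd_bsp:
  assumes "sum_bdd (\<lambda>b. blk n x b powr p) c" "\<And>b i. n b \<le> i \<Longrightarrow> x (b, i) = 0"
  shows "x \<in> bsp p n" "bsum p n x \<le> c"
  using sum_bdd_summable_on[OF assms(1)] assms(2) by (auto simp: bsp_def bsum_def)

lemma lp_sum_bdd: "x \<in> lp p \<Longrightarrow> sum_bdd (\<lambda>i. norm (x i) powr p) (\<Sum>i. norm (x i) powr p)"
  unfolding sum_bdd_def lp_def by (auto intro!: sum_le_suminf)

lemma sum_bdd_lp:
  assumes "sum_bdd (\<lambda>i. norm (x i) powr p) c"
  shows "x \<in> lp p" "(\<Sum>i. norm (x i) powr p) \<le> c"
proof -
  have s: "summable (\<lambda>i. norm (x i) powr p)"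
    using assms by (intro bounded_imp_summable[of _ c]) (auto simp: sum_bdd_def)
  then show "x \<in> lp p" by (simp add: lp_def)
  show "(\<Sum>i. norm (x i) powr p) \<le> c"
    using assms by (intro suminf_le_const[OF s]) (auto simp: sum_bdd_def)
qed

text \<open>In all uses f and g are p-th powers of norms, which keeps the estimates additive; C
  becomes its p-th root when norms are formed.\<close>

definition iso_bdd ::
    "('i \<Rightarrow> 'k::field) set \<Rightarrow> (('i \<Rightarrow> 'k) \<Rightarrow> real) \<Rightarrow> ('j \<Rightarrow> 'k) set \<Rightarrow> (('j \<Rightarrow> 'k) \<Rightarrow> real) \<Rightarrow> bool" where
  "iso_bdd V f W g \<longleftrightarrow> (\<exists>T S. \<exists>C>0. lin_on V T \<and> (\<forall>x\<in>V. T x \<in> W) \<and> (\<forall>y\<in>W. S y \<in> V) \<and>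
     (\<forall>x\<in>V. S (T x) = x) \<and> (\<forall>y\<in>W. T (S y) = y) \<and>
     (\<forall>x\<in>V. g (T x) \<le> C * f x) \<and> (\<forall>y\<in>W. f (S y) \<le> C * g y))"

lemma iso_bdd_trans:
  assumes "iso_bdd V f W g" "iso_bdd W g X h"
  shows "iso_bdd V f X h"
proof -
  obtain T S C where 1: "C > 0" "lin_on V T" "\<And>x. x \<in> V \<Longrightarrow> T x \<in> W" "\<And>y. y \<in> W \<Longrightarrow> S y \<in> V"
     "\<And>x. x \<in> V \<Longrightarrow> S (T x) = x" "\<And>y. y \<in> W \<Longrightarrow> T (S y) = y"
     "\<And>x. x \<in> V \<Longrightarrow> g (T x) \<le> C * f x" "\<And>y. y \<in> W \<Longrightarrow> f (S y) \<le> C * g y"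
    using assms(1) unfolding iso_bdd_def by blast
  obtain T' S' C' where 2: "C' > 0" "lin_on W T'" "\<And>x. x \<in> W \<Longrightarrow> T' x \<in> X" "\<And>y. y \<in> X \<Longrightarrow> S' y \<in> W"
     "\<And>x. x \<in> W \<Longrightarrow> S' (T' x) = x" "\<And>y. y \<in> X \<Longrightarrow> T' (S' y) = y"
     "\<And>x. x \<in> W \<Longrightarrow> h (T' x) \<le> C' * g x" "\<And>y. y \<in> X \<Longrightarrow> g (S' y) \<le> C' * h y"
    using assms(2) unfolding iso_bdd_def by blast
  show ?thesis
    unfolding iso_bdd_def
  proof (intro exI conjI ballI)
    show "0 < C' * C" using 1 2 by simp
    show "lin_on V (\<lambda>x. T' (T x))" using 1(2,3) 2(2) by (simp add: lin_on_def)
    fix x assume x: "x \<in> V"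
    show "h (T' (T x)) \<le> C' * C * f x"
      using order_trans[OF 2(7)[OF 1(3)[OF x]] mult_left_mono[OF 1(7)[OF x], of C']] 2(1) by (simp add: mult.assoc)
  next
    fix y assume y: "y \<in> X"
    show "f (S (S' y)) \<le> C' * C * h y"
      using order_trans[OF 1(8)[OF 2(4)[OF y]] mult_left_mono[OF 2(8)[OF y], of C]] 1(1) by (simp add: mult_ac)
  qed (use 1 2 in simp_all)
qed

section \<open>Three isomorphisms between block sums\<close>

abbreviation lp_sum :: "real \<Rightarrow> (nat \<Rightarrow> 'k::real_normed_field) \<Rightarrow> real" where
  "lp_sum p x \<equiv> \<Sum>i. norm (x i) powr p"

lemma blk_1: "blk (\<lambda>l. if l \<in> L then 1 else 0) z l = (if l \<in> L then norm (z (l, 0)) else 0)"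
  by (simp add: blk_def L2_set_def)

text \<open>Dimension 1 on L and 0 elsewhere presents the p-summable functions on L as a block sum
  over the whole type, so the cube points form a summand without a subtype.\<close>

lemma iso_bdd_relabel:
  fixes L :: "'l set"
  assumes \<tau>: "bij_betw \<tau> (UNIV :: nat set) L"
  shows "iso_bdd (lp p :: (nat \<Rightarrow> 'k::real_normed_field) set) (lp_sum p)
    (bsp p (\<lambda>l. if l \<in> L then 1 else 0)) (bsum p (\<lambda>l. if l \<in> L then 1 else 0))"
proof -
  let ?n = "\<lambda>l. if l \<in> L then 1 else 0 :: nat"
  define T :: "(nat \<Rightarrow> 'k) \<Rightarrow> ('l \<times> nat \<Rightarrow> 'k)" where "T x = (\<lambda>(l, i). if l \<in> L \<and> i = 0 then x (inv_into UNIV \<tau> l) else 0)" for x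
  define S :: "('l \<times> nat \<Rightarrow> 'k) \<Rightarrow> (nat \<Rightarrow> 'k)" where "S z = (\<lambda>k. z (\<tau> k, 0))" for z
  have \<tau>L: "\<tau> k \<in> L" for k using \<tau> by (auto simp: bij_betw_def)
  have inj: "inj \<tau>" and L: "range \<tau> = L" using \<tau> by (auto simp: bij_betw_def)
  have Tb: "sum_bdd (\<lambda>l. blk ?n (T x) l powr p) (lp_sum p x)" if "x \<in> lp p" for x
    by (rule sum_bdd_extend[OF lp_sum_bdd[OF that] inj]) (auto simp: blk_1 T_def \<tau>L inj L)
  have "T x (l, i) = 0" if "?n l \<le> i" for x l i using that by (auto simp: T_def)
  note T = sum_bdd_bsp[OF Tb this]
  have Sb: "sum_bdd (\<lambda>k. norm (S y k) powr p) (bsum p ?n y)" if "y \<in> bsp p ?n" for y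
    using sum_bdd_inj[OF bsp_sum_bdd[OF that] inj] by (simp add: blk_1 \<tau>L S_def)
  note S = sum_bdd_lp[OF Sb]
  have "T (S y) = y" if "y \<in> bsp p ?n" for y
  proof
    fix \<gamma>
    show "T (S y) \<gamma> = y \<gamma>"
      using bsp_outside[OF that, of "fst \<gamma>" "snd \<gamma>"] \<tau>
      by (cases \<gamma>) (auto simp: T_def S_def bij_betw_inv_into_right split: if_splits)
  qed
  moreover have "S (T x) = x" for x by (auto simp: T_def S_def \<tau>L inj)
  moreover have "lin_on (lp p) T" by (auto simp: lin_on_def T_def fun_eq_iff)
  ultimately show ?thesis
    unfolding iso_bdd_def using T S by (intro exI[of _ T] exI[of _ S] exI[of _ 1]) auto
qed

lemma L2_set_powr_le:
  fixes f :: "nat \<Rightarrow> real"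
  assumes "0 < p"
  shows "L2_set f {..<3} powr p \<le> 3 powr p * (\<Sum>i<3. \<bar>f i\<bar> powr p)"
proof -
  have "L2_set f {..<3} powr p \<le> (\<Sum>i<3. \<bar>f i\<bar>) powr p"
    using assms by (intro powr_mono2 L2_set_le_sum_abs L2_set_nonneg) auto
  also have "\<dots> \<le> 3 powr p * (\<Sum>i<3. \<bar>f i\<bar> powr p)"
    using powr_sum_le[of "{..<3::nat}" p "\<lambda>i. \<bar>f i\<bar>"] assms by simp
  finally show ?thesis .
qed

text \<open>In dimension 3 the p-norm and the Euclidean norm are equivalent with fixed constants, so
  scalar coordinates can be grouped in triples. This removes the one-dimensional blocks, which
  \<open>block_invariant\<close> excludes.\<close>

lemma iso_bdd_triples:
  fixes m :: "'a \<Rightarrow> nat" and L :: "'l set"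
  assumes p: "0 < p" and \<rho>: "bij_betw \<rho> (UNIV :: nat set) L"
  defines "n1 \<equiv> case_sum m (\<lambda>l. if l \<in> L then 1 else 0)" and "n2 \<equiv> case_sum m (\<lambda>_ :: nat. 3)"
  shows "iso_bdd (bsp p n1 :: (_ \<Rightarrow> 'k::real_normed_field) set) (bsum p n1) (bsp p n2) (bsum p n2)"
proof -
  define T :: "_ \<Rightarrow> (('a + nat) \<times> nat \<Rightarrow> 'k)" where
    "T z = (\<lambda>(b, i). case b of Inl a \<Rightarrow> z (Inl a, i) | Inr k \<Rightarrow> if i < 3 then z (Inr (\<rho> (3 * k + i)), 0) else 0)" for z
  define S :: "_ \<Rightarrow> (('a + 'l) \<times> nat \<Rightarrow> 'k)" where
    "S v = (\<lambda>(b, i). case b of Inl a \<Rightarrow> v (Inl a, i)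
       | Inr l \<Rightarrow> if l \<in> L \<and> i = 0 then v (Inr (inv_into UNIV \<rho> l div 3), inv_into UNIV \<rho> l mod 3) else 0)" for v
  have \<rho>L: "\<rho> k \<in> L" for k using \<rho> by (auto simp: bij_betw_def)
  have inj: "inj \<rho>" and L: "range \<rho> = L" using \<rho> by (auto simp: bij_betw_def)
  have b1: "blk n1 z (Inr l) = (if l \<in> L then norm (z (Inr l, 0)) else 0)" for z :: "_ \<Rightarrow> 'k" and l
    by (simp add: blk_def L2_set_def n1_def)
  have b2: "blk n2 z (Inr k) = L2_set (\<lambda>i. norm (z (Inr k, i))) {..<3}" for z :: "_ \<Rightarrow> 'k" and k
    by (simp add: blk_def n2_def)
  \<comment> \<open>The map from (k, i) to 3k + i is injective for i < 3 only; the other pairs go to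
    a dummy summand where the function is zero.\<close>
  have inj3: "inj (\<lambda>(k, i). if i < 3 then Inl (3 * k + i) else Inr (k, i) :: nat + nat \<times> nat)"
    by (rule injI) (auto split: if_splits simp: prod_eq_iff, presburger+)
  have "sum_bdd (\<lambda>b. blk n2 (T z) b powr p) (bsum p n1 z + 3 powr p * bsum p n1 z)" if "z \<in> bsp p n1" for z
  proof (rule sum_bdd_case_sum)
    note b = bsp_sum_bdd[OF that]
    show "sum_bdd (\<lambda>a. blk n2 (T z) (Inl a) powr p) (bsum p n1 z)"
      using sum_bdd_inj[OF b, of Inl] by (simp add: blk_def n1_def n2_def T_def)
    have 1: "sum_bdd (\<lambda>j. norm (z (Inr (\<rho> j), 0)) powr p) (bsum p n1 z)"
      using sum_bdd_inj[OF b, of "\<lambda>j. Inr (\<rho> j)"] inj by (simp add: inj_def b1 \<rho>L)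
    have "sum_bdd (case_sum (\<lambda>j. norm (z (Inr (\<rho> j), 0)) powr p) (\<lambda>_ :: nat \<times> nat. 0)) (bsum p n1 z + 0)"
      by (rule sum_bdd_case_sum) (use 1 in \<open>auto simp: sum_bdd_def\<close>)
    from sum_bdd_fibers[OF sum_bdd_inj[OF this inj3], of "\<lambda>_. {..<3}"]
    have "sum_bdd (\<lambda>k. \<Sum>i<3. norm (z (Inr (\<rho> (3 * k + i)), 0)) powr p) (bsum p n1 z)" by simp
    from sum_bdd_cmult[OF this, of "3 powr p"]
    show "sum_bdd (\<lambda>k. blk n2 (T z) (Inr k) powr p) (3 powr p * bsum p n1 z)"
    proof (rule sum_bdd_mono)
      show "blk n2 (T z) (Inr k) powr p \<le> 3 powr p * (\<Sum>i<3. norm (z (Inr (\<rho> (3 * k + i)), 0)) powr p)" for k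
        using L2_set_powr_le[OF p, of "\<lambda>i. norm (T z (Inr k, i))"] by (simp add: b2 T_def)
    qed auto
  qed
  note T = sum_bdd_bsp[OF this]
  have "sum_bdd (\<lambda>b. blk n1 (S v) b powr p) (bsum p n2 v + 3 * bsum p n2 v)" if "v \<in> bsp p n2" for v
  proof (rule sum_bdd_case_sum)
    note b = bsp_sum_bdd[OF that]
    show "sum_bdd (\<lambda>a. blk n1 (S v) (Inl a) powr p) (bsum p n2 v)"
      using sum_bdd_inj[OF b, of Inl] by (simp add: blk_def n1_def n2_def S_def)
    have A: "sum_bdd (\<lambda>k. 3 * (blk n2 v (Inr k) powr p)) (3 * bsum p n2 v)"
      using sum_bdd_cmult[OF sum_bdd_inj[OF b, of Inr], of 3] by simp
    have B: "(\<Sum>i<3. norm (v (Inr k, i)) powr p) \<le> 3 * (blk n2 v (Inr k) powr p)" for k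
    proof -
      have "(\<Sum>i<3. norm (v (Inr k, i)) powr p) \<le> (\<Sum>i<(3::nat). blk n2 v (Inr k) powr p)"
        using p by (intro sum_mono powr_mono2 norm_le_blk) (auto simp: n2_def)
      then show ?thesis by simp
    qed
    have "sum_bdd (\<lambda>k. \<Sum>i<3. norm (v (Inr k, i)) powr p) (3 * bsum p n2 v)"
      by (rule sum_bdd_mono[OF A _ B]) (auto intro: sum_nonneg)
    then have "sum_bdd (\<lambda>k. \<Sum>i<3. (\<lambda>(k, i). if i < 3 then norm (v (Inr k, i)) powr p else 0) (k, i)) (3 * bsum p n2 v)"
      by simp
    from sum_bdd_Sigma[OF this]
    have "sum_bdd (\<lambda>(k, i). if i < 3 then norm (v (Inr k, i)) powr p else 0) (3 * bsum p n2 v)" by auto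
    moreover have "inj (\<lambda>j::nat. (j div 3, j mod 3))" by (rule injI) (metis Pair_inject div_mod_decomp)
    ultimately have "sum_bdd (\<lambda>j. norm (v (Inr (j div 3), j mod 3)) powr p) (3 * bsum p n2 v)"
      using sum_bdd_inj by fastforce
    from sum_bdd_extend[OF this inj]
    show "sum_bdd (\<lambda>l. blk n1 (S v) (Inr l) powr p) (3 * bsum p n2 v)"
      by (auto simp: b1 S_def \<rho>L inj L)
  qed
  note S = sum_bdd_bsp[OF this]
  have T0: "T z (b, i) = 0" if "z \<in> bsp p n1" "n2 b \<le> i" for z b i
    using that by (auto simp: T_def n1_def n2_def split: sum.splits intro!: bsp_outside[OF that(1)])
  have S0: "S v (b, i) = 0" if "v \<in> bsp p n2" "n1 b \<le> i" for v b i
    using that by (auto simp: S_def n1_def n2_def split: sum.splits if_splits intro!: bsp_outside[OF that(1)])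
  have ST: "S (T z) = z" if "z \<in> bsp p n1" for z
  proof
    fix \<gamma> :: "('a + 'l) \<times> nat"
    obtain b i where \<gamma>: "\<gamma> = (b, i)" by (cases \<gamma>)
    show "S (T z) \<gamma> = z \<gamma>"
    proof (cases b)
      case (Inr l)
      then show ?thesis
        using bsp_outside[OF that, of b i] \<rho> \<gamma>
        by (auto simp: T_def S_def n1_def bij_betw_inv_into_right split: if_splits)
    qed (simp add: \<gamma> T_def S_def)
  qed
  have TS: "T (S v) = v" if "v \<in> bsp p n2" for v
  proof
    fix \<gamma> :: "('a + nat) \<times> nat"
    obtain b i where \<gamma>: "\<gamma> = (b, i)" by (cases \<gamma>)
    show "T (S v) \<gamma> = v \<gamma>"
    proof (cases b)
      case (Inr k)
      then show ?thesis
        using bsp_outside[OF that, of b i] \<gamma> by (auto simp: T_def S_def n2_def \<rho>L inj not_less)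
    qed (simp add: \<gamma> T_def S_def)
  qed
  have "lin_on (bsp p n1) T" by (auto simp: lin_on_def T_def fun_eq_iff split: sum.splits)
  moreover have "0 < 1 + 3 powr p + (3 :: real)" by (simp add: add_pos_nonneg)
  moreover have "bsum p n2 (T z) \<le> (1 + 3 powr p + 3) * bsum p n1 z" if "z \<in> bsp p n1" for z
  proof -
    have "bsum p n2 (T z) \<le> bsum p n1 z + 3 powr p * bsum p n1 z" by (rule T(2)[OF that T0[OF that]])
    also have "\<dots> \<le> (1 + 3 powr p + 3) * bsum p n1 z" by (simp add: algebra_simps)
    finally show ?thesis .
  qed
  moreover have "bsum p n1 (S v) \<le> (1 + 3 powr p + 3) * bsum p n2 v" if "v \<in> bsp p n2" for v
  proof -
    have "bsum p n1 (S v) \<le> bsum p n2 v + 3 * bsum p n2 v" by (rule S(2)[OF that S0[OF that]])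
    then show ?thesis by (simp add: algebra_simps add_increasing2)
  qed
  ultimately show ?thesis
    unfolding iso_bdd_def using T(1)[OF _ T0] S(1)[OF _ S0] ST TS
    by (intro exI[of _ T] exI[of _ S] exI[of _ "1 + 3 powr p + 3"]) auto
qed

lemma cube_proj_cong:
  "(\<And>S. S \<subseteq> {..<m} \<Longrightarrow> f S = g S) \<Longrightarrow> cube_proj p m f i = cube_proj p m g i"
  unfolding cube_proj_def by (intro arg_cong[where f = "\<lambda>x. _ *\<^sub>R x"] sum.cong) auto

lemma cube_emb_cong:
  "(\<And>i. i < m \<Longrightarrow> a i = b i) \<Longrightarrow> cube_emb p m a S = cube_emb p m b S"
  unfolding cube_emb_def by (intro arg_cong[where f = "\<lambda>x. _ *\<^sub>R x"] sum.cong) auto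

lemma cube_proj_add: "cube_proj p m (\<lambda>S. f S + g S) i = cube_proj p m f i + cube_proj p m g i"
  and cube_proj_diff: "cube_proj p m (\<lambda>S. f S - g S) i = cube_proj p m f i - cube_proj p m g i"
  by (simp_all add: cube_proj_def scaleR_add_right scaleR_diff_right sum.distrib sum_subtractf)

lemma cube_emb_add: "cube_emb p m (\<lambda>S. f S + g S) i = cube_emb p m f i + cube_emb p m g i"
  by (simp add: cube_emb_def scaleR_add_right sum.distrib)

lemma cube_proj_mult: "cube_proj p m (\<lambda>S. c * f S) i = c * (cube_proj p m f i :: 'k::real_normed_field)"
  and cube_emb_mult: "cube_emb p m (\<lambda>i. c * a i) S = c * (cube_emb p m a S :: 'k::real_normed_field)"
  by (simp_all add: cube_proj_def cube_emb_def sum_distrib_left)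

lemma powr_norm_add3:
  fixes a b c :: "'k::real_normed_vector"
  assumes "0 < p"
  shows "norm (a + b + c) powr p \<le> 3 powr p * (norm a powr p + norm b powr p + norm c powr p)"
proof -
  have "norm (a + b + c) powr p \<le> (norm a + norm b + norm c) powr p"
    using assms by (intro powr_mono2) (auto intro: norm_triangle_le norm_triangle_ineq add_right_mono order_trans[OF norm_triangle_ineq])
  also have "\<dots> \<le> 3 powr p * (norm a powr p + norm b powr p + norm c powr p)"
    using powr_sum_le[of "{..<3::nat}" p "\<lambda>i. if i = 0 then norm a else if i = 1 then norm b else norm c"] assms
    by (simp add: numeral_3_eq_3)
  finally show ?thesis .
qed

text \<open>The Eilenberg swindle: on each cube the space splits as H + Z with H Euclidean; moving one copy
  of every H to the front and regrouping Z with the next copy of H leaves the sequence of cubes intact.\<close>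

lemma iso_bdd_swindle:
  fixes m :: "'a \<Rightarrow> nat"
  assumes p: "1 < p"
  defines "L \<equiv> {((j :: nat, k), S). S \<subseteq> {..<m k}}"
  defines "n1 \<equiv> \<lambda>l. if l \<in> L then 1 else 0" and "n2 \<equiv> case_sum m (\<lambda>l. if l \<in> L then 1 else 0)"
  shows "iso_bdd (bsp p n1 :: (_ \<Rightarrow> 'k::scalar_field) set) (bsum p n1) (bsp p n2) (bsum p n2)"
proof -
  \<comment> \<open>The projection of the cube space for k onto its Euclidean part H.\<close>
  define P where "P k f = cube_emb p (m k) (cube_proj p (m k) f)" for k and f :: "nat set \<Rightarrow> 'k"
  define x where "x z j k = (\<lambda>S. z (((j, k), S), 0 :: nat))" for z :: "((nat \<times> 'a) \<times> nat set) \<times> nat \<Rightarrow> 'k" and j k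
  define y where "y v j k = (\<lambda>S. v (Inr ((j, k), S), 0 :: nat))" for v :: "('a + ((nat \<times> 'a) \<times> nat set)) \<times> nat \<Rightarrow> 'k" and j k
  define h where "h v k = (\<lambda>i. v (Inl k, i))" for v :: "('a + ((nat \<times> 'a) \<times> nat set)) \<times> nat \<Rightarrow> 'k" and k
  \<comment> \<open>Copy j keeps its complementary part x - Px and receives the H-part of copy j +
    1; the H-part of copy 0 becomes the new Euclidean block.\<close>
  define T :: "_ \<Rightarrow> ('a + ((nat \<times> 'a) \<times> nat set)) \<times> nat \<Rightarrow> 'k" where "T z = (\<lambda>(b, i). case b of
       Inl k \<Rightarrow> if i < m k then cube_proj p (m k) (x z 0 k) i else 0
     | Inr ((j, k), S) \<Rightarrow> if S \<subseteq> {..<m k} \<and> i = 0 then x z j k S - P k (x z j k) S + P k (x z (Suc j) k) S else 0)" for z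
  \<comment> \<open>The H-part restored to copy j: from the Euclidean block when j = 0, from copy j
    - 1 otherwise.\<close>
  define F where "F v j k = (case j of 0 \<Rightarrow> cube_emb p (m k) (h v k) | Suc j' \<Rightarrow> P k (y v j' k))" for v j k
  define S :: "_ \<Rightarrow> ((nat \<times> 'a) \<times> nat set) \<times> nat \<Rightarrow> 'k" where "S v = (\<lambda>(((j, k), X), i).
     if X \<subseteq> {..<m k} \<and> i = 0 then F v j k X + y v j k X - P k (y v j k) X else 0)" for v
  have QP: "cube_proj p (m k) (P k f) i = cube_proj p (m k) f i" if "i < m k" for k f i
    using cube_proj_emb[OF that] by (simp add: P_def)
  \<comment> \<open>\<open>cube_proj\<close> has values at every index, but \<open>cube_emb\<close>
    reads only those below \<open>m k\<close>.\<close>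
  have PP: "P k f = P k g" if "\<And>i. i < m k \<Longrightarrow> cube_proj p (m k) f i = cube_proj p (m k) g i" for k f g
    unfolding P_def using that by (intro ext cube_emb_cong)
  have Tx: "y (T z) j k S = x z j k S - P k (x z j k) S + P k (x z (Suc j) k) S" if "S \<subseteq> {..<m k}" for z j k S
    using that by (simp add: y_def T_def)
  have Sy: "x (S v) j k X = F v j k X + y v j k X - P k (y v j k) X" if "X \<subseteq> {..<m k}" for v j k X
    using that by (simp add: x_def S_def)
  have QT: "cube_proj p (m k) (y (T z) j k) i = cube_proj p (m k) (x z (Suc j) k) i" if "i < m k" for z j k i
  proof -
    have "cube_proj p (m k) (y (T z) j k) i = cube_proj p (m k) (\<lambda>S. x z j k S - P k (x z j k) S + P k (x z (Suc j) k) S) i"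
      by (rule cube_proj_cong) (rule Tx)
    then show ?thesis by (simp add: cube_proj_add cube_proj_diff QP[OF that])
  qed
  have QF: "cube_proj p (m k) (x (S v) j k) i = cube_proj p (m k) (F v j k) i" if "i < m k" for v j k i
  proof -
    have "cube_proj p (m k) (x (S v) j k) i = cube_proj p (m k) (\<lambda>X. F v j k X + y v j k X - P k (y v j k) X) i"
      by (rule cube_proj_cong) (rule Sy)
    then show ?thesis by (simp add: cube_proj_add cube_proj_diff QP[OF that])
  qed
  have QF0: "cube_proj p (m k) (F v 0 k) i = h v k i" if "i < m k" for v k i
    using cube_proj_emb[OF that] by (simp add: F_def)
  have QFS: "cube_proj p (m k) (F v (Suc j) k) i = cube_proj p (m k) (y v j k) i" if "i < m k" for v j k i
    using QP[OF that] by (simp add: F_def)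
  have PT: "P k (y (T z) j k) = P k (x z (Suc j) k)" for k z j by (rule PP) (rule QT)
  have ST: "S (T z) = z" if z: "z \<in> bsp p n1" for z
  proof
    fix \<gamma> :: "((nat \<times> 'a) \<times> nat set) \<times> nat"
    obtain j k X i where \<gamma>: "\<gamma> = (((j, k), X), i)" by (metis surj_pair)
    show "S (T z) \<gamma> = z \<gamma>"
    proof (cases "X \<subseteq> {..<m k} \<and> i = 0")
      case True
      have "F (T z) j k = P k (x z j k)"
      proof (cases j)
        case 0
        have "cube_emb p (m k) (h (T z) k) = cube_emb p (m k) (cube_proj p (m k) (x z 0 k))"
          by (intro ext cube_emb_cong) (simp add: h_def T_def)
        then show ?thesis by (simp add: F_def 0 P_def)
      qed (simp add: F_def PT)
      then show ?thesis using True by (simp add: \<gamma> S_def PT Tx) (simp add: x_def)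
    next
      case False
      then have "n1 ((j, k), X) \<le> i" by (auto simp: n1_def L_def)
      then show ?thesis using False bsp_outside[OF z] by (auto simp: \<gamma> S_def)
    qed
  qed
  have TS: "T (S v) = v" if v: "v \<in> bsp p n2" for v
  proof
    fix \<gamma> :: "('a + ((nat \<times> 'a) \<times> nat set)) \<times> nat"
    obtain b i where \<gamma>: "\<gamma> = (b, i)" by (cases \<gamma>)
    show "T (S v) \<gamma> = v \<gamma>"
    proof (cases b)
      case (Inl k)
      then show ?thesis
        using bsp_outside[OF v, of b i] by (auto simp: \<gamma> T_def n2_def QF QF0 not_less) (simp add: h_def)
    next
      case (Inr l)
      obtain j k X where l: "l = ((j, k), X)" by (metis surj_pair)
      show ?thesis
      proof (cases "X \<subseteq> {..<m k} \<and> i = 0")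
        case True
        have "P k (x (S v) (Suc j) k) = P k (y v j k)"
          by (rule PP) (simp add: QF QFS)
        moreover have "P k (x (S v) j k) X = F v j k X"
        proof (cases j)
          case 0
          have "P k (x (S v) 0 k) X = cube_emb p (m k) (h v k) X"
            unfolding P_def by (rule cube_emb_cong) (simp add: QF QF0)
          then show ?thesis by (simp add: 0 F_def)
        next
          case (Suc j')
          have "P k (x (S v) (Suc j') k) = P k (y v j' k)"
            by (rule PP) (simp add: QF QFS)
          then show ?thesis by (simp add: Suc F_def)
        qed
        ultimately show ?thesis
          using True by (simp add: \<gamma> Inr l T_def Sy) (simp add: y_def)
      next
        case False
        then have "n2 b \<le> i" by (auto simp: n2_def L_def Inr l)
        then show ?thesis using False bsp_outside[OF v, of b i] by (auto simp: \<gamma> Inr l T_def)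
      qed
    qed
  qed
  obtain KJ where KJ: "KJ > 0" "\<And>m (a :: nat \<Rightarrow> 'k). (\<Sum>S\<in>Pow {..<m}. norm (cube_emb p m a S) powr p) \<le> KJ * L2_set (\<lambda>i. norm (a i)) {..<m} powr p"
    using cube_emb_bound[of p, where 'k = 'k] p by force
  obtain KQ where KQ: "KQ > 0" "\<And>m (f :: nat set \<Rightarrow> 'k). L2_set (\<lambda>i. norm (cube_proj p m f i)) {..<m} powr p \<le> KQ * (\<Sum>S\<in>Pow {..<m}. norm (f S) powr p)"
    using cube_proj_bound[OF p, where 'k = 'k] by blast
  define N where "N k f = (\<Sum>X\<in>Pow {..<m k}. norm (f X) powr p)" for k and f :: "nat set \<Rightarrow> 'k"
  \<comment> \<open>One constant that dominates the bounds of the projection, the embedding and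
    their composition P.\<close>
  define K where "K = KJ + KQ + KJ * KQ"
  have K: "K > 0" "KJ \<le> K" "KQ \<le> K" "KJ * KQ \<le> K" using KJ(1) KQ(1) by (simp_all add: K_def add_pos_pos)
  have N0: "N k f \<ge> 0" for k f by (simp add: N_def sum_nonneg)
  have NP: "N k (P k f) \<le> K * N k f" for k f
  proof -
    have "N k (P k f) \<le> KJ * (KQ * N k f)"
      unfolding N_def P_def using KJ(1) by (intro order_trans[OF KJ(2)] mult_left_mono KQ(2)) auto
    also have "\<dots> = (KJ * KQ) * N k f" by simp
    also have "\<dots> \<le> K * N k f" using K N0 by (intro mult_right_mono) auto
    finally show ?thesis .
  qed
  have N3: "N k (\<lambda>X. f X + g X + f' X) \<le> 3 powr p * (N k f + N k g + N k f')" for k f g f'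
  proof -
    have "N k (\<lambda>X. f X + g X + f' X) \<le> (\<Sum>X\<in>Pow {..<m k}. 3 powr p * (norm (f X) powr p + norm (g X) powr p + norm (f' X) powr p))"
      unfolding N_def using p by (intro sum_mono powr_norm_add3) auto
    also have "\<dots> = 3 powr p * (N k f + N k g + N k f')"
      by (simp only: N_def sum.distrib flip: sum_distrib_left)
    finally show ?thesis .
  qed
  have Nm: "N k (\<lambda>X. - f X) = N k f" for k f by (simp add: N_def)
  have Ncong: "N k f = N k g" if "\<And>X. X \<subseteq> {..<m k} \<Longrightarrow> f X = g X" for k f g
    unfolding N_def using that by (intro sum.cong) auto
  have blk1: "(\<Sum>X\<in>Pow {..<m k}. blk n1 z ((j, k), X) powr p) = N k (x z j k)" for z :: "_ \<Rightarrow> 'k" and j k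
    unfolding N_def by (intro sum.cong) (auto simp: blk_def L2_set_def n1_def L_def x_def)
  have blk2: "(\<Sum>X\<in>Pow {..<m k}. blk n2 v (Inr ((j, k), X)) powr p) = N k (y v j k)" for v :: "_ \<Rightarrow> 'k" and j k
    unfolding N_def by (intro sum.cong) (auto simp: blk_def L2_set_def n2_def L_def y_def)
  have blk1_0: "blk n1 z l = 0" if "l \<notin> L" for z :: "_ \<Rightarrow> 'k" and l
    using that by (simp add: blk_def n1_def)
  have blk2_0: "blk n2 v (Inr l) = 0" if "l \<notin> L" for v :: "_ \<Rightarrow> 'k" and l
    using that by (simp add: blk_def n2_def)
  have notL: "(a, X) \<notin> L" if "X \<notin> Pow {..<m (snd a)}" for a X
    using that by (cases a) (auto simp: L_def)
  have inj0: "inj (\<lambda>k. (0 :: nat, k :: 'a))" and injS: "inj (\<lambda>(j, k :: 'a). (Suc j, k))"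
    by (auto simp: inj_def)
  define B where "B = (\<lambda>jk :: nat \<times> 'a. Pow {..<m (snd jk)})"
  have finB: "finite (B a)" for a by (simp add: B_def)
  have blk1': "(\<Sum>X\<in>B a. blk n1 z (a, X) powr p) = N (snd a) (x z (fst a) (snd a))" for z :: "_ \<Rightarrow> 'k" and a
    by (cases a) (simp add: B_def blk1)
  have blk2': "(\<Sum>X\<in>B a. blk n2 v (Inr (a, X)) powr p) = N (snd a) (y v (fst a) (snd a))" for v :: "_ \<Rightarrow> 'k" and a
    by (cases a) (simp add: B_def blk2)
  have "sum_bdd (\<lambda>b. blk n2 (T z) b powr p) (K * bsum p n1 z + 3 powr p * ((1 + K) * bsum p n1 z + K * bsum p n1 z))"
    if z: "z \<in> bsp p n1" for z
  proof (rule sum_bdd_case_sum)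
    let ?b = "bsum p n1 z" and ?c = "3 powr p * ((1 + K) * bsum p n1 z + K * bsum p n1 z)"
    have u: "sum_bdd (\<lambda>a. N (snd a) (x z (fst a) (snd a))) (?b)"
      using sum_bdd_fibers[OF bsp_sum_bdd[OF z], of B] finB by (simp add: blk1')
    have le: "blk n2 (T z) (Inl k) powr p \<le> K * N k (x z 0 k)" for k
    proof -
      have "blk n2 (T z) (Inl k) powr p = L2_set (\<lambda>i. norm (cube_proj p (m k) (x z 0 k) i)) {..<m k} powr p"
        by (simp add: blk_def n2_def T_def L2_set_def)
      also have "\<dots> \<le> KQ * N k (x z 0 k)" unfolding N_def by (rule KQ(2))
      also have "\<dots> \<le> K * N k (x z 0 k)" using K N0 by (intro mult_right_mono) auto
      finally show ?thesis .
    qed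
    have u0: "sum_bdd (\<lambda>k. N k (x z 0 k)) (?b)" using sum_bdd_inj[OF u inj0] by simp
    show "sum_bdd (\<lambda>k. blk n2 (T z) (Inl k) powr p) (K * ?b)"
      by (rule sum_bdd_mono[OF sum_bdd_cmult[OF u0, of K] _ le]) (use K in auto)
    have uS: "sum_bdd (\<lambda>a. N (snd a) (x z (Suc (fst a)) (snd a))) (?b)"
      using sum_bdd_inj[OF u injS] by (simp add: case_prod_beta')
    have le: "N k (y (T z) j k) \<le> 3 powr p * ((1 + K) * N k (x z j k) + K * N k (x z (Suc j) k))" for j k
    proof -
      have "N k (y (T z) j k) = N k (\<lambda>X. x z j k X + - P k (x z j k) X + P k (x z (Suc j) k) X)"
        by (rule Ncong) (simp add: Tx)
      also have "\<dots> \<le> 3 powr p * (N k (x z j k) + N k (P k (x z j k)) + N k (P k (x z (Suc j) k)))"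
        using N3[of k "x z j k" "\<lambda>X. - P k (x z j k) X" "P k (x z (Suc j) k)"] by (simp only: Nm)
      also have "\<dots> \<le> 3 powr p * (N k (x z j k) + K * N k (x z j k) + K * N k (x z (Suc j) k))"
        by (intro mult_left_mono add_mono NP order_refl) auto
      finally show ?thesis by (simp add: algebra_simps)
    qed
    have "sum_bdd (\<lambda>a. N (snd a) (y (T z) (fst a) (snd a))) ?c"
      by (rule sum_bdd_mono[OF sum_bdd_cmult[OF sum_bdd_add[OF sum_bdd_cmult[OF u, of "1 + K"] sum_bdd_cmult[OF uS, of K]], of "3 powr p"] N0 le])
        (use K in auto)
    then have "sum_bdd (\<lambda>a. \<Sum>X\<in>B a. blk n2 (T z) (Inr (a, X)) powr p) ?c"
      by (simp add: blk2')
    then show "sum_bdd (\<lambda>l. blk n2 (T z) (Inr l) powr p) ?c"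
      by (rule sum_bdd_Sigma) (use finB in \<open>auto simp: B_def intro!: blk2_0 notL\<close>)
  qed
  note T = sum_bdd_bsp[OF this]
  have "sum_bdd (\<lambda>l. blk n1 (S v) l powr p) (3 powr p * (K * bsum p n2 v + K * bsum p n2 v + (1 + K) * bsum p n2 v))"
    if v: "v \<in> bsp p n2" for v
  proof -
    let ?b = "bsum p n2 v"
    let ?c = "3 powr p * (K * ?b + K * ?b + (1 + K) * ?b)"
    note b = bsp_sum_bdd[OF v]
    \<comment> \<open>G1 and G2 split the cost of F by its two sources: G1 lives on j = 0, G2 on j >
      0 as a shifted copy of the cube terms of v. Each is an injective extension by zero.\<close>
    define G1 where "G1 = (\<lambda>(j :: nat, k). if j = 0 then blk n2 v (Inl k) powr p else 0)"
    define G2 where "G2 = (\<lambda>(j, k). case j of 0 \<Rightarrow> 0 | Suc j' \<Rightarrow> N k (y v j' k))"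
    have u: "sum_bdd (\<lambda>a. N (snd a) (y v (fst a) (snd a))) (?b)"
      using sum_bdd_fibers[OF sum_bdd_inj[OF b, of Inr], of B] finB by (simp add: blk2')
    have g1: "sum_bdd G1 (?b)"
      by (rule sum_bdd_extend[OF sum_bdd_inj[OF b, of Inl] inj0]) (auto simp: G1_def image_iff)
    have g2: "sum_bdd G2 (?b)"
      by (rule sum_bdd_extend[OF u injS]) (auto simp: G2_def image_iff split: nat.splits)
    have le: "N k (x (S v) j k) \<le> 3 powr p * (K * G1 (j, k) + K * G2 (j, k) + (1 + K) * N k (y v j k))" for j k
    proof -
      have F: "N k (F v j k) \<le> K * G1 (j, k) + K * G2 (j, k)"
      proof (cases j)
        case 0
        have "N k (F v 0 k) \<le> KJ * L2_set (\<lambda>i. norm (h v k i)) {..<m k} powr p"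
          unfolding N_def F_def using KJ(2) by simp
        also have "\<dots> \<le> K * L2_set (\<lambda>i. norm (h v k i)) {..<m k} powr p" using K by (intro mult_right_mono) auto
        finally show ?thesis by (simp add: 0 G1_def G2_def blk_def n2_def h_def)
      next
        case (Suc j')
        then show ?thesis using NP by (simp add: F_def G1_def G2_def)
      qed
      have "N k (x (S v) j k) = N k (\<lambda>X. F v j k X + y v j k X + - P k (y v j k) X)"
        by (rule Ncong) (simp add: Sy)
      also have "\<dots> \<le> 3 powr p * (N k (F v j k) + N k (y v j k) + N k (P k (y v j k)))"
        using N3[of k "F v j k" "y v j k" "\<lambda>X. - P k (y v j k) X"] by (simp only: Nm)
      also have "\<dots> \<le> 3 powr p * ((K * G1 (j, k) + K * G2 (j, k)) + N k (y v j k) + K * N k (y v j k))"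
        by (intro mult_left_mono add_mono NP order_refl F) auto
      finally show ?thesis by (simp add: algebra_simps)
    qed
    have "sum_bdd (\<lambda>a. N (snd a) (x (S v) (fst a) (snd a))) ?c"
    proof (rule sum_bdd_mono)
      show "sum_bdd (\<lambda>a. 3 powr p * (K * G1 a + K * G2 a + (1 + K) * N (snd a) (y v (fst a) (snd a)))) ?c"
        using K by (intro sum_bdd_cmult sum_bdd_add g1 g2 u) auto
    qed (use N0 le in auto)
    then have "sum_bdd (\<lambda>a. \<Sum>X\<in>B a. blk n1 (S v) (a, X) powr p) ?c"
      by (simp add: blk1')
    then show ?thesis
      by (rule sum_bdd_Sigma) (use finB in \<open>auto simp: B_def intro!: blk1_0 notL\<close>)
  qed
  note S = sum_bdd_bsp[OF this]
  have T0: "T z (b, i) = 0" if "n2 b \<le> i" for z b i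
    using that by (auto simp: T_def n2_def L_def split: sum.splits if_splits)
  have S0: "S v (l, i) = 0" if "n1 l \<le> i" for v l i
    using that by (auto simp: S_def n1_def L_def split: if_splits)
  have lin: "lin_on (bsp p n1) T"
  proof -
    have xa: "x (z + z') j k = (\<lambda>S. x z j k S + x z' j k S)" "x (smul c z) j k = (\<lambda>S. c * x z j k S)" for z z' c j k
      by (auto simp: x_def)
    have Pa: "P k (\<lambda>S. f S + g S) S = P k f S + P k g S" "P k (\<lambda>S. c * f S) S = c * P k f S" for k f g c S
      unfolding P_def cube_proj_add cube_proj_mult cube_emb_add cube_emb_mult by auto
    show ?thesis
      by (auto simp: lin_on_def T_def fun_eq_iff xa Pa cube_proj_add cube_proj_mult algebra_simps split: sum.splits)
  qed
  \<comment> \<open>Large enough for both directions: T costs K + 3 powr p (1 + 2K), S costs 3 powr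
    p (1 + 3K).\<close>
  define C where "C = K + 3 powr p * (1 + 3 * K)"
  have "C > 0" using K by (simp add: C_def add_pos_pos)
  moreover have "bsum p n2 (T z) \<le> C * bsum p n1 z" if "z \<in> bsp p n1" for z
  proof -
    have "C * bsum p n1 z = K * bsum p n1 z + 3 powr p * ((1 + K) * bsum p n1 z + K * bsum p n1 z) + 3 powr p * (K * bsum p n1 z)"
      by (simp add: C_def algebra_simps)
    moreover have "0 \<le> 3 powr p * (K * bsum p n1 z)" using K(1) by simp
    ultimately show ?thesis using T(2)[OF that T0] by linarith
  qed
  moreover have "bsum p n1 (S v) \<le> C * bsum p n2 v" if "v \<in> bsp p n2" for v
  proof -
    have "C * bsum p n2 v = 3 powr p * (K * bsum p n2 v + K * bsum p n2 v + (1 + K) * bsum p n2 v) + K * bsum p n2 v"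
      by (simp add: C_def algebra_simps)
    moreover have "0 \<le> K * bsum p n2 v" using K(1) by simp
    ultimately show ?thesis using S(2)[OF that S0] by linarith
  qed
  ultimately show ?thesis
    unfolding iso_bdd_def using lin T(1)[OF _ T0] S(1)[OF _ S0] ST TS by blast
qed

section \<open>The renormings\<close>

lemma lin_on_lp_iff: "linear_on_lp p T \<longleftrightarrow> lin_on (lp p) T"
  by (simp add: linear_on_lp_def lin_on_def plus_fun_def smul_def)

lemma nrm_on_lp_iff: "norm_on_lp p N \<longleftrightarrow> nrm_on (lp p) N"
  by (simp add: norm_on_lp_def nrm_on_def plus_fun_def smul_def zero_fun_def)

text \<open>The index (a, j) is the j-th copy of the block for a, so every dimension occurs
  infinitely often. The right summand holds the triples left by the swindle; the shift by 4 keeps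
  the dimensions from A apart from 3.\<close>

definition dims_of :: "nat set \<Rightarrow> (nat \<times> nat) + nat \<Rightarrow> nat" where
  "dims_of A = case_sum (\<lambda>(a, j). if a \<in> A then a + 4 else 3) (\<lambda>_. 3)"

lemma range_dims_of: "range (dims_of A) = insert 3 ((\<lambda>a. a + 4) ` A)"
proof (intro Set.equalityI subsetI)
  fix d assume "d \<in> insert 3 ((\<lambda>a. a + 4) ` A)"
  then show "d \<in> range (dims_of A)"
  proof
    assume "d = 3"
    then have "d = dims_of A (Inr 0)" by (simp add: dims_of_def)
    then show ?thesis by blast
  next
    assume "d \<in> (\<lambda>a. a + 4) ` A"
    then obtain a where "a \<in> A" "d = a + 4" by blast
    then have "d = dims_of A (Inl (a, 0))" by (simp add: dims_of_def)
    then show ?thesis by blast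
  qed
qed (auto simp: dims_of_def split: sum.splits prod.splits)

lemma range_dims_of_inj:
  assumes "range (dims_of A) = range (dims_of B)"
  shows "A = B"
proof -
  have "A = {a. a + 4 \<in> range (dims_of A)}" for A
    unfolding range_dims_of by auto
  then show ?thesis using assms by metis
qed

lemma dims_of_ge: "3 \<le> dims_of A b"
  by (auto simp: dims_of_def split: sum.splits)

lemma infinite_dims_of: "infinite {c. dims_of A c = dims_of A b}"
proof (cases b)
  case (Inl x)
  obtain a j where "x = (a, j)" by (cases x)
  then have "range (\<lambda>j. Inl (a, j)) \<subseteq> {c. dims_of A c = dims_of A b}"
    by (auto simp: dims_of_def Inl)
  moreover have "infinite (range (\<lambda>j :: nat. Inl (a, j) :: (nat \<times> nat) + nat))"
    by (intro range_inj_infinite) (simp add: inj_def)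
  ultimately show ?thesis using finite_subset by blast
next
  case (Inr k)
  have "range Inr \<subseteq> {c. dims_of A c = dims_of A b}"
    by (auto simp: dims_of_def Inr)
  moreover have "infinite (range (Inr :: nat \<Rightarrow> (nat \<times> nat) + nat))"
    by (intro range_inj_infinite) (simp add: inj_def)
  ultimately show ?thesis using finite_subset by blast
qed

text \<open>L, the points of all cubes, is countably infinite. One bijection \<tau> serves twice: it
  spreads \<open>lp p\<close> over L, and after the swindle has added the Euclidean blocks it
  regroups L into triples.\<close>

lemma iso_bdd_lp_blocks:
  assumes p: "1 < p"
  shows "iso_bdd (lp p :: (nat \<Rightarrow> 'k::scalar_field) set) (lp_sum p)
    (bsp p (dims_of A)) (bsum p (dims_of A))"
proof -
  define m where "m = (\<lambda>(a, j :: nat). if a \<in> A then a + 4 else 3 :: nat)"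
  define L where "L = {((j :: nat, k), S). S \<subseteq> {..<m k}}"
  have L: "L = Sigma UNIV (\<lambda>(j, k). Pow {..<m k})" by (auto simp: L_def)
  have "countable L" unfolding L by (intro countable_SIGMA) (auto intro: countable_finite)
  moreover have "infinite L"
  proof
    assume "finite L"
    moreover have "range (\<lambda>j. ((j, (0, 0)), {})) \<subseteq> L" by (auto simp: L_def)
    ultimately have "finite (range (\<lambda>j :: nat. ((j, (0 :: nat, 0 :: nat)), {} :: nat set)))"
      using finite_subset by blast
    then show False by (simp add: finite_image_iff inj_def)
  qed
  ultimately obtain \<tau> :: "nat \<Rightarrow> _" where \<tau>: "bij_betw \<tau> UNIV L"
    using bij_betw_from_nat_into by blast
  have d: "dims_of A = case_sum m (\<lambda>_. 3)" by (simp add: dims_of_def m_def)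
  show ?thesis
    unfolding d
    by (rule iso_bdd_trans[OF iso_bdd_relabel[OF \<tau>] iso_bdd_trans[OF
          iso_bdd_swindle[OF p, of m, folded L_def] iso_bdd_triples[OF _ \<tau>]]])
      (use p in simp)
qed

lemma lp_norm_eq: "lp_norm p x = lp_sum p x powr (1 / p)"
  by (simp add: lp_norm_def)

lemma lp_sum_nonneg: "x \<in> lp p \<Longrightarrow> 0 \<le> lp_sum p x"
  by (simp add: lp_def suminf_nonneg)

definition block_iso ::
    "real \<Rightarrow> nat set \<Rightarrow> ((nat \<Rightarrow> 'k::scalar_field) \<Rightarrow> (((nat \<times> nat) + nat) \<times> nat \<Rightarrow> 'k)) \<Rightarrow> bool" where
  "block_iso p A T \<longleftrightarrow> (\<exists>S. \<exists>C>0. lin_on (lp p) T \<and>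
    (\<forall>x\<in>lp p. T x \<in> bsp p (dims_of A)) \<and> (\<forall>y\<in>bsp p (dims_of A). S y \<in> lp p) \<and>
    (\<forall>x\<in>lp p. S (T x) = x) \<and> (\<forall>y\<in>bsp p (dims_of A). T (S y) = y) \<and>
    (\<forall>x\<in>lp p. bnorm p (dims_of A) (T x) \<le> C * lp_norm p x) \<and>
    (\<forall>y\<in>bsp p (dims_of A). lp_norm p (S y) \<le> C * bnorm p (dims_of A) y))"

lemma iso_lp_blocks:
  assumes p: "1 < p"
  shows "\<exists>T :: (nat \<Rightarrow> 'k::scalar_field) \<Rightarrow> _. block_iso p A T"
proof -
  let ?n = "dims_of A"
  obtain T S C where C: "C > 0" and 1: "lin_on (lp p :: (nat \<Rightarrow> 'k) set) T" "\<And>x. x \<in> lp p \<Longrightarrow> T x \<in> bsp p ?n"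
    "\<And>y. y \<in> bsp p ?n \<Longrightarrow> S y \<in> lp p" "\<And>x. x \<in> lp p \<Longrightarrow> S (T x) = x" "\<And>y. y \<in> bsp p ?n \<Longrightarrow> T (S y) = y"
    "\<And>x. x \<in> lp p \<Longrightarrow> bsum p ?n (T x) \<le> C * lp_sum p x" "\<And>y. y \<in> bsp p ?n \<Longrightarrow> lp_sum p (S y) \<le> C * bsum p ?n y"
    using iso_bdd_lp_blocks[OF p, where 'k = 'k and A = A] unfolding iso_bdd_def by blast
  have "bnorm p ?n (T x) \<le> C powr (1/p) * lp_norm p x" if "x \<in> lp p" for x
  proof -
    have "bnorm p ?n (T x) \<le> (C * lp_sum p x) powr (1/p)"
      unfolding bnorm_def using 1(6)[OF that] p by (intro powr_mono2) auto
    then show ?thesis using C lp_sum_nonneg[OF that] by (simp add: powr_mult lp_norm_eq)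
  qed
  moreover have "lp_norm p (S y) \<le> C powr (1/p) * bnorm p ?n y" if "y \<in> bsp p ?n" for y
  proof -
    have "lp_norm p (S y) \<le> (C * bsum p ?n y) powr (1/p)"
      unfolding lp_norm_eq using 1(7)[OF that] p lp_sum_nonneg[OF 1(3)[OF that]] by (intro powr_mono2) auto
    then show ?thesis using C by (simp add: powr_mult bnorm_def)
  qed
  moreover have "C powr (1/p) > 0" using C by simp
  ultimately show ?thesis using 1(1-5) unfolding block_iso_def by blast
qed

text \<open>Fixing one isomorphism for each A makes the renorming a function of A; its range is the
  desired family.\<close>

definition to_blocks :: "real \<Rightarrow> nat set \<Rightarrow> (nat \<Rightarrow> 'k::scalar_field) \<Rightarrow> (((nat \<times> nat) + nat) \<times> nat \<Rightarrow> 'k)" where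
  "to_blocks p A = (SOME T. block_iso p A T)"

definition renorm :: "real \<Rightarrow> nat set \<Rightarrow> (nat \<Rightarrow> 'k::scalar_field) \<Rightarrow> real" where
  "renorm p A x = bnorm p (dims_of A) (to_blocks p A x)"

definition of_blocks :: "real \<Rightarrow> nat set \<Rightarrow> (((nat \<times> nat) + nat) \<times> nat \<Rightarrow> 'k::scalar_field) \<Rightarrow> (nat \<Rightarrow> 'k)" where
  "of_blocks p A = inv_into (lp p) (to_blocks p A)"

lemma lp_subspace:
  assumes "0 < p"
  shows "fs.subspace (lp p :: (nat \<Rightarrow> 'k::real_normed_field) set)"
proof (rule fs.subspaceI)
  show "0 \<in> lp p" by (simp add: lp_def)
  show "smul c x \<in> lp p" if "x \<in> lp p" for c and x :: "nat \<Rightarrow> 'k"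
    using that summable_mult[of "\<lambda>n. norm (x n) powr p" "norm c powr p"] by (simp add: lp_def norm_mult powr_mult)
  show "x + y \<in> lp p" if "x \<in> lp p" "y \<in> lp p" for x y :: "nat \<Rightarrow> 'k"
  proof -
    have s: "summable (\<lambda>n. 3 powr p * (norm (x n) powr p + norm (y n) powr p))"
      using that by (intro summable_mult summable_add) (auto simp: lp_def)
    have "norm (norm ((x + y) n) powr p) \<le> 3 powr p * (norm (x n) powr p + norm (y n) powr p)" for n
      using powr_norm_add3[OF assms, of "x n" "y n" 0] by simp
    from summable_comparison_test'[OF s this] show ?thesis by (simp add: lp_def)
  qed
qed

context
  fixes p :: real and A :: "nat set"
  assumes p: "1 < p"
begin

lemma blocks_isom:
  "isom_pair (lp p :: (nat \<Rightarrow> 'k::scalar_field) set) (renorm p A)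
     (bsp p (dims_of A)) (bnorm p (dims_of A)) (to_blocks p A) (of_blocks p A)" (is ?isom)
  and renorm_bounds: "\<exists>C>0. (\<forall>x\<in>lp p :: (nat \<Rightarrow> 'k) set. renorm p A x \<le> C * lp_norm p x \<and> lp_norm p x \<le> C * renorm p A x)" (is ?bounds)
proof -
  let ?X = "lp p :: (nat \<Rightarrow> 'k) set" and ?V = "bsp p (dims_of A)" and ?T = "to_blocks p A"
  obtain S C where C: "C > 0" and *: "lin_on ?X ?T" "\<forall>x\<in>?X. ?T x \<in> ?V" "\<forall>y\<in>?V. S y \<in> ?X"
    "\<forall>x\<in>?X. S (?T x) = x" "\<forall>y\<in>?V. ?T (S y) = y"
    "\<forall>x\<in>?X. bnorm p (dims_of A) (?T x) \<le> C * lp_norm p x" "\<forall>y\<in>?V. lp_norm p (S y) \<le> C * bnorm p (dims_of A) y"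
    using someI_ex[OF iso_lp_blocks[OF p, where 'k = 'k and A = A], folded to_blocks_def] unfolding block_iso_def by blast
  have inj: "inj_on ?T ?X" using *(4) by (metis inj_onI)
  have im: "y \<in> ?T ` ?X" if "y \<in> ?V" for y using *(3,5) that by force
  have "of_blocks p A y \<in> ?X" "?T (of_blocks p A y) = y" if "y \<in> ?V" for y
    unfolding of_blocks_def by (rule inv_into_into[OF im[OF that]], rule f_inv_into_f[OF im[OF that]])
  moreover have "of_blocks p A (?T x) = x" if "x \<in> ?X" for x
    unfolding of_blocks_def using inj that by (rule inv_into_f_f)
  ultimately show ?isom using *(1,2) by (simp add: isom_pair_def renorm_def)
  show ?bounds
    using C *(2,4,6,7) unfolding renorm_def by metis
qed

lemma equivalent_norm_renorm: "equivalent_norm p (renorm p A :: (nat \<Rightarrow> 'k::scalar_field) \<Rightarrow> real)"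
  unfolding equivalent_norm_def
proof
  have p1: "1 \<le> p" using p by simp
  interpret B: normed_subspace "bsp p (dims_of A) :: (_ \<Rightarrow> 'k) set" "bnorm p (dims_of A)"
    by unfold_locales (rule bsp_subspace[OF p1] nrm_on_bnorm[OF p1])+
  note iso = blocks_isom[where 'k = 'k]
  have sub: "fs.subspace (lp p :: (nat \<Rightarrow> 'k) set)" using p by (intro lp_subspace) simp
  have T: "lin_on (lp p) (to_blocks p A :: (nat \<Rightarrow> 'k) \<Rightarrow> _)"
    "\<And>x :: nat \<Rightarrow> 'k. x \<in> lp p \<Longrightarrow> to_blocks p A x \<in> bsp p (dims_of A)"
    "\<And>x :: nat \<Rightarrow> 'k. x \<in> lp p \<Longrightarrow> of_blocks p A (to_blocks p A x) = x"
    using iso by (auto simp: isom_pair_def)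
  have "to_blocks p A x = 0 \<longleftrightarrow> x = 0" if "x \<in> lp p" for x :: "nat \<Rightarrow> 'k"
    using T(3)[OF that] T(3)[OF fs.subspace_0[OF sub]] lin_on_0[OF T(1) sub] by metis
  then show "norm_on_lp p (renorm p A :: (nat \<Rightarrow> 'k) \<Rightarrow> real)"
    unfolding nrm_on_lp_iff nrm_on_def renorm_def
    by (simp add: T(2) B.eq_0_iff lin_on_smul[OF T(1)] lin_on_add[OF T(1)] B.scale B.triangle)
  obtain C where C: "C > 0" "\<And>x :: nat \<Rightarrow> 'k. x \<in> lp p \<Longrightarrow> renorm p A x \<le> C * lp_norm p x"
    "\<And>x :: nat \<Rightarrow> 'k. x \<in> lp p \<Longrightarrow> lp_norm p x \<le> C * renorm p A x"
    using renorm_bounds[where 'k = 'k] by blast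
  have "1 / C * lp_norm p x \<le> renorm p A x" if "x \<in> lp p" for x :: "nat \<Rightarrow> 'k"
    using C(1) C(3)[OF that] by (simp add: field_simps)
  then show "\<exists>a>0. \<exists>b>0. \<forall>x\<in>lp p :: (nat \<Rightarrow> 'k) set. a * lp_norm p x \<le> renorm p A x \<and> renorm p A x \<le> b * lp_norm p x"
    using C(1,2) by (intro exI[of _ "1 / C"] conjI exI[of _ C]) auto
qed

text \<open>Conjugation by \<open>to_blocks\<close> turns isometries of the block sum into elements
  of \<open>Isom p (renorm p A)\<close>, so invariance of M under the latter becomes invariance of
  the transported norm.\<close>

lemma block_invariant_pullback:
  fixes M :: "(nat \<Rightarrow> 'k::scalar_field) \<Rightarrow> real"
  assumes p2: "p \<noteq> 2" and M: "equivalent_norm p M"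
    and inv: "\<And>U x. U \<in> Isom p (renorm p A) \<Longrightarrow> x \<in> lp p \<Longrightarrow> M (U x) = M x"
  shows "block_invariant p (dims_of A) (\<lambda>y. M (of_blocks p A y))"
proof
  note iso = blocks_isom[where 'k = 'k]
  have p1: "1 \<le> p" using p by simp
  have sub: "fs.subspace (lp p :: (nat \<Rightarrow> 'k) set)" using p by (intro lp_subspace) simp
  have isub: "fs.subspace (bsp p (dims_of A) :: (_ \<Rightarrow> 'k) set)" by (rule bsp_subspace[OF p1])
  note iso' = isom_pair_sym[OF iso sub]
  have T: "lin_on (lp p) (to_blocks p A :: (nat \<Rightarrow> 'k) \<Rightarrow> _)"
    "\<And>x :: nat \<Rightarrow> 'k. x \<in> lp p \<Longrightarrow> to_blocks p A x \<in> bsp p (dims_of A)"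
    "\<And>x :: nat \<Rightarrow> 'k. x \<in> lp p \<Longrightarrow> of_blocks p A (to_blocks p A x) = x"
    using iso by (auto simp: isom_pair_def)
  have S: "lin_on (bsp p (dims_of A)) (of_blocks p A :: (_ \<Rightarrow> 'k) \<Rightarrow> _)"
    "\<And>y :: _ \<Rightarrow> 'k. y \<in> bsp p (dims_of A) \<Longrightarrow> of_blocks p A y \<in> lp p"
    "\<And>y :: _ \<Rightarrow> 'k. y \<in> bsp p (dims_of A) \<Longrightarrow> to_blocks p A (of_blocks p A y) = y"
    "\<And>y :: _ \<Rightarrow> 'k. y \<in> bsp p (dims_of A) \<Longrightarrow> renorm p A (of_blocks p A y) = bnorm p (dims_of A) y"
    using iso' by (auto simp: isom_pair_def)
  from M obtain a b where nM: "nrm_on (lp p) M" and ab: "a > 0" "b > 0"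
    "\<And>x. x \<in> lp p \<Longrightarrow> a * lp_norm p x \<le> M x" "\<And>x. x \<in> lp p \<Longrightarrow> M x \<le> b * lp_norm p x"
    by (auto simp: equivalent_norm_def nrm_on_lp_iff)
  interpret X: normed_subspace "lp p :: (nat \<Rightarrow> 'k) set" M by unfold_locales (fact sub nM)+
  show "1 < p" "p \<noteq> 2" by fact+
  show "3 \<le> dims_of A c" "infinite {d. dims_of A d = dims_of A c}" for c
    by (rule dims_of_ge infinite_dims_of)+
  have "of_blocks p A y = 0 \<longleftrightarrow> y = 0" if "y \<in> bsp p (dims_of A)" for y :: "_ \<Rightarrow> 'k"
    using S(3)[OF that] S(3)[OF fs.subspace_0[OF isub]] lin_on_0[OF S(1) isub] by metis
  then show "nrm_on (bsp p (dims_of A)) (\<lambda>y. M (of_blocks p A y))"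
    unfolding nrm_on_def
    by (simp add: S(2) X.nonneg X.eq_0_iff lin_on_smul[OF S(1)] lin_on_add[OF S(1)] X.scale X.triangle)
  obtain C where C: "C > 0" "\<And>x :: nat \<Rightarrow> 'k. x \<in> lp p \<Longrightarrow> renorm p A x \<le> C * lp_norm p x"
    "\<And>x :: nat \<Rightarrow> 'k. x \<in> lp p \<Longrightarrow> lp_norm p x \<le> C * renorm p A x"
    using renorm_bounds[where 'k = 'k] by blast
  have "a / C * bnorm p (dims_of A) y \<le> M (of_blocks p A y)" "M (of_blocks p A y) \<le> b * C * bnorm p (dims_of A) y"
    if "y \<in> bsp p (dims_of A)" for y
  proof -
    let ?x = "of_blocks p A y"
    have "bnorm p (dims_of A) y \<le> C * lp_norm p ?x" "lp_norm p ?x \<le> C * bnorm p (dims_of A) y"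
      using C(2,3)[OF S(2)[OF that]] S(4)[OF that] by simp_all
    then have "a / C * bnorm p (dims_of A) y \<le> a / C * (C * lp_norm p ?x)" "b * lp_norm p ?x \<le> b * (C * bnorm p (dims_of A) y)"
      using ab(1,2) C(1) by (intro mult_left_mono; simp)+
    then show "a / C * bnorm p (dims_of A) y \<le> M ?x" "M ?x \<le> b * C * bnorm p (dims_of A) y"
      using ab(3,4)[OF S(2)[OF that]] C(1) by (simp_all add: mult.assoc)
  qed
  then show "\<exists>a>0. \<exists>b>0. \<forall>y\<in>bsp p (dims_of A). a * bnorm p (dims_of A) y \<le> M (of_blocks p A y)
      \<and> M (of_blocks p A y) \<le> b * bnorm p (dims_of A) y"
    using ab C(1) by (intro exI[of _ "a / C"] conjI exI[of _ "b * C"]) auto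
  fix U U' :: "(((nat \<times> nat) + nat) \<times> nat \<Rightarrow> 'k) \<Rightarrow> (((nat \<times> nat) + nat) \<times> nat \<Rightarrow> 'k)"
    and y :: "((nat \<times> nat) + nat) \<times> nat \<Rightarrow> 'k"
  assume U: "isom_pair (bsp p (dims_of A)) (bnorm p (dims_of A)) (bsp p (dims_of A)) (bnorm p (dims_of A)) U U'"
    and y: "y \<in> bsp p (dims_of A)"
  \<comment> \<open>\<open>Isom\<close> contains extensional functions only, hence the
    restriction.\<close>
  define W where "W = restrict (\<lambda>x. of_blocks p A (U (to_blocks p A x))) (lp p)"
  have W: "isom_pair (lp p) (renorm p A) (lp p) (renorm p A)
      (\<lambda>x. of_blocks p A (U (to_blocks p A x))) (\<lambda>x. of_blocks p A (U' (to_blocks p A x)))"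
    by (rule isom_pair_comp[OF isom_pair_comp[OF iso U] iso'])
  have "W \<in> Isom p (renorm p A)"
    unfolding Isom_def lin_on_lp_iff
  proof (safe)
    show "W \<in> extensional (lp p)" by (simp add: W_def)
    show "lin_on (lp p) W"
      using W X.V_add X.V_scale by (auto simp: isom_pair_def lin_on_def W_def)
    show "renorm p A (W x) = renorm p A x" if "x \<in> lp p" for x
      using W that by (simp add: isom_pair_def W_def)
    show "W x \<in> lp p" if "x \<in> lp p" for x
      using W that by (simp add: isom_pair_def W_def)
    show "x \<in> W ` lp p" if "x \<in> lp p" for x
      using W that by (intro image_eqI[of _ _ "of_blocks p A (U' (to_blocks p A x))"]) (auto simp: isom_pair_def W_def)
  qed
  from inv[OF this S(2)[OF y]] show "M (of_blocks p A (U y)) = M (of_blocks p A y)"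
    by (simp add: W_def S(2,3) y)
qed

lemma Isom_isom_pair:
  assumes "equivalent_norm p M" "U \<in> Isom p M"
  shows "isom_pair (lp p) M (lp p) M U (inv_into (lp p) U)"
proof -
  have sub: "fs.subspace (lp p :: (nat \<Rightarrow> 'a) set)" using p by (intro lp_subspace) simp
  interpret X: normed_subspace "lp p" M
    using assms(1) sub by unfold_locales (simp_all add: equivalent_norm_def nrm_on_lp_iff)
  have U: "U ` lp p = lp p" "lin_on (lp p) U" "\<And>x. x \<in> lp p \<Longrightarrow> M (U x) = M x"
    using assms(2) by (auto simp: Isom_def lin_on_lp_iff)
  have inj: "inj_on U (lp p)"
  proof (rule inj_onI)
    fix x y assume xy: "x \<in> lp p" "y \<in> lp p" "U x = U y"
    then have "M (U (x - y)) = 0" using lin_on_diff[OF sub U(2)] X.eq_0_iff[OF X.V_0] by simp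
    then have "x - y = 0" using U(3)[of "x - y"] X.V_diff X.eq_0_iff xy by simp
    then show "x = y" by simp
  qed
  have V: "U x \<in> lp p" if "x \<in> lp p" for x using U(1) that by blast
  have I: "inv_into (lp p) U x \<in> lp p" "U (inv_into (lp p) U x) = x" if "x \<in> lp p" for x
    using that U(1) by (metis inv_into_into, metis f_inv_into_f)
  show ?thesis
    unfolding isom_pair_def using U V I inj by (simp add: inv_into_f_f)
qed

text \<open>The inclusion of groups makes the pullback of M block invariant. An isometry of M then
  becomes an isometry of this pullback, so it preserves \<open>bnorm\<close>, which is the renorming
  seen on the block sum.\<close>

lemma maximal_Isom_renorm:
  assumes p2: "p \<noteq> 2"
  shows "maximal_Isom p (renorm p A :: (nat \<Rightarrow> 'k::scalar_field) \<Rightarrow> real)"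
  unfolding maximal_Isom_def
proof (intro allI impI Set.equalityI)
  fix M :: "(nat \<Rightarrow> 'k) \<Rightarrow> real"
  assume M: "equivalent_norm p M" and sub: "Isom p (renorm p A) \<subseteq> Isom p M"
  note iso = blocks_isom[where 'k = 'k]
  have X: "fs.subspace (lp p :: (nat \<Rightarrow> 'k) set)" using p by (intro lp_subspace) simp
  note iso' = isom_pair_sym[OF iso X]
  let ?M = "\<lambda>y. M (of_blocks p A y)"
  have bi: "block_invariant p (dims_of A) ?M"
    using sub by (intro block_invariant_pullback p2 M) (auto simp: Isom_def)
  show "Isom p M \<subseteq> Isom p (renorm p A)"
  proof
    fix U assume U: "U \<in> Isom p M"
    have "isom_pair (lp p) M (bsp p (dims_of A)) ?M (to_blocks p A) (of_blocks p A)"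
      using iso by (simp add: isom_pair_def)
    note i = this isom_pair_sym[OF this X]
    have "isom_pair (bsp p (dims_of A)) ?M (bsp p (dims_of A)) ?M
        (\<lambda>y. to_blocks p A (U (of_blocks p A y))) (\<lambda>y. to_blocks p A (inv_into (lp p) U (of_blocks p A y)))"
      by (rule isom_pair_comp[OF isom_pair_comp[OF i(2) Isom_isom_pair[OF M U]] i(1)])
    then have bI: "block_isometry p (dims_of A) ?M (dims_of A) ?M
        (\<lambda>y. to_blocks p A (U (of_blocks p A y))) (\<lambda>y. to_blocks p A (inv_into (lp p) U (of_blocks p A y)))"
      using bi by (simp add: block_isometry_def block_isometry_axioms_def)
    have "renorm p A (U x) = renorm p A x" if "x \<in> lp p" for x
      using block_isometry_preserves_bnorm[OF bI, of "to_blocks p A x"] iso that by (simp add: renorm_def isom_pair_def)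
    then show "U \<in> Isom p (renorm p A)" using U by (simp add: Isom_def)
  qed
qed (assumption)

end

text \<open>The norm \<open>renorm p B\<close> composed with t is equivalent to the original one and
  invariant under the isometries of \<open>renorm p A\<close>. With respect to it t is an isometry
  onto (\<open>lp p\<close>, \<open>renorm p B\<close>), hence a block isometry between the two
  sums, and their sets of dimensions agree.\<close>

lemma renorm_intertwined_imp_eq:
  fixes t :: "(nat \<Rightarrow> 'k::scalar_field) \<Rightarrow> (nat \<Rightarrow> 'k)"
  assumes p: "1 < p" "p \<noteq> 2" and lin: "lin_on (lp p) t" and bij: "bij_betw t (lp p) (lp p)"
    and C: "\<And>x. x \<in> lp p \<Longrightarrow> lp_norm p (t x) \<le> C * lp_norm p x"
    and C': "\<And>x. x \<in> lp p \<Longrightarrow> lp_norm p x \<le> C' * lp_norm p (t x)"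
    and inv: "\<And>U x. U \<in> Isom p (renorm p A) \<Longrightarrow> x \<in> lp p \<Longrightarrow> renorm p B (t (U x)) = renorm p B (t x)"
  shows "A = B"
proof -
  have X: "fs.subspace (lp p :: (nat \<Rightarrow> 'k) set)" using p by (intro lp_subspace) simp
  let ?N = "\<lambda>x. renorm p B (t x)"
  have tX: "t x \<in> lp p" if "x \<in> lp p" for x using bij that by (auto simp: bij_betw_def)
  have sX: "inv_into (lp p) t x \<in> lp p" if "x \<in> lp p" for x using bij that by (metis bij_betw_def inv_into_into)
  have it: "isom_pair (lp p) ?N (lp p) (renorm p B) t (inv_into (lp p) t)"
    using lin tX sX bij by (auto simp: isom_pair_def bij_betw_inv_into_left bij_betw_inv_into_right)
  have eB: "equivalent_norm p (renorm p B :: (nat \<Rightarrow> 'k) \<Rightarrow> real)" by (rule equivalent_norm_renorm[OF p(1)])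
  then obtain a b where ab: "a > 0" "b > 0" "\<And>x :: nat \<Rightarrow> 'k. x \<in> lp p \<Longrightarrow> a * lp_norm p x \<le> renorm p B x"
    "\<And>x :: nat \<Rightarrow> 'k. x \<in> lp p \<Longrightarrow> renorm p B x \<le> b * lp_norm p x"
    and nB: "nrm_on (lp p) (renorm p B :: (nat \<Rightarrow> 'k) \<Rightarrow> real)"
    by (auto simp: equivalent_norm_def nrm_on_lp_iff)
  interpret B: normed_subspace "lp p :: (nat \<Rightarrow> 'k) set" "renorm p B" by unfold_locales (fact X nB)+
  have eN: "equivalent_norm p ?N"
    unfolding equivalent_norm_def nrm_on_lp_iff
  proof
    have "t x = 0 \<longleftrightarrow> x = 0" if "x \<in> lp p" for x
      using bij_betw_imp_inj_on[OF bij] that B.V_0 lin_on_0[OF lin X] by (metis inj_on_eq_iff)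
    then show "nrm_on (lp p) ?N"
      unfolding nrm_on_def
      by (simp add: tX B.nonneg B.eq_0_iff lin_on_smul[OF lin] lin_on_add[OF lin] B.scale B.triangle)
    \<comment> \<open>The given constants carry no sign, so |C| + 1 and |C'| + 1 serve as positive
      ones.\<close>
    have "a / (\<bar>C'\<bar> + 1) * lp_norm p x \<le> ?N x" "?N x \<le> b * (\<bar>C\<bar> + 1) * lp_norm p x" if x: "x \<in> lp p" for x
    proof -
      have l0: "0 \<le> lp_norm p y" for y :: "nat \<Rightarrow> 'k" by (simp add: lp_norm_def)
      have "lp_norm p x \<le> (\<bar>C'\<bar> + 1) * lp_norm p (t x)"
        by (rule order_trans[OF C'[OF x] mult_right_mono]) (auto simp: l0)
      then have "lp_norm p x / (\<bar>C'\<bar> + 1) \<le> lp_norm p (t x)"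
        by (simp add: pos_divide_le_eq add_nonneg_pos mult.commute)
      from mult_left_mono[OF this, of a] have "a / (\<bar>C'\<bar> + 1) * lp_norm p x \<le> a * lp_norm p (t x)"
        using ab(1) by simp
      then show "a / (\<bar>C'\<bar> + 1) * lp_norm p x \<le> ?N x" using ab(3)[OF tX[OF x]] by simp
      have "lp_norm p (t x) \<le> (\<bar>C\<bar> + 1) * lp_norm p x"
        by (rule order_trans[OF C[OF x] mult_right_mono]) (auto simp: l0)
      then have "b * lp_norm p (t x) \<le> b * ((\<bar>C\<bar> + 1) * lp_norm p x)"
        using ab(2) by (intro mult_left_mono) auto
      then show "?N x \<le> b * (\<bar>C\<bar> + 1) * lp_norm p x" using ab(4)[OF tX[OF x]] by (simp add: mult.assoc)
    qed
    then show "\<exists>a>0. \<exists>b>0. \<forall>x\<in>lp p. a * lp_norm p x \<le> ?N x \<and> ?N x \<le> b * lp_norm p x"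
      using ab by (intro exI[of _ "a / (\<bar>C'\<bar> + 1)"] conjI exI[of _ "b * (\<bar>C\<bar> + 1)"]) auto
  qed
  let ?NA = "\<lambda>y. ?N (of_blocks p A y)"
  have biA: "block_invariant p (dims_of A) ?NA"
    by (rule block_invariant_pullback[OF p(1,2) eN]) (rule inv)
  have biB: "block_invariant p (dims_of B) (\<lambda>y :: _ \<Rightarrow> 'k. renorm p B (of_blocks p B y))"
    by (rule block_invariant_pullback[OF p(1,2) eB]) (simp add: Isom_def)
  have iA: "isom_pair (bsp p (dims_of A)) ?NA (lp p) ?N (of_blocks p A) (to_blocks p A)"
  proof (rule isom_pair_sym[OF _ X])
    show "isom_pair (lp p) ?N (bsp p (dims_of A)) ?NA (to_blocks p A) (of_blocks p A)"
      using blocks_isom[OF p(1), where 'k = 'k and A = A] by (simp add: isom_pair_def)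
  qed
  have iB: "isom_pair (lp p) (renorm p B) (bsp p (dims_of B)) (\<lambda>y :: _ \<Rightarrow> 'k. renorm p B (of_blocks p B y)) (to_blocks p B) (of_blocks p B)"
    using blocks_isom[OF p(1), where 'k = 'k and A = B] by (simp add: isom_pair_def)
  from isom_pair_comp[OF isom_pair_comp[OF iA it] iB]
  have "block_isometry p (dims_of A) ?NA (dims_of B) (\<lambda>y. renorm p B (of_blocks p B y))
      (\<lambda>y. to_blocks p B (t (of_blocks p A y))) (\<lambda>y. to_blocks p A (inv_into (lp p) t (of_blocks p B y)))"
    using biA biB by (simp add: block_isometry_def block_isometry_axioms_def)
  from block_isometry.range_dims_eq[OF this] show "A = B" by (rule range_dims_of_inj)
qed

section \<open>The group of isomorphisms and conjugacy\<close>

lemma GL_lp_carrier: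
  "T \<in> carrier (GL_lp p) \<longleftrightarrow> T \<in> Bij (lp p) \<and> lin_on (lp p) T \<and>
     (\<exists>C. \<forall>x\<in>lp p. lp_norm p (T x) \<le> C * lp_norm p x) \<and> (\<exists>C. \<forall>x\<in>lp p. lp_norm p x \<le> C * lp_norm p (T x))"
  by (simp add: GL_lp_def lin_on_lp_iff)

lemma lp_norm_nonneg: "0 \<le> lp_norm p x"
  by (simp add: lp_norm_def)

text \<open>Conjugacy involves inverses formed inside \<open>GL_lp p\<close>; cancelling them
  requires the group laws, inherited from \<open>BijGroup\<close> as for any subgroup.\<close>

lemma group_GL_lp:
  assumes "0 < p"
  shows "group (GL_lp p :: ((nat \<Rightarrow> 'k::real_normed_field) \<Rightarrow> _) monoid)"
proof -
  let ?G = "BijGroup (lp p :: (nat \<Rightarrow> 'k) set)"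
  let ?H = "carrier (GL_lp p) :: ((nat \<Rightarrow> 'k) \<Rightarrow> (nat \<Rightarrow> 'k)) set"
  have X: "fs.subspace (lp p :: (nat \<Rightarrow> 'k) set)" by (rule lp_subspace[OF assms])
  note Xs = fs.subspace_add[OF X] fs.subspace_scale[OF X]
  have "subgroup ?H ?G"
  proof (rule group.subgroupI[OF group_BijGroup])
    show "?H \<subseteq> carrier ?G" by (auto simp: GL_lp_carrier BijGroup_def)
    have "(\<lambda>x\<in>lp p. x) \<in> ?H"
      unfolding GL_lp_carrier using Xs
      by (auto simp: id_Bij lin_on_def intro!: exI[of _ 1])
    then show "?H \<noteq> {}" by blast
  next
    fix T assume T: "T \<in> ?H"
    then have B: "bij_betw T (lp p) (lp p)" by (simp add: GL_lp_carrier Bij_def)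
    let ?I = "\<lambda>x\<in>lp p. inv_into (lp p) T x"
    have lin: "lin_on (lp p) T" using T by (simp add: GL_lp_carrier)
    have IX: "inv_into (lp p) T x \<in> lp p" "T (inv_into (lp p) T x) = x" if "x \<in> lp p" for x
      using B that by (metis bij_betw_def inv_into_into, metis bij_betw_inv_into_right)
    have TX: "T x \<in> lp p" if "x \<in> lp p" for x using B that by (auto simp: bij_betw_def)
    have "isom_pair (lp p) (\<lambda>x. lp_norm p (T x)) (lp p) (lp_norm p) T (inv_into (lp p) T)"
      using lin IX TX B by (simp add: isom_pair_def bij_betw_inv_into_left)
    from isom_pair_sym[OF this X] have "lin_on (lp p) (inv_into (lp p) T)" by (simp add: isom_pair_def)
    then have "lin_on (lp p) ?I" using Xs by (simp add: lin_on_def)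
    moreover have "\<exists>C. \<forall>x\<in>lp p. lp_norm p (?I x) \<le> C * lp_norm p x"
      using T IX by (metis (no_types, lifting) GL_lp_carrier restrict_apply')
    moreover have "\<exists>C. \<forall>x\<in>lp p. lp_norm p x \<le> C * lp_norm p (?I x)"
      using T IX by (metis (no_types, lifting) GL_lp_carrier restrict_apply')
    moreover have "?I \<in> Bij (lp p)" using T by (intro restrict_inv_into_Bij) (simp add: GL_lp_carrier)
    ultimately have "?I \<in> ?H" by (simp add: GL_lp_carrier)
    then show "inv\<^bsub>?G\<^esub> T \<in> ?H" using T by (subst inv_BijGroup) (auto simp: GL_lp_carrier)
  next
    fix T U assume TU: "T \<in> ?H" "U \<in> ?H"
    then have B: "T \<in> Bij (lp p)" "U \<in> Bij (lp p)" by (auto simp: GL_lp_carrier)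
    then have UX: "U x \<in> lp p" if "x \<in> lp p" for x
      using that by (auto simp: Bij_def bij_betw_def)
    obtain C D where C: "\<And>x. x \<in> lp p \<Longrightarrow> lp_norm p (T x) \<le> C * lp_norm p x" "\<And>x. x \<in> lp p \<Longrightarrow> lp_norm p x \<le> D * lp_norm p (T x)"
      using TU(1) by (auto simp: GL_lp_carrier)
    obtain C' D' where C': "\<And>x. x \<in> lp p \<Longrightarrow> lp_norm p (U x) \<le> C' * lp_norm p x" "\<And>x. x \<in> lp p \<Longrightarrow> lp_norm p x \<le> D' * lp_norm p (U x)"
      using TU(2) by (auto simp: GL_lp_carrier)
    have "lp_norm p (T (U x)) \<le> \<bar>C\<bar> * C' * lp_norm p x" if x: "x \<in> lp p" for x
    proof -
      have "lp_norm p (T (U x)) \<le> C * lp_norm p (U x)" by (rule C(1)[OF UX[OF x]])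
      also have "\<dots> \<le> \<bar>C\<bar> * lp_norm p (U x)" by (rule mult_right_mono[OF abs_ge_self lp_norm_nonneg])
      also have "\<dots> \<le> \<bar>C\<bar> * (C' * lp_norm p x)" by (rule mult_left_mono[OF C'(1)[OF x]]) simp
      finally show ?thesis by (simp add: mult.assoc)
    qed
    moreover have "lp_norm p x \<le> \<bar>D'\<bar> * D * lp_norm p (T (U x))" if x: "x \<in> lp p" for x
    proof -
      have "lp_norm p x \<le> D' * lp_norm p (U x)" by (rule C'(2)[OF x])
      also have "\<dots> \<le> \<bar>D'\<bar> * lp_norm p (U x)" by (rule mult_right_mono[OF abs_ge_self lp_norm_nonneg])
      also have "\<dots> \<le> \<bar>D'\<bar> * (D * lp_norm p (T (U x)))" by (rule mult_left_mono[OF C(2)[OF UX[OF x]]]) simp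
      finally show ?thesis by (simp add: mult.assoc)
    qed
    moreover have "lin_on (lp p) (compose (lp p) T U)"
      using TU UX Xs by (simp add: GL_lp_carrier lin_on_def compose_def)
    ultimately have "compose (lp p) T U \<in> ?H"
      unfolding GL_lp_carrier using compose_Bij[OF B] by (auto simp: compose_def)
    then show "T \<otimes>\<^bsub>?G\<^esub> U \<in> ?H" using B by (simp add: BijGroup_def)
  qed
  moreover have "GL_lp p = ?G\<lparr>carrier := ?H\<rparr>" by (simp add: GL_lp_def)
  ultimately show ?thesis using subgroup.subgroup_is_group[OF _ group_BijGroup] by metis
qed

lemma GL_lp_mult: "T \<in> carrier (GL_lp p) \<Longrightarrow> U \<in> carrier (GL_lp p) \<Longrightarrow> T \<otimes>\<^bsub>GL_lp p\<^esub> U = compose (lp p) T U"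
  by (simp add: GL_lp_def BijGroup_def)

lemma Isom_subset_GL_lp:
  assumes p: "1 < p" and M: "equivalent_norm p M"
  shows "Isom p M \<subseteq> carrier (GL_lp p)"
proof
  fix U assume U: "U \<in> Isom p M"
  note i = Isom_isom_pair[OF p M U]
  obtain a b where ab: "a > 0" "b > 0" "\<And>x. x \<in> lp p \<Longrightarrow> a * lp_norm p x \<le> M x" "\<And>x. x \<in> lp p \<Longrightarrow> M x \<le> b * lp_norm p x"
    using M by (auto simp: equivalent_norm_def)
  have UX: "U x \<in> lp p" "M (U x) = M x" if "x \<in> lp p" for x using i that by (auto simp: isom_pair_def)
  have "lp_norm p (U x) \<le> b / a * lp_norm p x" "lp_norm p x \<le> b / a * lp_norm p (U x)" if "x \<in> lp p" for x
    using ab(3,4)[OF that] ab(3,4)[OF UX(1)[OF that]] UX(2)[OF that] ab(1) by (simp_all add: field_simps)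
  moreover have "bij_betw U (lp p) (lp p)"
    by (rule bij_betw_byWitness[of _ "inv_into (lp p) U"]) (use i in \<open>auto simp: isom_pair_def\<close>)
  ultimately show "U \<in> carrier (GL_lp p)"
    using U unfolding GL_lp_carrier Bij_def Isom_def lin_on_lp_iff by blast
qed

lemma conjugate_in_imp_eq:
  assumes p: "1 < p" "p \<noteq> 2"
    and conj: "conjugate_in (GL_lp p) (Isom p (renorm p A :: (nat \<Rightarrow> 'k::scalar_field) \<Rightarrow> real)) (Isom p (renorm p B))"
  shows "A = B"
proof -
  let ?G = "GL_lp p :: ((nat \<Rightarrow> 'k) \<Rightarrow> _) monoid"
  interpret G: group ?G using p by (intro group_GL_lp) simp
  obtain t where t: "t \<in> carrier ?G"
    and eq: "Isom p (renorm p A) = inv\<^bsub>?G\<^esub> t <#\<^bsub>?G\<^esub> (Isom p (renorm p B) #>\<^bsub>?G\<^esub> t)"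
    using conj by (auto simp: conjugate_in_def)
  have tB: "bij_betw t (lp p) (lp p)" "lin_on (lp p) t" using t by (auto simp: GL_lp_carrier Bij_def)
  obtain C C' where C: "\<And>x. x \<in> lp p \<Longrightarrow> lp_norm p (t x) \<le> C * lp_norm p x" "\<And>x. x \<in> lp p \<Longrightarrow> lp_norm p x \<le> C' * lp_norm p (t x)"
    using t by (auto simp: GL_lp_carrier)
  show "A = B"
  proof (rule renorm_intertwined_imp_eq[OF p tB(2,1) C])
    fix U :: "(nat \<Rightarrow> 'k) \<Rightarrow> (nat \<Rightarrow> 'k)" and x :: "nat \<Rightarrow> 'k" assume U: "U \<in> Isom p (renorm p A)" and x: "x \<in> lp p"
    obtain g where g: "g \<in> Isom p (renorm p B)" and Ug: "U = inv\<^bsub>?G\<^esub> t \<otimes>\<^bsub>?G\<^esub> (g \<otimes>\<^bsub>?G\<^esub> t)"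
      using U unfolding eq by (auto simp: l_coset_def r_coset_def)
    have gG: "g \<in> carrier ?G" using g Isom_subset_GL_lp[OF p(1) equivalent_norm_renorm[OF p(1)]] by blast
    have UG: "U \<in> carrier ?G" using U Isom_subset_GL_lp[OF p(1) equivalent_norm_renorm[OF p(1)]] by blast
    \<comment> \<open>Once the inverse is cancelled, t intertwines U with an isometry g of
      \<open>renorm p B\<close>; so \<open>renorm p B\<close> composed with t is invariant under
      U.\<close>
    have "t \<otimes>\<^bsub>?G\<^esub> U = g \<otimes>\<^bsub>?G\<^esub> t"
      unfolding Ug using t gG by (simp add: G.m_assoc[symmetric])
    then have "compose (lp p) t U = compose (lp p) g t" using t gG UG by (simp add: GL_lp_mult)
    then have "compose (lp p) t U x = compose (lp p) g t x" by simp
    then have "t (U x) = g (t x)" using x by (simp add: compose_def)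
    moreover have "t x \<in> lp p" using tB(1) x by (auto simp: bij_betw_def)
    ultimately show "renorm p B (t (U x)) = renorm p B (t x)" using g by (simp add: Isom_def)
  qed
qed

lemma continuum_of_renormings:
  assumes p: "1 < p" "p \<noteq> 2"
  shows "\<exists>F :: ((nat \<Rightarrow> 'k::scalar_field) \<Rightarrow> real) set.
            F \<approx> (UNIV :: real set) \<and>
            (\<forall>N\<in>F. equivalent_norm p N \<and> maximal_Isom p N) \<and>
            pairwise (\<lambda>M N. \<not> conjugate_in (GL_lp p) (Isom p M) (Isom p N)) F"
proof (intro exI conjI)
  let ?F = "range (renorm p) :: ((nat \<Rightarrow> 'k) \<Rightarrow> real) set"
  have "inj (renorm p :: _ \<Rightarrow> (nat \<Rightarrow> 'k) \<Rightarrow> real)"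
  proof (rule injI)
    fix A B assume eq: "renorm p A = (renorm p B :: (nat \<Rightarrow> 'k) \<Rightarrow> real)"
    \<comment> \<open>Equal renormings are intertwined by the identity, so distinct sets give
      distinct norms and the family has the cardinality of the power set of the natural
      numbers.\<close>
    show "A = B"
      by (rule renorm_intertwined_imp_eq[OF p, of "\<lambda>x. x :: nat \<Rightarrow> 'k" 1 1]) (auto simp: lin_on_def eq Isom_def bij_betw_def)
  qed
  then have "?F \<approx> (UNIV :: nat set set)"
    using inj_on_image_eqpoll_self by blast
  then show "?F \<approx> (UNIV :: real set)" using nat_sets_eqpoll_reals eqpoll_trans by blast
  show "\<forall>N\<in>?F. equivalent_norm p N \<and> maximal_Isom p N"
    using equivalent_norm_renorm[OF p(1)] maximal_Isom_renorm[OF p] by auto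
  show "pairwise (\<lambda>M N. \<not> conjugate_in (GL_lp p) (Isom p M) (Isom p N)) ?F"
    using conjugate_in_imp_eq[OF p] unfolding pairwise_def by blast
qed

theorem theorem3p9:
  fixes p :: real
  assumes "1 < p" and "p \<noteq> 2"
  shows "(\<exists>F :: ((nat \<Rightarrow> real) \<Rightarrow> real) set.
            F \<approx> (UNIV :: real set) \<and>
            (\<forall>N\<in>F. equivalent_norm p N \<and> maximal_Isom p N) \<and>
            pairwise (\<lambda>M N. \<not> conjugate_in (GL_lp p) (Isom p M) (Isom p N)) F) \<and>
         (\<exists>F :: ((nat \<Rightarrow> complex) \<Rightarrow> real) set.
            F \<approx> (UNIV :: real set) \<and>
            (\<forall>N\<in>F. equivalent_norm p N \<and> maximal_Isom p N) \<and>
            pairwise (\<lambda>M N. \<not> conjugate_in (GL_lp p) (Isom p M) (Isom p N)) F)"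
  by (intro conjI continuum_of_renormings assms)

end
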